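(* Let $\varepsilon\in\{1,-1\}$ and let $\gamma_1,\gamma_2,\nu_1,\nu_2,\lambda,\mu,\beta_1,\beta_2$ be smooth functions defined in a domain $\mathcal{D}\subset\mathbb{R}^2$ with coordinates $(u,v)$, with $\mu\ne0$ and $\nu_1-\nu_2>0$ everywhere, and satisfying $$\frac{\mu_u}{2\mu\gamma_2-\varepsilon\lambda\beta_1+\varepsilon\nu_1\beta_2}>0,\qquad \frac{\mu_v}{2\mu\gamma_1+\varepsilon\nu_2\beta_1-\varepsilon\lambda\beta_2}>0,$$ $$-\gamma_1\sqrt{E}\sqrt{-G}=(\sqrt{E})_v,\qquad -\gamma_2\sqrt{E}\sqrt{-G}=(\sqrt{-G})_u,$$ $$2\lambda\gamma_2-\varepsilon\mu\beta_1-(\nu_1+\nu_2)\gamma_1=\frac1{\sqrt{E}}\lambda_u-\frac1{\sqrt{-G}}(\nu_1)_v,$$ $$2\lambda\gamma_1-\varepsilon\mu\beta_2-(\nu_1+\nu_2)\gamma_2=-\frac1{\sqrt{E}}(\nu_2)_u+\frac1{\sqrt{-G}}\lambda_v,$$ $$\gamma_1\beta_1-\gamma_2\beta_2+(\nu_1+\nu_2)\mu=-\frac1{\sqrt{E}}(\beta_2)_u+\frac1{\sqrt{-G}}(\beta_1)_v,$$ $$\varepsilon(\lambda^2-\mu^2-\nu_1\nu_2)=\frac1{\sqrt{E}}(\gamma_2)_u-\frac1{\sqrt{-G}}(\gamma_1)_v+(\gamma_1)^2-(\gamma_2)^2,$$ where $\sqrt{E}$ and $\sqrt{-G}$ denote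 the functions $$\sqrt{E}=\frac{\mu_u}{2\mu\gamma_2-\varepsilon\lambda\beta_1+\varepsilon\nu_1\beta_2},\qquad \sqrt{-G}=\frac{\mu_v}{2\mu\gamma_1+\varepsilon\nu_2\beta_1-\varepsilon\lambda\beta_2}.$$ Let $(u_0,v_0)\in\mathcal{D}$, $p_0\in\mathbb{E}^4_2$, and let $\{x_0,y_0,b_0,l_0\}$ be an orthonormal frame at $p_0$ with $\langle x_0,x_0\rangle=1$, $\langle y_0,y_0\rangle=-1$, $\langle b_0,b_0\rangle=\varepsilon$, $\langle l_0,l_0\rangle=-\varepsilon$, such that $(x_0,y_0,b_0,l_0)$ is positively oriented if $\varepsilon=1$ and $(x_0,y_0,l_0,b_0)$ is positively oriented if $\varepsilon=-1$. Then there exist a subdomain $\mathcal{D}_0\subset\mathcal{D}$ containing $(u_0,v_0)$ and a unique Lorentz surface $M^2_1:z=z(u,v)$, $(u,v)\in\mathcal{D}_0$, whose mean curvature vector at every point is a non-zero spacelike vector if $\varepsilon=1$, or a timelike vector if $\varepsilon=-1$, such that $z(u_0,v_0)=p_0$, the functions $\gamma_1,\gamma_2,\nu_1,\nu_2,\lambda,\mu,\beta_1,\beta_2$ are the geometric functions of $M^2_1$, and $\{x_0,y_0,b_0,l_0\}$ is the geometric frame of $M^2_1$ at the point $p_0$.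
   Context: $\mathbb{E}^4_2$ is $\mathbb{R}^4$ with the standard orientation and the metric $\langle\cdot,\cdot\rangle=dx_1^2+dx_2^2-dx_3^2-dx_4^2$; $\nabla'$ is its Levi-Civita connection. A Lorentz surface $M^2_1:z=z(u,v)$, $(u,v)$ in a domain of $\mathbb{R}^2$, is a smooth immersed surface whose induced metric has signature $(1,1)$. $\sigma$ is its second fundamental form (normal part of $\nabla'_XY$), and $H=\frac12\operatorname{tr}\sigma=\frac12(\sigma(x,x)-\sigma(y,y))$ for tangent orthonormal $x,y$ with $\langle x,x\rangle=1$, $\langle y,y\rangle=-1$. Write $E=\langle z_u,z_u\rangle>0$, $F=\langle z_u,z_v\rangle$, $G=\langle z_v,z_v\rangle<0$ (parameters are always taken with these signs), $W=\sqrt{|EG-F^2|}$. For a normal frame $n_1,n_2$ with $\langle n_1,n_1\rangle=1$, $\langle n_2,n_2\rangle=-1$, $\langle n_1,n_2\rangle=0$ put $c_{11}^k=\langle z_{uu},n_k\rangle$, $c_{12}^k=\langle z_{uv},n_k\rangle$, $c_{22}^k=\langle z_{vv},n_k\rangle$, $\Delta_1=c_{11}^1c_{12}^2-c_{12}^1c_{11}^2$, $\Delta_2=c_{11}^1c_{22}^2-c_{22}^1c_{11}^2$, $\Delta_3=c_{12}^1c_{22}^2-c_{22}^1c_{12}^2$, $L=2\Delta_1/W$, $M=\Delta_2/W$, $N=2\Delta_3/W$, $k=\frac{LN-M^2}{EG-F^2}$, $\varkappa=\frac{EN+GL-2FM}{2(EG-F^2)}$. Surfaces considered are free of flat points, i.e.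 $(L,M,N)\neq(0,0,0)$ everywhere, and satisfy $\varkappa^2-k>0$ everywhere. Suppose $\langle H,H\rangle\ne0$ everywhere and set $\varepsilon=\operatorname{sign}\langle H,H\rangle$. Parameters are principal if $F=0$ and $M=0$. In principal parameters put $x=z_u/\sqrt{E}$, $y=z_v/\sqrt{-G}$, $b=\varepsilon H/\sqrt{\varepsilon\langle H,H\rangle}$ (so $\langle b,b\rangle=\varepsilon$), and let $l$ be the normal field with $\langle l,l\rangle=-\varepsilon$, $\langle b,l\rangle=0$, such that $(x,y,b,l)$ is positively oriented if $\varepsilon=1$ and $(x,y,l,b)$ is positively oriented if $\varepsilon=-1$. This is the geometric frame. The geometric functions are $\nu_1=\langle\sigma(x,x),b\rangle$, $\nu_2=\langle\sigma(y,y),b\rangle$, $\lambda=\langle\sigma(x,y),b\rangle$, $\mu=\langle\sigma(x,y),l\rangle$, $\gamma_1=\langle\nabla'_xx,y\rangle$, $\gamma_2=\langle\nabla'_yx,y\rangle$, $\beta_1=\langle\nabla'_xb,l\rangle$, $\beta_2=\langle\nabla'_yb,l\rangle$. Saying that given functions $\gamma_1,\gamma_2,\nu_1,\nu_2,\lambda,\mu,\beta_1,\beta_2$ of $(u,v)$ are the geometric functions of $z(u,v)$, or that a given frame is its geometric frame, means that $(u,v)$ are principal parameters of $z(u,v)$ and that, with $x=z_u/\sqrt{E}$, $y=z_v/\sqrt{-G}$, $b=\varepsilon H/\sqrt{\varepsilon\langle H,H\rangle}$ and $l$ the unit normal field orthogonal to $b$ fixed by the stated orientation condition, the given functions equal $\langle\nabla'_xx,y\rangle$,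 $\langle\nabla'_yx,y\rangle$, $\langle\sigma(x,x),b\rangle$, $\langle\sigma(y,y),b\rangle$, $\langle\sigma(x,y),b\rangle$, $\langle\sigma(x,y),l\rangle$, $\langle\nabla'_xb,l\rangle$, $\langle\nabla'_yb,l\rangle$ respectively, or, respectively, the given frame equals $\{x,y,b,l\}$. *)

theory Defs
  imports "HOL-Analysis.Analysis" "HOL-Library.FuncSet"
begin

section \<open>Partial derivatives and smoothness on the parameter plane\<close>

definition d_u :: "(real \<times> real \<Rightarrow> 'a::real_normed_vector) \<Rightarrow> real \<times> real \<Rightarrow> 'a"
  where "d_u f p = frechet_derivative f (at p) (1, 0)"

definition d_v :: "(real \<times> real \<Rightarrow> 'a::real_normed_vector) \<Rightarrow> real \<times> real \<Rightarrow> 'a"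
  where "d_v f p = frechet_derivative f (at p) (0, 1)"

fun C_on :: "nat \<Rightarrow> (real \<times> real) set \<Rightarrow> (real \<times> real \<Rightarrow> 'a::real_normed_vector) \<Rightarrow> bool"
  where
    "C_on 0 S f \<longleftrightarrow> continuous_on S f"
  | "C_on (Suc n) S f \<longleftrightarrow>
       (\<forall>p\<in>S. f differentiable (at p)) \<and> C_on n S (d_u f) \<and> C_on n S (d_v f)"

definition smooth_on :: "(real \<times> real) set \<Rightarrow> (real \<times> real \<Rightarrow> 'a::real_normed_vector) \<Rightarrow> bool"
  where "smooth_on S f \<longleftrightarrow> (\<forall>n. C_on n S f)"

definition plane_domain :: "(real \<times> real) set \<Rightarrow> bool"
  where "plane_domain S \<longleftrightarrow> open S \<and> connected S \<and> S \<noteq> {}"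


section \<open>The space $E^4_2$\<close>

text \<open>The index type \<^typ>\<open>4\<close> has the elements 1, 2, 3 and 4 = 0.\<close>

definition ip :: "real ^ 4 \<Rightarrow> real ^ 4 \<Rightarrow> real"
  where "ip X Y = X $ 1 * Y $ 1 + X $ 2 * Y $ 2 - X $ 3 * Y $ 3 - X $ 4 * Y $ 4"

definition positively_oriented :: "real ^ 4 \<Rightarrow> real ^ 4 \<Rightarrow> real ^ 4 \<Rightarrow> real ^ 4 \<Rightarrow> bool"
  where "positively_oriented a b c d \<longleftrightarrow> det (vector [a, b, c, d] :: real ^ 4 ^ 4) > 0"

text \<open>The orientation convention for a frame (x, y, b, l) whose third vector has square eps.\<close>

definition frame_oriented :: "real \<Rightarrow> real ^ 4 \<Rightarrow> real ^ 4 \<Rightarrow> real ^ 4 \<Rightarrow> real ^ 4 \<Rightarrow> bool"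
  where "frame_oriented eps x y b l \<longleftrightarrow>
    (if eps = 1 then positively_oriented x y b l else positively_oriented x y l b)"


section \<open>Lorentz surfaces\<close>

text \<open>A surface is given by its parametrization z, and a vector field along it by a function
  of the parameters. Only the values on the parameter domain matter.\<close>

type_synonym vfield = "real \<times> real \<Rightarrow> real ^ 4"

definition E_coef :: "vfield \<Rightarrow> real \<times> real \<Rightarrow> real"
  where "E_coef z p = ip (d_u z p) (d_u z p)"

definition F_coef :: "vfield \<Rightarrow> real \<times> real \<Rightarrow> real"
  where "F_coef z p = ip (d_u z p) (d_v z p)"

definition G_coef :: "vfield \<Rightarrow> real \<times> real \<Rightarrow> real"
  where "G_coef z p = ip (d_v z p) (d_v z p)"

definition W_coef :: "vfield \<Rightarrow> real \<times> real \<Rightarrow> real"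
  where "W_coef z p = sqrt \<bar>E_coef z p * G_coef z p - (F_coef z p)\<^sup>2\<bar>"

text \<open>The induced metric is nondegenerate of signature (1,1) iff its determinant is negative.
  The signs of E and G are the standing convention for the parameters.\<close>

definition lorentz_surface :: "(real \<times> real) set \<Rightarrow> vfield \<Rightarrow> bool"
  where "lorentz_surface S z \<longleftrightarrow> plane_domain S \<and> smooth_on S z \<and>
    (\<forall>p\<in>S. inj (frechet_derivative z (at p)) \<and>
           E_coef z p * G_coef z p - (F_coef z p)\<^sup>2 < 0 \<and>
           E_coef z p > 0 \<and> G_coef z p < 0)"

definition tangent_space :: "vfield \<Rightarrow> real \<times> real \<Rightarrow> (real ^ 4) set"
  where "tangent_space z p = range (frechet_derivative z (at p))"

definition normal_space :: "vfield \<Rightarrow> real \<times> real \<Rightarrow> (real ^ 4) set"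
  where "normal_space z p = {n. \<forall>t\<in>tangent_space z p. ip n t = 0}"

definition normal_part :: "vfield \<Rightarrow> real \<times> real \<Rightarrow> real ^ 4 \<Rightarrow> real ^ 4"
  where "normal_part z p w = (THE n. n \<in> normal_space z p \<and> w - n \<in> tangent_space z p)"

text \<open>The flat connection, for a tangent field X and any field Y along z: the derivative of Y in
  the parameter direction which the differential of z sends to X.\<close>

definition nabla :: "vfield \<Rightarrow> vfield \<Rightarrow> vfield \<Rightarrow> vfield"
  where "nabla z X Y p =
    frechet_derivative Y (at p) (THE w. frechet_derivative z (at p) w = X p)"

definition second_ff :: "vfield \<Rightarrow> vfield \<Rightarrow> vfield \<Rightarrow> vfield"
  where "second_ff z X Y p = normal_part z p (nabla z X Y p)"

text \<open>Half the trace of the second fundamental form. The trace does not depend on the tangent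
  orthonormal frame; it is evaluated here in the frame obtained from (z_u, z_v) by the
  Gram-Schmidt process, which is (z_u/sqrt E, z_v/sqrt(-G)) when F = 0.\<close>

definition tan_x :: "vfield \<Rightarrow> vfield"
  where "tan_x z p = (1 / sqrt (E_coef z p)) *\<^sub>R d_u z p"

definition tan_y :: "vfield \<Rightarrow> vfield"
  where "tan_y z p = (1 / sqrt (- (G_coef z p - (F_coef z p)\<^sup>2 / E_coef z p))) *\<^sub>R
    (d_v z p - (F_coef z p / E_coef z p) *\<^sub>R d_u z p)"

definition mean_curv :: "vfield \<Rightarrow> vfield"
  where "mean_curv z p =
    (1 / 2) *\<^sub>R (second_ff z (tan_x z) (tan_x z) p - second_ff z (tan_y z) (tan_y z) p)"


section \<open>The second order invariants\<close>

definition normal_frame :: "vfield \<Rightarrow> real \<times> real \<Rightarrow> real ^ 4 \<Rightarrow> real ^ 4 \<Rightarrow> bool"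
  where "normal_frame z p n1 n2 \<longleftrightarrow> n1 \<in> normal_space z p \<and> n2 \<in> normal_space z p \<and>
    ip n1 n1 = 1 \<and> ip n2 n2 = -1 \<and> ip n1 n2 = 0"

definition c11 :: "vfield \<Rightarrow> real \<times> real \<Rightarrow> real ^ 4 \<Rightarrow> real"
  where "c11 z p n = ip (d_u (d_u z) p) n"

definition c12 :: "vfield \<Rightarrow> real \<times> real \<Rightarrow> real ^ 4 \<Rightarrow> real"
  where "c12 z p n = ip (d_v (d_u z) p) n"

definition c22 :: "vfield \<Rightarrow> real \<times> real \<Rightarrow> real ^ 4 \<Rightarrow> real"
  where "c22 z p n = ip (d_v (d_v z) p) n"

definition L_coef :: "vfield \<Rightarrow> real \<times> real \<Rightarrow> real ^ 4 \<Rightarrow> real ^ 4 \<Rightarrow> real"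
  where "L_coef z p n1 n2 = 2 * (c11 z p n1 * c12 z p n2 - c12 z p n1 * c11 z p n2) / W_coef z p"

definition M_coef :: "vfield \<Rightarrow> real \<times> real \<Rightarrow> real ^ 4 \<Rightarrow> real ^ 4 \<Rightarrow> real"
  where "M_coef z p n1 n2 = (c11 z p n1 * c22 z p n2 - c22 z p n1 * c11 z p n2) / W_coef z p"

definition N_coef :: "vfield \<Rightarrow> real \<times> real \<Rightarrow> real ^ 4 \<Rightarrow> real ^ 4 \<Rightarrow> real"
  where "N_coef z p n1 n2 = 2 * (c12 z p n1 * c22 z p n2 - c22 z p n1 * c12 z p n2) / W_coef z p"

definition k_inv :: "vfield \<Rightarrow> real \<times> real \<Rightarrow> real ^ 4 \<Rightarrow> real ^ 4 \<Rightarrow> real"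
  where "k_inv z p n1 n2 =
    (L_coef z p n1 n2 * N_coef z p n1 n2 - (M_coef z p n1 n2)\<^sup>2)
      / (E_coef z p * G_coef z p - (F_coef z p)\<^sup>2)"

definition kappa_inv :: "vfield \<Rightarrow> real \<times> real \<Rightarrow> real ^ 4 \<Rightarrow> real ^ 4 \<Rightarrow> real"
  where "kappa_inv z p n1 n2 =
    (E_coef z p * N_coef z p n1 n2 + G_coef z p * L_coef z p n1 n2
        - 2 * F_coef z p * M_coef z p n1 n2)
      / (2 * (E_coef z p * G_coef z p - (F_coef z p)\<^sup>2))"

text \<open>A change of the normal frame changes (L, M, N) at most by a common sign, so the conditions
  below hold for one normal frame at p iff they hold for all of them; on a Lorentz surface
  normal frames exist at every point.\<close>

definition admissible :: "(real \<times> real) set \<Rightarrow> vfield \<Rightarrow> bool"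
  where "admissible S z \<longleftrightarrow> (\<forall>p\<in>S. \<forall>n1 n2. normal_frame z p n1 n2 \<longrightarrow>
    (L_coef z p n1 n2, M_coef z p n1 n2, N_coef z p n1 n2) \<noteq> (0, 0, 0) \<and>
    (kappa_inv z p n1 n2)\<^sup>2 - k_inv z p n1 n2 > 0)"

definition principal :: "(real \<times> real) set \<Rightarrow> vfield \<Rightarrow> bool"
  where "principal S z \<longleftrightarrow> (\<forall>p\<in>S. F_coef z p = 0 \<and>
    (\<forall>n1 n2. normal_frame z p n1 n2 \<longrightarrow> M_coef z p n1 n2 = 0))"


section \<open>The geometric frame and the geometric functions\<close>

definition eps_of :: "vfield \<Rightarrow> real \<times> real \<Rightarrow> real"
  where "eps_of z p = sgn (ip (mean_curv z p) (mean_curv z p))"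

definition geo_x :: "vfield \<Rightarrow> vfield"
  where "geo_x z p = (1 / sqrt (E_coef z p)) *\<^sub>R d_u z p"

definition geo_y :: "vfield \<Rightarrow> vfield"
  where "geo_y z p = (1 / sqrt (- G_coef z p)) *\<^sub>R d_v z p"

definition geo_b :: "vfield \<Rightarrow> vfield"
  where "geo_b z p =
    (eps_of z p / sqrt (eps_of z p * ip (mean_curv z p) (mean_curv z p))) *\<^sub>R mean_curv z p"

definition geo_l :: "vfield \<Rightarrow> vfield"
  where "geo_l z p = (THE l. l \<in> normal_space z p \<and> ip l l = - eps_of z p \<and>
    ip (geo_b z p) l = 0 \<and> frame_oriented (eps_of z p) (geo_x z p) (geo_y z p) (geo_b z p) l)"

definition geometric_functions :: "(real \<times> real) set \<Rightarrow> vfield \<Rightarrow>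
    (real \<times> real \<Rightarrow> real) \<Rightarrow> (real \<times> real \<Rightarrow> real) \<Rightarrow> (real \<times> real \<Rightarrow> real) \<Rightarrow>
    (real \<times> real \<Rightarrow> real) \<Rightarrow> (real \<times> real \<Rightarrow> real) \<Rightarrow> (real \<times> real \<Rightarrow> real) \<Rightarrow>
    (real \<times> real \<Rightarrow> real) \<Rightarrow> (real \<times> real \<Rightarrow> real) \<Rightarrow> bool"
  where "geometric_functions S z \<gamma>1 \<gamma>2 \<nu>1 \<nu>2 lam \<mu> \<beta>1 \<beta>2 \<longleftrightarrow> principal S z \<and>
    (\<forall>p\<in>S.
      \<gamma>1 p = ip (nabla z (geo_x z) (geo_x z) p) (geo_y z p) \<and>
      \<gamma>2 p = ip (nabla z (geo_y z) (geo_x z) p) (geo_y z p) \<and>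
      \<nu>1 p = ip (second_ff z (geo_x z) (geo_x z) p) (geo_b z p) \<and>
      \<nu>2 p = ip (second_ff z (geo_y z) (geo_y z) p) (geo_b z p) \<and>
      lam p = ip (second_ff z (geo_x z) (geo_y z) p) (geo_b z p) \<and>
      \<mu> p = ip (second_ff z (geo_x z) (geo_y z) p) (geo_l z p) \<and>
      \<beta>1 p = ip (nabla z (geo_x z) (geo_b z) p) (geo_l z p) \<and>
      \<beta>2 p = ip (nabla z (geo_y z) (geo_b z) p) (geo_l z p))"

definition geometric_frame_at :: "(real \<times> real) set \<Rightarrow> vfield \<Rightarrow> real \<times> real \<Rightarrow>
    real ^ 4 \<Rightarrow> real ^ 4 \<Rightarrow> real ^ 4 \<Rightarrow> real ^ 4 \<Rightarrow> bool"
  where "geometric_frame_at S z p x y b l \<longleftrightarrow> principal S z \<and>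
    x = geo_x z p \<and> y = geo_y z p \<and> b = geo_b z p \<and> l = geo_l z p"

end

theory Submission
  imports Defs
begin

text \<open>
A surface with the given geometric functions is the same thing as a solution of a linear system.
Write \<open>e\<close> and \<open>g\<close> for \<open>sqrt E\<close> and \<open>sqrt (-G)\<close>. The point \<open>z\<close> and its geometric frame \<open>x, y, b, l\<close>
satisfy \<open>z_u = e x\<close>, \<open>z_v = g y\<close> and the derivation formulas collected in \<open>frame_equations\<close> below. In
them \<open>\<sigma>(x,x)\<close> and \<open>\<sigma>(y,y)\<close> are multiples of \<open>b\<close>: their difference is \<open>2H\<close>, and \<open>M = 0\<close> makes them
linearly dependent. So the state \<open>X = (z, x, y, b, l)\<close> solves \<open>X_u = A X\<close>, \<open>X_v = B X\<close> with
operators \<open>A, B\<close> built from the given functions.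

Existence. The system has a local solution through every initial value once
\<open>A_v + A B = B_u + B A\<close> (\<open>linear_pfaffian_system\<close>). Written in components, this condition is the
hypothesis of the theorem (\<open>motion_compatible\<close>): the equations for \<open>e_v\<close> and \<open>g_u\<close> say \<open>z_uv = z_vu\<close>,
the others are the equations of Gauss, Codazzi and Ricci, and the two quotients which define \<open>e\<close>
and \<open>g\<close> are the Codazzi equations in the direction \<open>l\<close>. The matrix of the frame part is
skew with respect to the signature \<open>(1, -1, eps, -eps)\<close>. Hence \<open>x \<otimes> x - y \<otimes> y + eps b \<otimes> b - eps l \<otimes> l\<close>
is constant (\<open>frame_pairing_constant\<close>), and its value at one point expresses orthonormality
(\<open>orthonormal_frame_iff_pairing\<close>), so an orthonormal frame stays orthonormal. It then
remains to read off the fundamental forms of \<open>z\<close>; for instance \<open>H = eps (\<nu>1 - \<nu>2) / 2 b\<close> and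
\<open>\<kappa>\<^sup>2 - k = (\<mu> (\<nu>1 - \<nu>2))\<^sup>2\<close>.

Uniqueness. The geometric frame of any other surface with these functions solves the frame
equations with its own \<open>e\<close> and \<open>g\<close>. Symmetry of the second derivatives of \<open>x\<close> and \<open>y\<close> gives the two
Codazzi equations in the direction \<open>l\<close> (\<open>codazzi_\<mu>\<close>), which force \<open>e\<close> and \<open>g\<close> to be the prescribed
quotients. The tensor \<open>x' \<otimes> x - y' \<otimes> y + eps b' \<otimes> b - eps l' \<otimes> l\<close> that pairs the two frames is again
constant; if the frames agree at one point, then they agree everywhere, and so do \<open>z_u\<close> and \<open>z_v\<close>.
\<close>

section \<open>Calculus of smooth functions on the parameter plane\<close>

lemma d_u_eqI: "(f has_derivative f') (at p) \<Longrightarrow> d_u f p = f' (1, 0)"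
  unfolding d_u_def using frechet_derivative_at by metis

lemma d_v_eqI: "(f has_derivative f') (at p) \<Longrightarrow> d_v f p = f' (0, 1)"
  unfolding d_v_def using frechet_derivative_at by metis

lemma frechet_derivative_eq_partials:
  assumes "f differentiable (at p)"
  shows "frechet_derivative f (at p) w = fst w *\<^sub>R d_u f p + snd w *\<^sub>R d_v f p"
proof -
  have lin: "linear (frechet_derivative f (at p))"
    using assms by (rule linear_frechet_derivative)
  have "w = fst w *\<^sub>R (1, 0) + snd w *\<^sub>R (0, 1)" by (cases w) simp
  then have "frechet_derivative f (at p) w
      = frechet_derivative f (at p) (fst w *\<^sub>R (1, 0) + snd w *\<^sub>R (0, 1))" by simp
  also have "\<dots> = fst w *\<^sub>R d_u f p + snd w *\<^sub>R d_v f p"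
    unfolding linear_add[OF lin] linear_scale[OF lin] d_u_def d_v_def ..
  finally show ?thesis .
qed

lemma has_derivative_partials:
  assumes "f differentiable (at p)"
  shows "(f has_derivative (\<lambda>w. fst w *\<^sub>R d_u f p + snd w *\<^sub>R d_v f p)) (at p)"
proof -
  have "(f has_derivative frechet_derivative f (at p)) (at p)"
    using assms by (simp add: frechet_derivative_works)
  then show ?thesis
    by (rule has_derivative_eq_rhs) (simp add: fun_eq_iff frechet_derivative_eq_partials[OF assms])
qed

lemma has_derivative_cong_open:
  assumes "open S" "p \<in> S" "\<And>q. q \<in> S \<Longrightarrow> f q = g q"
  shows "(f has_derivative f') (at p) \<longleftrightarrow> (g has_derivative f') (at p)"
  using assms has_derivative_transform_within_open[of f f' p UNIV S g]
    has_derivative_transform_within_open[of g f' p UNIV S f] by auto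

lemma frechet_derivative_cong_open:
  assumes "open S" "p \<in> S" "\<And>q. q \<in> S \<Longrightarrow> f q = g q"
  shows "frechet_derivative f (at p) = frechet_derivative g (at p)"
  unfolding frechet_derivative_def using has_derivative_cong_open[OF assms] by simp

lemma differentiable_cong_open:
  assumes "open S" "p \<in> S" "\<And>q. q \<in> S \<Longrightarrow> f q = g q"
  shows "f differentiable (at p) \<longleftrightarrow> g differentiable (at p)"
  unfolding differentiable_def using has_derivative_cong_open[OF assms] by simp

lemma d_u_cong_open:
  assumes "open S" "p \<in> S" "\<And>q. q \<in> S \<Longrightarrow> f q = g q"
  shows "d_u f p = d_u g p"
  unfolding d_u_def using frechet_derivative_cong_open[OF assms] by simp

lemma d_v_cong_open:
  assumes "open S" "p \<in> S" "\<And>q. q \<in> S \<Longrightarrow> f q = g q"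
  shows "d_v f p = d_v g p"
  unfolding d_v_def using frechet_derivative_cong_open[OF assms] by simp

lemma C_on_cong:
  assumes "open S" "\<And>q. q \<in> S \<Longrightarrow> f q = g q"
  shows "C_on n S f \<longleftrightarrow> C_on n S g"
  using assms(2)
proof (induction n arbitrary: f g)
  case 0
  then show ?case by (simp cong: continuous_on_cong)
next
  case (Suc n)
  have "C_on n S (d_u f) \<longleftrightarrow> C_on n S (d_u g)"
    by (rule Suc.IH) (rule d_u_cong_open[OF assms(1) _ Suc.prems])
  moreover have "C_on n S (d_v f) \<longleftrightarrow> C_on n S (d_v g)"
    by (rule Suc.IH) (rule d_v_cong_open[OF assms(1) _ Suc.prems])
  moreover have "(\<forall>p\<in>S. f differentiable (at p)) \<longleftrightarrow> (\<forall>p\<in>S. g differentiable (at p))"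
    using differentiable_cong_open[of S _ f g] assms(1) Suc.prems by simp
  ultimately show ?case by simp
qed

lemma C_on_SucD: "C_on (Suc n) S f \<Longrightarrow> C_on n S f"
proof (induction n arbitrary: f)
  case 0
  then show ?case
    by (simp add: continuous_at_imp_continuous_on differentiable_imp_continuous_within)
next
  case (Suc n)
  then show ?case by (meson C_on.simps(2))
qed

lemma C_on_subset: "C_on n S f \<Longrightarrow> T \<subseteq> S \<Longrightarrow> C_on n T f"
  by (induction n arbitrary: f) (auto intro: continuous_on_subset)

lemma C_on_add:
  assumes "open S" "C_on n S f" "C_on n S g"
  shows "C_on n S (\<lambda>p. f p + g p)"
  using assms(2,3)
proof (induction n arbitrary: f g)
  case 0
  then show ?case by (auto intro: continuous_on_add)
next
  case (Suc n)
  have d: "((\<lambda>p. f p + g p) has_derivative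
      (\<lambda>w. (fst w *\<^sub>R d_u f p + snd w *\<^sub>R d_v f p) + (fst w *\<^sub>R d_u g p + snd w *\<^sub>R d_v g p))) (at p)"
    if "p \<in> S" for p
    using Suc.prems that by (intro has_derivative_add has_derivative_partials) auto
  have "C_on n S (d_u (\<lambda>p. f p + g p)) \<longleftrightarrow> C_on n S (\<lambda>p. d_u f p + d_u g p)"
    by (rule C_on_cong[OF assms(1)]) (simp add: d_u_eqI[OF d])
  moreover have "C_on n S (d_v (\<lambda>p. f p + g p)) \<longleftrightarrow> C_on n S (\<lambda>p. d_v f p + d_v g p)"
    by (rule C_on_cong[OF assms(1)]) (simp add: d_v_eqI[OF d])
  ultimately show ?case using Suc by (auto intro: differentiableI[OF d])
qed

lemma C_on_bilinear:
  assumes "bounded_bilinear bop" "open S" "C_on n S f" "C_on n S g"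
  shows "C_on n S (\<lambda>p. bop (f p) (g p))"
  using assms(3,4)
proof (induction n arbitrary: f g)
  case 0
  then show ?case using bounded_bilinear.continuous_on[OF assms(1)] by auto
next
  case (Suc n)
  have d: "((\<lambda>p. bop (f p) (g p)) has_derivative
      (\<lambda>w. bop (f p) (fst w *\<^sub>R d_u g p + snd w *\<^sub>R d_v g p)
         + bop (fst w *\<^sub>R d_u f p + snd w *\<^sub>R d_v f p) (g p))) (at p)"
    if "p \<in> S" for p
    using Suc.prems that
    by (intro bounded_bilinear.FDERIV[OF assms(1)] has_derivative_partials) auto
  have fg: "C_on n S f" "C_on n S g" using Suc.prems C_on_SucD by blast+
  have "C_on n S (d_u (\<lambda>p. bop (f p) (g p)))
      \<longleftrightarrow> C_on n S (\<lambda>p. bop (f p) (d_u g p) + bop (d_u f p) (g p))"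
    by (rule C_on_cong[OF assms(2)]) (simp add: d_u_eqI[OF d])
  moreover have "C_on n S (d_v (\<lambda>p. bop (f p) (g p)))
      \<longleftrightarrow> C_on n S (\<lambda>p. bop (f p) (d_v g p) + bop (d_v f p) (g p))"
    by (rule C_on_cong[OF assms(2)]) (simp add: d_v_eqI[OF d])
  ultimately show ?case using Suc.prems Suc.IH fg
    by (auto intro: C_on_add[OF assms(2)] differentiableI[OF d])
qed

lemma C_on_const: "C_on n S (\<lambda>p. c)"
proof (induction n arbitrary: c)
  case (Suc n)
  have "d_u (\<lambda>p. c) = (\<lambda>p. 0)" "d_v (\<lambda>p. c) = (\<lambda>p. 0)"
    by (auto simp: fun_eq_iff intro: d_u_eqI[OF has_derivative_const] d_v_eqI[OF has_derivative_const])
  with Suc show ?case by simp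
qed auto

lemma smooth_on_cong:
  assumes "open S" "\<And>q. q \<in> S \<Longrightarrow> f q = g q"
  shows "smooth_on S f \<longleftrightarrow> smooth_on S g"
  unfolding smooth_on_def using C_on_cong[OF assms] by simp

lemma smooth_on_subset: "smooth_on S f \<Longrightarrow> T \<subseteq> S \<Longrightarrow> smooth_on T f"
  unfolding smooth_on_def using C_on_subset by blast

lemma smooth_on_differentiable: "smooth_on S f \<Longrightarrow> p \<in> S \<Longrightarrow> f differentiable (at p)"
  unfolding smooth_on_def by (meson C_on.simps(2))

lemma smooth_on_d_u: "smooth_on S f \<Longrightarrow> smooth_on S (d_u f)"
  unfolding smooth_on_def by (meson C_on.simps(2))

lemma smooth_on_d_v: "smooth_on S f \<Longrightarrow> smooth_on S (d_v f)"
  unfolding smooth_on_def by (meson C_on.simps(2))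

lemma smooth_on_continuous: "smooth_on S f \<Longrightarrow> continuous_on S f"
  unfolding smooth_on_def by (metis C_on.simps(1))

lemma smooth_on_const: "smooth_on S (\<lambda>p. c)"
  unfolding smooth_on_def using C_on_const by blast

lemma smooth_on_bilinear:
  assumes "bounded_bilinear bop" "open S" "smooth_on S f" "smooth_on S g"
  shows "smooth_on S (\<lambda>p. bop (f p) (g p))"
  using assms C_on_bilinear unfolding smooth_on_def by blast

lemmas smooth_on_scaleR = smooth_on_bilinear[OF bounded_bilinear_scaleR]
lemmas smooth_on_mult = smooth_on_bilinear[OF bounded_bilinear_mult]

lemma smooth_on_linear:
  assumes "bounded_linear h" "open S" "smooth_on S f"
  shows "smooth_on S (\<lambda>p. h (f p))"
proof -
  have "bounded_bilinear (\<lambda>(c::real) x. c *\<^sub>R h x)"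
    using bounded_bilinear.comp[OF bounded_bilinear_scaleR bounded_linear_ident assms(1)] by simp
  from smooth_on_bilinear[OF this assms(2) smooth_on_const[where c = 1] assms(3)]
  show ?thesis by simp
qed

lemma smooth_on_add:
  assumes "open S" "smooth_on S f" "smooth_on S g"
  shows "smooth_on S (\<lambda>p. f p + g p)"
  using assms C_on_add unfolding smooth_on_def by blast

lemma smooth_on_minus:
  assumes "open S" "smooth_on S f"
  shows "smooth_on S (\<lambda>p. - f p)"
  using smooth_on_linear[OF bounded_linear_minus[OF bounded_linear_ident] assms] .

lemma smooth_on_diff:
  assumes "open S" "smooth_on S f" "smooth_on S g"
  shows "smooth_on S (\<lambda>p. f p - g p)"
  using smooth_on_add[OF assms(1,2) smooth_on_minus[OF assms(1,3)]] by simp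

text \<open>\<^const>\<open>C_on\<close> is by recursion on the order, so a function whose partial derivatives are smooth
  expressions in the function itself gains one order at each step.\<close>
lemma smooth_on_bootstrap:
  assumes "\<And>p. p \<in> S \<Longrightarrow> f differentiable (at p)"
    and "\<And>n. C_on n S f \<Longrightarrow> C_on n S (d_u f)"
    and "\<And>n. C_on n S f \<Longrightarrow> C_on n S (d_v f)"
  shows "smooth_on S f"
proof -
  have "C_on n S f" for n
  proof (induction n)
    case 0
    then show ?case
      using assms(1) by (simp add: continuous_at_imp_continuous_on differentiable_imp_continuous_within)
  next
    case (Suc n)
    then show ?case using assms by simp
  qed
  then show ?thesis by (simp add: smooth_on_def)
qed

lemma smooth_on_inverse:
  fixes f :: "real \<times> real \<Rightarrow> real"
  assumes "open S" "smooth_on S f" "\<And>p. p \<in> S \<Longrightarrow> f p \<noteq> 0"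
  shows "smooth_on S (\<lambda>p. inverse (f p))"
proof -
  have d: "((\<lambda>p. inverse (f p)) has_derivative
      (\<lambda>w. - (inverse (f p) * (fst w *\<^sub>R d_u f p + snd w *\<^sub>R d_v f p) * inverse (f p)))) (at p)"
    if "p \<in> S" for p
    by (intro Deriv.has_derivative_inverse has_derivative_partials assms(3) that
        smooth_on_differentiable[OF assms(2)])
  note mult = C_on_bilinear[OF bounded_bilinear_mult \<open>open S\<close>]
  show ?thesis
  proof (rule smooth_on_bootstrap)
    fix n assume n: "C_on n S (\<lambda>p. inverse (f p))"
    have "C_on n S (\<lambda>p. (- 1) * (inverse (f p) * d_u f p * inverse (f p)))"
      using n smooth_on_d_u[OF assms(2)] by (intro mult C_on_const) (auto simp: smooth_on_def)
    then show "C_on n S (d_u (\<lambda>p. inverse (f p)))"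
      by (subst C_on_cong[OF \<open>open S\<close>]) (auto simp: d_u_eqI[OF d])
    have "C_on n S (\<lambda>p. (- 1) * (inverse (f p) * d_v f p * inverse (f p)))"
      using n smooth_on_d_v[OF assms(2)] by (intro mult C_on_const) (auto simp: smooth_on_def)
    then show "C_on n S (d_v (\<lambda>p. inverse (f p)))"
      by (subst C_on_cong[OF \<open>open S\<close>]) (auto simp: d_v_eqI[OF d])
  qed (rule differentiableI[OF d])
qed

lemma smooth_on_divide:
  fixes f g :: "real \<times> real \<Rightarrow> real"
  assumes "open S" "smooth_on S f" "smooth_on S g" "\<And>p. p \<in> S \<Longrightarrow> g p \<noteq> 0"
  shows "smooth_on S (\<lambda>p. f p / g p)"
  unfolding divide_inverse using assms by (intro smooth_on_mult smooth_on_inverse)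

lemma smooth_on_sqrt:
  fixes f :: "real \<times> real \<Rightarrow> real"
  assumes "open S" "smooth_on S f" "\<And>p. p \<in> S \<Longrightarrow> f p > 0"
  shows "smooth_on S (\<lambda>p. sqrt (f p))"
proof -
  have d: "((\<lambda>p. sqrt (f p)) has_derivative
      (\<lambda>w. (fst w *\<^sub>R d_u f p + snd w *\<^sub>R d_v f p) * (sqrt (f p) * inverse (2 * f p)))) (at p)"
    if "p \<in> S" for p
  proof -
    have "(f has_derivative (\<lambda>w. fst w *\<^sub>R d_u f p + snd w *\<^sub>R d_v f p)) (at p)"
      using assms that by (intro has_derivative_partials smooth_on_differentiable)
    from has_derivative_real_sqrt[OF assms(3)[OF that] this]
    show ?thesis
      by (rule has_derivative_eq_rhs)
        (use assms(3)[OF that] in \<open>auto simp: fun_eq_iff divide_simps\<close>)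
  qed
  have inv: "smooth_on S (\<lambda>p. inverse (2 * f p))"
    using assms by (intro smooth_on_inverse smooth_on_mult smooth_on_const) fastforce+
  note mult = C_on_bilinear[OF bounded_bilinear_mult \<open>open S\<close>]
  show ?thesis
  proof (rule smooth_on_bootstrap)
    fix n assume n: "C_on n S (\<lambda>p. sqrt (f p))"
    have "C_on n S (\<lambda>p. d_u f p * (sqrt (f p) * inverse (2 * f p)))"
      using n smooth_on_d_u[OF assms(2)] inv by (intro mult) (auto simp: smooth_on_def)
    then show "C_on n S (d_u (\<lambda>p. sqrt (f p)))"
      by (subst C_on_cong[OF \<open>open S\<close>]) (auto simp: d_u_eqI[OF d])
    have "C_on n S (\<lambda>p. d_v f p * (sqrt (f p) * inverse (2 * f p)))"
      using n smooth_on_d_v[OF assms(2)] inv by (intro mult) (auto simp: smooth_on_def)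
    then show "C_on n S (d_v (\<lambda>p. sqrt (f p)))"
      by (subst C_on_cong[OF \<open>open S\<close>]) (auto simp: d_v_eqI[OF d])
  qed (rule differentiableI[OF d])
qed

lemma
  assumes "bounded_bilinear bop" "f differentiable (at p)" "g differentiable (at p)"
  shows d_u_bilinear: "d_u (\<lambda>p. bop (f p) (g p)) p = bop (d_u f p) (g p) + bop (f p) (d_u g p)"
    and d_v_bilinear: "d_v (\<lambda>p. bop (f p) (g p)) p = bop (d_v f p) (g p) + bop (f p) (d_v g p)"
proof -
  note d = bounded_bilinear.FDERIV[OF assms(1) has_derivative_partials[OF assms(2)]
      has_derivative_partials[OF assms(3)]]
  show "d_u (\<lambda>p. bop (f p) (g p)) p = bop (d_u f p) (g p) + bop (f p) (d_u g p)"
    by (simp add: d_u_eqI[OF d])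
  show "d_v (\<lambda>p. bop (f p) (g p)) p = bop (d_v f p) (g p) + bop (f p) (d_v g p)"
    by (simp add: d_v_eqI[OF d])
qed

lemmas d_u_scaleR = d_u_bilinear[OF bounded_bilinear_scaleR]
lemmas d_v_scaleR = d_v_bilinear[OF bounded_bilinear_scaleR]
lemmas d_u_mult = d_u_bilinear[OF bounded_bilinear_mult]
lemmas d_v_mult = d_v_bilinear[OF bounded_bilinear_mult]

lemma
  assumes "bounded_linear h" "f differentiable (at p)"
  shows d_u_linear: "d_u (\<lambda>p. h (f p)) p = h (d_u f p)"
    and d_v_linear: "d_v (\<lambda>p. h (f p)) p = h (d_v f p)"
proof -
  note d = bounded_linear.has_derivative[OF assms(1) has_derivative_partials[OF assms(2)]]
  show "d_u (\<lambda>p. h (f p)) p = h (d_u f p)" by (simp add: d_u_eqI[OF d])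
  show "d_v (\<lambda>p. h (f p)) p = h (d_v f p)" by (simp add: d_v_eqI[OF d])
qed

lemma d_u_const [simp]: "d_u (\<lambda>p. c) p = 0"
  by (rule d_u_eqI[OF has_derivative_const])

lemma d_v_const [simp]: "d_v (\<lambda>p. c) p = 0"
  by (rule d_v_eqI[OF has_derivative_const])

lemma
  assumes "f differentiable (at (u, v))"
  shows has_vector_derivative_d_u: "((\<lambda>s. f (s, v)) has_vector_derivative d_u f (u, v)) (at u within I)"
    and has_vector_derivative_d_v: "((\<lambda>t. f (u, t)) has_vector_derivative d_v f (u, v)) (at v within I)"
proof -
  have "((\<lambda>s. (s, v)) has_derivative (\<lambda>h. (h, 0))) (at u within I)"
    by (auto intro!: derivative_eq_intros)
  from has_derivative_compose[OF this has_derivative_partials[OF assms]]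
  show "((\<lambda>s. f (s, v)) has_vector_derivative d_u f (u, v)) (at u within I)"
    by (simp add: has_vector_derivative_def)
  have "((\<lambda>t. (u, t)) has_derivative (\<lambda>h. (0, h))) (at v within I)"
    by (auto intro!: derivative_eq_intros)
  from has_derivative_compose[OF this has_derivative_partials[OF assms]]
  show "((\<lambda>t. f (u, t)) has_vector_derivative d_v f (u, v)) (at v within I)"
    by (simp add: has_vector_derivative_def)
qed

lemma open_plane_contains_box:
  assumes "open (S :: (real \<times> real) set)" "(u0, v0) \<in> S"
  obtains r where "r > 0" "\<And>u v. \<bar>u - u0\<bar> \<le> r \<Longrightarrow> \<bar>v - v0\<bar> \<le> r \<Longrightarrow> (u, v) \<in> S"
proof -
  obtain e where e: "e > 0" "ball (u0, v0) e \<subseteq> S" using assms by (meson openE)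
  have "(u, v) \<in> S" if "\<bar>u - u0\<bar> \<le> e / 3" "\<bar>v - v0\<bar> \<le> e / 3" for u v
  proof -
    have "dist (u0, v0) (u, v) \<le> dist u0 u + dist v0 v"
      unfolding dist_prod_def by (simp add: sqrt_sum_squares_le_sum)
    also have "\<dots> < e" using that e(1) unfolding dist_real_def by linarith
    finally show ?thesis using e(2) by auto
  qed
  then show thesis using that[of "e / 3"] e(1) by simp
qed

text \<open>Differentiate \<open>f(u,v) = f(a,v) + \<integral>_a^u f_u(s,v) ds\<close> under the integral sign in \<open>v\<close>, and
  then in \<open>u\<close>.\<close>
lemma mixed_partials_symmetric:
  fixes f :: "real \<times> real \<Rightarrow> 'a::banach"
  assumes "open S" "smooth_on S f" "p \<in> S"
  shows "d_u (d_v f) p = d_v (d_u f) p"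
proof -
  obtain u0 v0 where p: "p = (u0, v0)" by (cases p)
  obtain r where r: "r > 0" "\<And>u v. \<bar>u - u0\<bar> \<le> r \<Longrightarrow> \<bar>v - v0\<bar> \<le> r \<Longrightarrow> (u, v) \<in> S"
    using open_plane_contains_box assms(1,3) p by metis
  define a where "a = u0 - r"
  define V where "V = {v0 - r..v0 + r}"
  have box: "(s, v) \<in> S" if "s \<in> {a..u0 + r}" "v \<in> V" for s v
    using r(2) that by (auto simp: a_def V_def abs_le_iff)
  have diff: "f differentiable (at q)" "d_u f differentiable (at q)" "d_v f differentiable (at q)"
    if "q \<in> S" for q
    using that assms(2) by (auto intro: smooth_on_differentiable smooth_on_d_u smooth_on_d_v)
  have cont_uv: "continuous_on S (d_v (d_u f))"
    using assms(2) by (intro smooth_on_continuous smooth_on_d_v smooth_on_d_u)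
  have ftc: "((\<lambda>s. d_u f (s, v)) has_integral f (u, v) - f (a, v)) {a..u}"
    if "u \<in> {a..u0 + r}" "v \<in> V" for u v
    using that box diff
    by (intro fundamental_theorem_of_calculus has_vector_derivative_d_u) auto
  have dv: "d_v f (u, v0) = d_v f (a, v0) + integral {a..u} (\<lambda>s. d_v (d_u f) (s, v0))"
    if u: "u \<in> {a..u0 + r}" for u
  proof -
    have 1: "((\<lambda>v. integral (cbox a u) (\<lambda>s. d_u f (s, v))) has_vector_derivative
        integral (cbox a u) (\<lambda>s. d_v (d_u f) (s, v0))) (at v0 within V)"
    proof (rule leibniz_rule_vector_derivative)
      show "continuous_on (V \<times> cbox a u) (\<lambda>(v, s). d_v (d_u f) (s, v))"
        unfolding split_beta
        by (rule continuous_on_compose2[OF cont_uv]) (use u box in \<open>auto intro!: continuous_intros\<close>)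
    qed (use u ftc box diff r(1) in \<open>auto simp: V_def intro!: has_vector_derivative_d_v
      has_integral_integrable[of _ "f (u, v) - f (a, v)" for v]\<close>)
    have 2: "((\<lambda>v. f (u, v) - f (a, v)) has_vector_derivative d_v f (u, v0) - d_v f (a, v0))
        (at v0 within V)"
      using u box diff r(1)
      by (intro has_vector_derivative_diff has_vector_derivative_d_v) (auto simp: V_def a_def)
    have 3: "((\<lambda>v. f (u, v) - f (a, v)) has_vector_derivative
        integral (cbox a u) (\<lambda>s. d_v (d_u f) (s, v0))) (at v0 within V)"
      by (rule has_vector_derivative_transform[OF _ _ 1])
        (use integral_unique[OF ftc[OF u]] r(1) in \<open>auto simp: V_def\<close>)
    have "d_v f (u, v0) - d_v f (a, v0) = integral (cbox a u) (\<lambda>s. d_v (d_u f) (s, v0))"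
      by (rule vector_derivative_unique_within[OF _ 2 3])
        (use r(1) in \<open>simp add: V_def trivial_limit_within islimpt_Icc\<close>)
    then show ?thesis by (simp add: algebra_simps)
  qed
  have u0: "u0 \<in> {a..u0 + r}" using r(1) by (simp add: a_def)
  have 1: "((\<lambda>u. d_v f (u, v0)) has_vector_derivative d_u (d_v f) (u0, v0)) (at u0 within {a..u0 + r})"
    using diff(3) assms(3) p by (intro has_vector_derivative_d_u) auto
  have "((\<lambda>u. integral {a..u} (\<lambda>s. d_v (d_u f) (s, v0))) has_vector_derivative d_v (d_u f) (u0, v0))
      (at u0 within {a..u0 + r})"
    by (rule integral_has_vector_derivative[OF continuous_on_compose2[OF cont_uv] u0])
      (use box r(1) in \<open>auto intro!: continuous_intros simp: V_def\<close>)
  from has_vector_derivative_add[OF has_vector_derivative_const this, of "d_v f (a, v0)"]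
  have 2: "((\<lambda>u. d_v f (u, v0)) has_vector_derivative d_v (d_u f) (u0, v0)) (at u0 within {a..u0 + r})"
    by (intro has_vector_derivative_transform[OF u0 dv]) auto
  show ?thesis unfolding p
    by (rule vector_derivative_unique_within[OF _ 1 2])
      (use r(1) in \<open>simp add: a_def trivial_limit_within islimpt_Icc\<close>)
qed


section \<open>Linear Pfaffian systems\<close>

text \<open>The oriented integral from \<open>a\<close> to \<open>b\<close>, pulled back to the unit interval: it has the right sign
  for \<open>b < a\<close>, and the theorems on integrals over a fixed interval with a parameter apply to it.\<close>
definition oint :: "real \<Rightarrow> real \<Rightarrow> (real \<Rightarrow> 'a::banach) \<Rightarrow> 'a"
  where "oint a b f = (b - a) *\<^sub>R integral {0..1} (\<lambda>s. f (a + s * (b - a)))"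

lemma oint_refl [simp]: "oint a a f = 0"
  by (simp add: oint_def)

lemma segment_in_interval:
  fixes a b c d s :: real
  assumes "a \<in> {c..d}" "b \<in> {c..d}" "s \<in> {0..1}"
  shows "a + s * (b - a) \<in> {c..d}"
proof -
  have "(1 - s) *\<^sub>R a + s *\<^sub>R b \<in> {c..d}"
    by (rule convexD[OF convex_real_interval(5)]) (use assms in auto)
  then show ?thesis by (simp add: algebra_simps)
qed

lemma continuous_on_segment:
  assumes "continuous_on {c..d} f" "a \<in> {c..d}" "b \<in> {c..d}"
  shows "continuous_on {0..1} (\<lambda>s. f (a + s * (b - a :: real)))"
  by (rule continuous_on_compose2[OF assms(1)])
    (use segment_in_interval[OF assms(2,3)] in \<open>auto intro!: continuous_intros\<close>)

lemma norm_oint_le: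
  assumes "continuous_on {c..d} f" "a \<in> {c..d}" "b \<in> {c..d}"
    and "\<And>x. x \<in> {c..d} \<Longrightarrow> norm (f x) \<le> C"
  shows "norm (oint a b f) \<le> C * \<bar>b - a\<bar>"
proof -
  have "norm (integral {0..1} (\<lambda>s. f (a + s * (b - a)))) \<le> C * (1 - 0)"
    by (rule integral_bound[OF _ continuous_on_segment[OF assms(1-3)]])
      (use assms(4) segment_in_interval[OF assms(2,3)] in auto)
  then show ?thesis by (simp add: oint_def mult.commute[of C] mult_left_mono)
qed

lemma oint_ftc:
  assumes "\<And>x. x \<in> {c..d} \<Longrightarrow> (F has_vector_derivative f x) (at x within {c..d})"
    and "a \<in> {c..d}" "b \<in> {c..d}"
  shows "oint a b f = F b - F a"
proof -
  have D: "((F \<circ> (\<lambda>s. a + s * (b - a))) has_vector_derivative (b - a) *\<^sub>R f (a + s * (b - a)))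
      (at s within {0..1})" if "s \<in> {0..1}" for s
  proof (rule vector_diff_chain_within)
    show "((\<lambda>s. a + s * (b - a)) has_vector_derivative b - a) (at s within {0..1})"
      by (auto intro!: derivative_eq_intros simp: has_real_derivative_iff_has_vector_derivative[symmetric])
    show "(F has_vector_derivative f (a + s * (b - a)))
        (at (a + s * (b - a)) within (\<lambda>s. a + s * (b - a)) ` {0..1})"
      by (rule has_vector_derivative_within_subset[OF assms(1)])
        (use segment_in_interval[OF assms(2,3)] that in auto)
  qed
  have "((\<lambda>s. (b - a) *\<^sub>R f (a + s * (b - a))) has_integral
      (F \<circ> (\<lambda>s. a + s * (b - a))) 1 - (F \<circ> (\<lambda>s. a + s * (b - a))) 0) {0..1}"
    by (rule fundamental_theorem_of_calculus[OF _ D]) auto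
  from integral_unique[OF this] show ?thesis
    by (simp add: oint_def)
qed

lemma has_vector_derivative_oint:
  assumes "continuous_on {c..d} f" "a \<in> {c..d}" "x \<in> {c..d}"
  shows "((\<lambda>x. oint a x f) has_vector_derivative f x) (at x within {c..d})"
proof -
  have F: "((\<lambda>x. integral {c..x} f) has_vector_derivative f x) (at x within {c..d})"
    if "x \<in> {c..d}" for x
    using assms(1) that by (rule integral_has_vector_derivative)
  have "((\<lambda>x. integral {c..x} f - integral {c..a} f) has_vector_derivative f x - 0)
      (at x within {c..d})"
    using F[OF assms(3)] by (intro has_vector_derivative_diff has_vector_derivative_const)
  then have "((\<lambda>x. integral {c..x} f - integral {c..a} f) has_vector_derivative f x)
      (at x within {c..d})" by simp
  then show ?thesis
    by (rule has_vector_derivative_transform[OF assms(3), rotated])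
      (use oint_ftc[OF F] assms(2) in auto)
qed

lemma continuous_on_oint:
  assumes "continuous_on UNIV (\<lambda>(p, x). f p x)" "continuous_on UNIV b"
  shows "continuous_on UNIV (\<lambda>p. oint a (b p) (f p))"
proof -
  have "continuous_on (UNIV \<times> cbox 0 1) (\<lambda>(p, s). f p (a + s * (b p - a)))"
    unfolding split_beta
    by (rule continuous_on_compose2[OF assms(1)[unfolded split_beta], of _ "\<lambda>x. (fst x, a + snd x * (b (fst x) - a))", simplified])
      (intro continuous_intros continuous_on_compose2[OF assms(2)], auto)
  from integral_continuous_on_param[OF this] assms(2) show ?thesis
    unfolding oint_def by (auto intro!: continuous_intros)
qed

text \<open>Picard iteration in two variables. Each of the two integrals is Lipschitz in \<open>X\<close> with constant
  \<open>\<delta> K \<le> 1/4\<close>, so the right-hand side is a contraction. The coefficients live on the whole plane, so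
  that the fixed point can be sought in the Banach space of bounded continuous functions there;
  on the line \<open>v = v0\<close> the equation only involves \<open>A\<close>, and on the lines \<open>u = const\<close> only \<open>B\<close>.\<close>
lemma volterra_solution:
  fixes A B :: "real \<times> real \<Rightarrow> 'v::banach \<Rightarrow>\<^sub>L 'v"
  assumes cont: "continuous_on UNIV A" "continuous_on UNIV B"
    and K: "\<And>p. norm (A p) \<le> K" "\<And>p. norm (B p) \<le> K"
    and \<delta>: "\<delta> > 0" "\<delta> * K \<le> 1 / 4"
  obtains X where "continuous_on UNIV X"
    "\<And>u v. \<lbrakk>\<bar>u - u0\<bar> \<le> \<delta>; \<bar>v - v0\<bar> \<le> \<delta>\<rbrakk> \<Longrightarrow> X (u, v) = X0
        + oint u0 u (\<lambda>s. A (s, v0) (X (s, v0))) + oint v0 v (\<lambda>t. B (u, t) (X (u, t)))"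
proof -
  define c where "c x0 x = max (x0 - \<delta>) (min (x0 + \<delta>) x)" for x0 x :: real
  have c: "c x0 x \<in> {x0 - \<delta>..x0 + \<delta>}" "\<bar>c x0 x - x0\<bar> \<le> \<delta>" for x0 x
    using \<delta>(1) by (auto simp: c_def)
  have c_id: "c x0 x = x" if "\<bar>x - x0\<bar> \<le> \<delta>" for x0 x
    using that by (auto simp: c_def)
  have cont_c: "continuous_on UNIV (\<lambda>p. c x0 (f p))" if "continuous_on UNIV f"
    for x0 and f :: "real \<times> real \<Rightarrow> real"
    unfolding c_def using that by (intro continuous_intros)
  define T where "T X p = X0 + oint u0 (c u0 (fst p)) (\<lambda>s. A (s, v0) (X (s, v0)))
      + oint v0 (c v0 (snd p)) (\<lambda>t. B (fst p, t) (X (fst p, t)))" for X :: "real \<times> real \<Rightarrow> 'v" and p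
  have cAX: "continuous_on S (\<lambda>s. A (g s) (X (g s)))" "continuous_on S (\<lambda>s. B (g s) (X (g s)))"
    if "continuous_on UNIV X" "continuous_on S g" for X S and g :: "'x::topological_space \<Rightarrow> _"
    using that by (auto intro!: continuous_intros blinfun.continuous_on
        continuous_on_compose2[OF cont(1)] continuous_on_compose2[OF cont(2)]
        continuous_on_compose2[OF that(1)])
  have T_cont: "continuous_on UNIV (T X)" if "continuous_on UNIV X" for X
    unfolding T_def split_beta
    by (intro continuous_intros continuous_on_oint cont_c)
      (unfold split_beta, (intro cAX that continuous_intros)+)
  have T_diff: "norm (T X p - T Y p) \<le> 1 / 2 * m"
    if "continuous_on UNIV X" "continuous_on UNIV Y" "\<And>p. norm (X p - Y p) \<le> m" for X Y p m
  proof -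
    have m: "0 \<le> m" using that(3)[of undefined] norm_ge_zero order_trans by blast
    have est: "norm (oint x0 (c x0 x) (\<lambda>s. L (g s) (X (g s))) - oint x0 (c x0 x) (\<lambda>s. L (g s) (Y (g s))))
        \<le> 1 / 4 * m"
      if "continuous_on UNIV (\<lambda>s. L (g s) (X (g s)))" "continuous_on UNIV (\<lambda>s. L (g s) (Y (g s)))"
        "\<And>p. norm (L p) \<le> K" for x0 x g and L :: "real \<times> real \<Rightarrow> 'v \<Rightarrow>\<^sub>L 'v"
    proof -
      let ?I = "{x0 - \<delta>..x0 + \<delta>}"
      have x0: "x0 \<in> ?I" using \<delta>(1) by simp
      have cI: "continuous_on ?I (\<lambda>s. L (g s) (X (g s)))" "continuous_on ?I (\<lambda>s. L (g s) (Y (g s)))"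
        using that(1,2) continuous_on_subset by blast+
      have "oint x0 (c x0 x) (\<lambda>s. L (g s) (X (g s))) - oint x0 (c x0 x) (\<lambda>s. L (g s) (Y (g s)))
          = oint x0 (c x0 x) (\<lambda>s. L (g s) (X (g s)) - L (g s) (Y (g s)))"
        unfolding oint_def scaleR_diff_right[symmetric]
        by (subst integral_diff)
          (auto intro!: integrable_continuous_real continuous_on_segment[OF cI(1) x0 c(1)]
            continuous_on_segment[OF cI(2) x0 c(1)])
      also have "norm \<dots> \<le> K * m * \<bar>c x0 x - x0\<bar>"
      proof (rule norm_oint_le[OF _ x0 c(1)])
        show "continuous_on ?I (\<lambda>s. L (g s) (X (g s)) - L (g s) (Y (g s)))"
          using cI by (rule continuous_on_diff)
        show "norm (L (g s) (X (g s)) - L (g s) (Y (g s))) \<le> K * m" for s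
          unfolding blinfun.diff_right[symmetric]
          using norm_blinfun[of "L (g s)" "X (g s) - Y (g s)"]
            mult_mono[OF that(3)[of "g s"] \<open>\<And>p. norm (X p - Y p) \<le> m\<close>[of "g s"]]
            norm_ge_zero[of "L (g s)"] that(3)[of "g s"]
          by (smt (verit) norm_ge_zero)
      qed
      also have "\<dots> \<le> K * m * \<delta>"
        by (intro mult_left_mono mult_nonneg_nonneg c(2) m order_trans[OF norm_ge_zero that(3)])
      also have "\<dots> = (\<delta> * K) * m" by simp
      also have "\<dots> \<le> 1 / 4 * m" using \<delta>(2) m by (rule mult_right_mono)
      finally show ?thesis .
    qed
    have "T X p - T Y p =
       (oint u0 (c u0 (fst p)) (\<lambda>s. A (s, v0) (X (s, v0))) - oint u0 (c u0 (fst p)) (\<lambda>s. A (s, v0) (Y (s, v0))))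
       + (oint v0 (c v0 (snd p)) (\<lambda>t. B (fst p, t) (X (fst p, t))) - oint v0 (c v0 (snd p)) (\<lambda>t. B (fst p, t) (Y (fst p, t))))"
      by (simp add: T_def)
    also have "norm \<dots> \<le> 1 / 4 * m + 1 / 4 * m"
      by (intro norm_triangle_mono est K cAX that continuous_intros)
    finally show ?thesis by simp
  qed
  \<comment> \<open>Composing with the retraction onto the square makes the iterates bounded.\<close>
  define clamp2 where "clamp2 p = (c u0 (fst p), c v0 (snd p))" for p :: "real \<times> real"
  have clamp2_cont: "continuous_on UNIV clamp2"
    unfolding clamp2_def by (intro continuous_intros cont_c)
  have clamp2_range: "clamp2 p \<in> {u0 - \<delta>..u0 + \<delta>} \<times> {v0 - \<delta>..v0 + \<delta>}" for p
    unfolding clamp2_def using c(1) by simp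
  have T_bcont: "(\<lambda>p. T X (clamp2 p)) \<in> bcontfun" if "continuous_on UNIV X" for X
  proof -
    have "continuous_on UNIV (\<lambda>p. T X (clamp2 p))"
      by (rule continuous_on_compose2[OF T_cont[OF that] clamp2_cont]) auto
    moreover have "compact (T X ` ({u0 - \<delta>..u0 + \<delta>} \<times> {v0 - \<delta>..v0 + \<delta>}))"
      using T_cont[OF that] by (intro compact_continuous_image compact_Times) (auto intro: continuous_on_subset)
    then have "bounded (range (\<lambda>p. T X (clamp2 p)))"
      using clamp2_range by (elim bounded_subset[OF compact_imp_bounded]) auto
    ultimately show ?thesis by (simp add: bcontfun_def)
  qed
  define \<Phi> :: "((real \<times> real) \<Rightarrow>\<^sub>C 'v) \<Rightarrow> ((real \<times> real) \<Rightarrow>\<^sub>C 'v)"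
    where "\<Phi> X = Bcontfun (\<lambda>p. T (apply_bcontfun X) (clamp2 p))" for X
  have \<Phi>: "apply_bcontfun (\<Phi> X) p = T (apply_bcontfun X) (clamp2 p)" for X p
    unfolding \<Phi>_def by (simp add: Bcontfun_inverse T_bcont)
  have "\<exists>!X. \<Phi> X = X"
  proof (rule banach_fix_type[of "1 / 2"])
    show "\<forall>X Y. dist (\<Phi> X) (\<Phi> Y) \<le> 1 / 2 * dist X Y"
    proof (intro allI dist_bound)
      fix X Y p
      show "dist (apply_bcontfun (\<Phi> X) p) (apply_bcontfun (\<Phi> Y) p) \<le> 1 / 2 * dist X Y"
        unfolding \<Phi> dist_norm
        by (rule T_diff) (use dist_bounded[of X _ Y] in \<open>auto simp: dist_norm\<close>)
    qed
  qed auto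
  then obtain X where X: "\<Phi> X = X" by blast
  show thesis
  proof (rule that[of "apply_bcontfun X"])
    fix u v assume uv: "\<bar>u - u0\<bar> \<le> \<delta>" "\<bar>v - v0\<bar> \<le> \<delta>"
    have "apply_bcontfun X (u, v) = T (apply_bcontfun X) (clamp2 (u, v))" using \<Phi>[of X "(u, v)"] X by simp
    then show "apply_bcontfun X (u, v) = X0
        + oint u0 u (\<lambda>s. A (s, v0) (apply_bcontfun X (s, v0)))
        + oint v0 v (\<lambda>t. B (u, t) (apply_bcontfun X (u, t)))"
      by (simp add: clamp2_def T_def c_id uv)
  qed auto
qed


text \<open>The Frobenius theorem for linear systems in two variables. Let \<open>X\<close> solve \<open>X_u = A X\<close> on the line
  \<open>v = v0\<close> and \<open>X_v = B X\<close> on all lines \<open>u = const\<close>, and put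
  \<open>P(u,v) = X(u0,v) + \<integral>_u0^u A X ds\<close>. It has to be shown that the defect \<open>R = X - P\<close> vanishes.
  Differentiation under the integral sign, \<open>A_v + A B = B_u + B A\<close> and \<open>P_u = A X\<close> give
  \<open>R_v = B R - \<integral>_u0^u B_u R ds\<close>, and \<open>R = 0\<close> on \<open>v = v0\<close>. This equation is linear
  and homogeneous in \<open>R\<close>, and on a small square it forces \<open>R = 0\<close>. Smoothness then follows by
  bootstrapping.\<close>
theorem linear_pfaffian_system:
  fixes A B :: "real \<times> real \<Rightarrow> 'v::banach \<Rightarrow>\<^sub>L 'v"
  assumes D: "open D" "q0 \<in> D"
    and smooth: "smooth_on D A" "smooth_on D B"
    and compat: "\<And>p x. p \<in> D \<Longrightarrow> d_v A p x + A p (B p x) = d_u B p x + B p (A p x)"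
  obtains D0 X where "plane_domain D0" "q0 \<in> D0" "D0 \<subseteq> D" "smooth_on D0 X" "X q0 = X0"
    "\<And>p. p \<in> D0 \<Longrightarrow> d_u X p = A p (X p)" "\<And>p. p \<in> D0 \<Longrightarrow> d_v X p = B p (X p)"
proof -
  obtain u0 v0 where q0: "q0 = (u0, v0)" by (cases q0)
  obtain r where r: "r > 0" "\<And>u v. \<lbrakk>\<bar>u - u0\<bar> \<le> r; \<bar>v - v0\<bar> \<le> r\<rbrakk> \<Longrightarrow> (u, v) \<in> D"
    using open_plane_contains_box D q0 by metis
  define Q where "Q = {u0 - r..u0 + r} \<times> {v0 - r..v0 + r}"
  have Q: "compact Q" "Q \<subseteq> D"
    using r(2) by (auto simp: Q_def abs_le_iff compact_Times)
  have bnd: "\<exists>K. \<forall>p\<in>Q. norm (L p) \<le> K" if "smooth_on D L" for L :: "real \<times> real \<Rightarrow> 'v \<Rightarrow>\<^sub>L 'v"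
  proof -
    have "compact (L ` Q)"
      using that Q by (intro compact_continuous_image) (auto intro: continuous_on_subset smooth_on_continuous)
    then show ?thesis
      using compact_imp_bounded bounded_iff by (metis imageI)
  qed
  obtain K1 K2 K3 where K123: "\<forall>p\<in>Q. norm (A p) \<le> K1" "\<forall>p\<in>Q. norm (B p) \<le> K2"
    "\<forall>p\<in>Q. norm (d_u B p) \<le> K3"
    using bnd[OF smooth(1)] bnd[OF smooth(2)] bnd[OF smooth_on_d_u[OF smooth(2)]] by metis
  define K where "K = Max {1, K1, K2, K3}"
  have Kge: "1 \<le> K" "K1 \<le> K" "K2 \<le> K" "K3 \<le> K" unfolding K_def by simp_all
  have K: "norm (A p) \<le> K" "norm (B p) \<le> K" "norm (d_u B p) \<le> K" if "p \<in> Q" for p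
    using K123 Kge that by force+
  \<comment> \<open>\<open>\<delta> K \<le> 1/4\<close> is for the contraction; with \<open>\<delta> \<le> 1\<close> it also gives \<open>\<bar>R\<bar> \<le> (K + \<delta> K) \<delta> max \<bar>R\<bar>
    \<le> max \<bar>R\<bar> / 2\<close> below.\<close>
  define \<delta> where "\<delta> = min (min r 1) (1 / (4 * K))"
  have \<delta>: "\<delta> > 0" "\<delta> \<le> r" "\<delta> \<le> 1" using r(1) Kge(1) by (auto simp: \<delta>_def)
  have \<delta>K: "\<delta> * K \<le> 1 / 4"
  proof -
    have "\<delta> * K \<le> 1 / (4 * K) * K" using Kge(1) by (intro mult_right_mono) (auto simp: \<delta>_def)
    then show ?thesis using Kge(1) by simp
  qed
  define I where "I = {u0 - \<delta>..u0 + \<delta>}"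
  define J where "J = {v0 - \<delta>..v0 + \<delta>}"
  have IJ: "I \<times> J \<subseteq> Q" using \<delta>(2) by (auto simp: I_def J_def Q_def)
  have IJ_D: "(u, v) \<in> D" if "u \<in> I" "v \<in> J" for u v using that IJ Q(2) by blast
  have mid: "u0 \<in> I" "v0 \<in> J" using \<delta>(1) by (auto simp: I_def J_def)

  \<comment> \<open>Extend the coefficients to the plane by composing with the retraction onto \<open>Q\<close>.\<close>
  define ret where "ret p = (max (u0 - r) (min (u0 + r) (fst p)), max (v0 - r) (min (v0 + r) (snd p)))"
    for p :: "real \<times> real"
  have ret_cont: "continuous_on UNIV ret" unfolding ret_def by (intro continuous_intros)
  have ret_Q: "ret p \<in> Q" for p using r(1) by (auto simp: ret_def Q_def)
  have ret_id: "ret (u, v) = (u, v)" if "u \<in> I" "v \<in> J" for u v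
    using that \<delta>(2) by (auto simp: ret_def I_def J_def)
  have ext_cont: "continuous_on UNIV (\<lambda>p. L (ret p))" if "smooth_on D L" for L :: "real \<times> real \<Rightarrow> 'v \<Rightarrow>\<^sub>L 'v"
    by (rule continuous_on_compose2[OF smooth_on_continuous[OF that] ret_cont]) (use ret_Q Q(2) in auto)
  obtain X where X_cont: "continuous_on UNIV X"
    and X_eq: "\<And>u v. \<lbrakk>\<bar>u - u0\<bar> \<le> \<delta>; \<bar>v - v0\<bar> \<le> \<delta>\<rbrakk> \<Longrightarrow> X (u, v) = X0
        + oint u0 u (\<lambda>s. A (ret (s, v0)) (X (s, v0))) + oint v0 v (\<lambda>t. B (ret (u, t)) (X (u, t)))"
    by (rule volterra_solution[OF ext_cont[OF smooth(1)] ext_cont[OF smooth(2)]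
        K(1)[OF ret_Q] K(2)[OF ret_Q] \<delta>(1) \<delta>K, where ?X0.0 = X0 and ?u0.0 = u0 and ?v0.0 = v0])
      (rule that)
  have cont_I: "continuous_on I (\<lambda>s. L (s, v) (f (s, v)))" if "smooth_on D L" "continuous_on (I \<times> J) f" "v \<in> J"
    for L :: "real \<times> real \<Rightarrow> 'v \<Rightarrow>\<^sub>L 'v" and v f
    using that IJ_D
    by (intro blinfun.continuous_on continuous_on_compose2[OF smooth_on_continuous[OF that(1)]]
        continuous_on_compose2[OF that(2)] continuous_intros) auto
  have cont_J: "continuous_on J (\<lambda>t. L (u, t) (f (u, t)))" if "smooth_on D L" "continuous_on (I \<times> J) f" "u \<in> I"
    for L :: "real \<times> real \<Rightarrow> 'v \<Rightarrow>\<^sub>L 'v" and u f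
    using that IJ_D
    by (intro blinfun.continuous_on continuous_on_compose2[OF smooth_on_continuous[OF that(1)]]
        continuous_on_compose2[OF that(2)] continuous_intros) auto
  have cont_seg: "continuous_on (J \<times> {0..1}) (\<lambda>(v, s). L (u0 + s * (u - u0), v) (f (u0 + s * (u - u0), v)))"
    if "smooth_on D L" "continuous_on (I \<times> J) f" "u \<in> I"
    for L :: "real \<times> real \<Rightarrow> 'v \<Rightarrow>\<^sub>L 'v" and u f
    unfolding split_beta using that IJ_D segment_in_interval[of u0 "u0 - \<delta>" "u0 + \<delta>" u] mid
    by (intro blinfun.continuous_on continuous_on_compose2[OF smooth_on_continuous[OF that(1)]]
        continuous_on_compose2[OF that(2)] continuous_intros) (auto simp: I_def)
  have X_IJ: "continuous_on (I \<times> J) X" using X_cont continuous_on_subset by blast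

  have oint_cong_ret: "oint v0 v (\<lambda>t. B (ret (u, t)) (X (u, t))) = oint v0 v (\<lambda>t. B (u, t) (X (u, t)))"
    if "u \<in> I" "v \<in> J" for u v
    unfolding oint_def using that segment_in_interval[OF mid(2)[unfolded J_def] that(2)[unfolded J_def]] ret_id
    by (intro arg_cong[where f = "scaleR _"] integral_cong) (simp add: J_def)
  have oint_cong_ret': "oint u0 u (\<lambda>s. A (ret (s, v0)) (X (s, v0))) = oint u0 u (\<lambda>s. A (s, v0) (X (s, v0)))"
    if "u \<in> I" for u
    unfolding oint_def using that segment_in_interval[OF mid(1)[unfolded I_def] that(1)[unfolded I_def]] ret_id mid
    by (intro arg_cong[where f = "scaleR _"] integral_cong) (simp add: I_def)
  have X_eq': "X (u, v) = X0 + oint u0 u (\<lambda>s. A (s, v0) (X (s, v0))) + oint v0 v (\<lambda>t. B (u, t) (X (u, t)))"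
    if "u \<in> I" "v \<in> J" for u v
    using X_eq[of u v] oint_cong_ret oint_cong_ret' that by (auto simp: I_def J_def abs_le_iff)

  have X_v: "((\<lambda>v. X (u, v)) has_vector_derivative B (u, v) (X (u, v))) (at v within J)"
    if "u \<in> I" "v \<in> J" for u v
  proof -
    have "((\<lambda>v. X0 + oint u0 u (\<lambda>s. A (s, v0) (X (s, v0))) + oint v0 v (\<lambda>t. B (u, t) (X (u, t))))
        has_vector_derivative 0 + B (u, v) (X (u, v))) (at v within J)"
      unfolding J_def
      by (rule has_vector_derivative_add[OF has_vector_derivative_const has_vector_derivative_oint])
        (use cont_J[OF smooth(2) X_IJ that(1)] mid(2) that(2) in \<open>auto simp: J_def\<close>)
    then show ?thesis
      using X_eq'[OF that(1)] by (auto intro: has_vector_derivative_transform[OF that(2)])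
  qed

  define P where "P u v = X (u0, v) + oint u0 u (\<lambda>s. A (s, v) (X (s, v)))" for u v
  have P_u: "((\<lambda>u. P u v) has_vector_derivative A (u, v) (X (u, v))) (at u within I)"
    if "u \<in> I" "v \<in> J" for u v
  proof -
    have "((\<lambda>u. P u v) has_vector_derivative 0 + A (u, v) (X (u, v))) (at u within I)"
      unfolding I_def P_def
      by (rule has_vector_derivative_add[OF has_vector_derivative_const has_vector_derivative_oint])
        (use cont_I[OF smooth(1) X_IJ that(2)] mid(1) that(1) in \<open>auto simp: I_def\<close>)
    then show ?thesis by simp
  qed
  define R where "R p = X p - P (fst p) (snd p)" for p

  have bil: "((\<lambda>t. L (g t) (f t)) has_vector_derivative L (g x) f' + L' (f x)) (at x within S)"
    if "((\<lambda>t. L (g t)) has_vector_derivative L') (at x within S)" "(f has_vector_derivative f') (at x within S)"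
    for L :: "real \<times> real \<Rightarrow> 'v \<Rightarrow>\<^sub>L 'v" and L' g f f' x S
    using bounded_bilinear.has_vector_derivative[OF bounded_bilinear_blinfun_apply that] .
  have diffAB: "A differentiable (at p)" "B differentiable (at p)" if "p \<in> D" for p
    using smooth_on_differentiable smooth that by blast+

  have P_cont: "continuous_on (I \<times> J) (\<lambda>p. P (fst p) (snd p))"
  proof -
    have "continuous_on ((I \<times> J) \<times> cbox 0 1)
        (\<lambda>(p, s). A (u0 + s * (fst p - u0), snd p) (X (u0 + s * (fst p - u0), snd p)))"
      unfolding split_beta
      by (intro blinfun.continuous_on continuous_on_compose2[OF smooth_on_continuous[OF smooth(1)]]
        continuous_on_compose2[OF X_cont] continuous_intros)
        (use IJ_D segment_in_interval[of u0 "u0 - \<delta>" "u0 + \<delta>"] mid in \<open>auto simp: I_def\<close>)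
    from integral_continuous_on_param[OF this]
    show ?thesis unfolding P_def oint_def
      by (auto intro!: continuous_intros continuous_on_compose2[OF X_cont])
  qed
  have R_cont: "continuous_on (I \<times> J) R"
    unfolding R_def using X_IJ P_cont by (rule continuous_on_diff)

  have R_v: "((\<lambda>v. R (u, v)) has_vector_derivative
      B (u, v) (R (u, v)) - oint u0 u (\<lambda>s. d_u B (s, v) (R (s, v)))) (at v within J)"
    if u: "u \<in> I" and v: "v \<in> J" for u v
  proof -
    let ?g = "\<lambda>s. u0 + s * (u - u0)"
    have g: "?g s \<in> I" if "s \<in> {0..1}" for s
      using segment_in_interval[OF mid(1)[unfolded I_def] u[unfolded I_def] that] by (simp add: I_def)
    let ?h = "\<lambda>v s. A (?g s, v) (X (?g s, v))"
    let ?h' = "\<lambda>v s. A (?g s, v) (B (?g s, v) (X (?g s, v))) + d_v A (?g s, v) (X (?g s, v))"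
    have cBX: "continuous_on (I \<times> J) (\<lambda>p. B p (X p))"
      using smooth_on_continuous[OF smooth(2)] X_IJ IJ Q(2)
      by (auto intro!: blinfun.continuous_on intro: continuous_on_subset)
    have "((\<lambda>v. integral (cbox 0 1) (?h v)) has_vector_derivative integral (cbox 0 1) (?h' v)) (at v within J)"
    proof (rule leibniz_rule_vector_derivative)
      show "((\<lambda>v. ?h v s) has_vector_derivative ?h' v s) (at v within J)" if "v \<in> J" "s \<in> cbox 0 1" for v s
        using that g IJ_D diffAB by (intro bil has_vector_derivative_d_v X_v) auto
      show "?h v integrable_on cbox 0 1" if "v \<in> J" for v
        using continuous_on_segment[OF cont_I[OF smooth(1) X_IJ that, unfolded I_def] mid(1)[unfolded I_def] u[unfolded I_def]]
        by (auto intro: integrable_continuous_real)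
      show "continuous_on (J \<times> cbox 0 1) (\<lambda>(v, s). ?h' v s)"
        using continuous_on_add[OF cont_seg[OF smooth(1) cBX u] cont_seg[OF smooth_on_d_v[OF smooth(1)] X_IJ u]]
        by (simp add: split_beta)
    qed (use v in \<open>auto simp: J_def\<close>)
    then have "((\<lambda>v. oint u0 u (\<lambda>s. A (s, v) (X (s, v)))) has_vector_derivative
        (u - u0) *\<^sub>R integral (cbox 0 1) (?h' v)) (at v within J)"
      unfolding oint_def by (auto intro!: has_vector_derivative_scaleR[where f = "\<lambda>_. u - u0", THEN has_vector_derivative_eq_rhs] derivative_eq_intros)
    then have "((\<lambda>v. X (u, v) - (X (u0, v) + oint u0 u (\<lambda>s. A (s, v) (X (s, v))))) has_vector_derivative
        B (u, v) (X (u, v)) - (B (u0, v) (X (u0, v)) + (u - u0) *\<^sub>R integral (cbox 0 1) (?h' v))) (at v within J)"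
      using u v mid by (intro has_vector_derivative_diff has_vector_derivative_add X_v)
    moreover have "(u - u0) *\<^sub>R integral (cbox 0 1) (?h' v)
        = B (u, v) (P u v) - B (u0, v) (X (u0, v)) + oint u0 u (\<lambda>s. d_u B (s, v) (R (s, v)))"
    proof -
      have "(u - u0) *\<^sub>R integral (cbox 0 1) (?h' v)
          = oint u0 u (\<lambda>s. (B (s, v) (A (s, v) (X (s, v))) + d_u B (s, v) (P s v)) + d_u B (s, v) (R (s, v)))"
        unfolding oint_def cbox_interval
      proof (intro arg_cong[where f = "scaleR _"] integral_cong)
        fix s :: real assume "s \<in> {0..1}"
        then have D: "(?g s, v) \<in> D" using g IJ_D v by blast
        have "?h' v s = B (?g s, v) (A (?g s, v) (X (?g s, v))) + d_u B (?g s, v) (X (?g s, v))"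
          using compat[OF D, of "X (?g s, v)"] by (simp add: add.commute)
        also have "d_u B (?g s, v) (X (?g s, v)) = d_u B (?g s, v) (P (?g s) v) + d_u B (?g s, v) (R (?g s, v))"
          by (simp add: R_def blinfun.add_right[symmetric])
        finally show "?h' v s = B (?g s, v) (A (?g s, v) (X (?g s, v)))
            + d_u B (?g s, v) (P (?g s) v) + d_u B (?g s, v) (R (?g s, v))"
          by (simp add: add.assoc)
      qed
      also have "\<dots> = oint u0 u (\<lambda>s. B (s, v) (A (s, v) (X (s, v))) + d_u B (s, v) (P s v))
          + oint u0 u (\<lambda>s. d_u B (s, v) (R (s, v)))"
      proof -
        have cAX: "continuous_on (I \<times> J) (\<lambda>p. A p (X p))"
          using smooth_on_continuous[OF smooth(1)] X_IJ IJ Q(2)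
          by (auto intro!: blinfun.continuous_on intro: continuous_on_subset)
        have 1: "continuous_on I (\<lambda>s. B (s, v) (A (s, v) (X (s, v))) + d_u B (s, v) (P s v))"
          using cont_I[OF smooth(2) cAX v] cont_I[OF smooth_on_d_u[OF smooth(2)] P_cont v]
          by (auto intro!: continuous_on_add)
        have 2: "continuous_on I (\<lambda>s. d_u B (s, v) (R (s, v)))"
          by (rule cont_I[OF smooth_on_d_u[OF smooth(2)] R_cont v])
        show ?thesis
          unfolding oint_def scaleR_add_right[symmetric]
          by (rule arg_cong[where f = "scaleR _"], rule integral_add;
              rule integrable_continuous_real;
              rule continuous_on_segment[OF 1[unfolded I_def] mid(1)[unfolded I_def] u[unfolded I_def]]
                continuous_on_segment[OF 2[unfolded I_def] mid(1)[unfolded I_def] u[unfolded I_def]])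
      qed
      \<comment> \<open>The integrand is the \<open>u\<close>-derivative of \<open>B P\<close>.\<close>
      also have "oint u0 u (\<lambda>s. B (s, v) (A (s, v) (X (s, v))) + d_u B (s, v) (P s v))
          = B (u, v) (P u v) - B (u0, v) (P u0 v)"
        by (rule oint_ftc[where c = "u0 - \<delta>" and d = "u0 + \<delta>"])
          (use u v mid IJ_D diffAB P_u in \<open>auto simp: I_def intro!: bil has_vector_derivative_d_u\<close>)
      finally show ?thesis by (simp add: P_def)
    qed
    ultimately show ?thesis
      by (simp add: R_def P_def blinfun.diff_right algebra_simps)
  qed

  \<comment> \<open>The defect \<open>R\<close> vanishes, because its maximum is at most half of itself.\<close>
  have R0: "R (u, v) = 0" if uv: "u \<in> I" "v \<in> J" for u v
  proof -
    have "compact (I \<times> J)" by (simp add: I_def J_def compact_Times)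
    moreover have "I \<times> J \<noteq> {}" using mid by blast
    moreover have "continuous_on (I \<times> J) (\<lambda>p. norm (R p))" using R_cont by (intro continuous_intros)
    ultimately obtain p1 where p1: "p1 \<in> I \<times> J" "\<And>p. p \<in> I \<times> J \<Longrightarrow> norm (R p) \<le> norm (R p1)"
      using continuous_attains_sup by metis
    define m where "m = norm (R p1)"
    have m: "0 \<le> m" "\<And>u v. u \<in> I \<Longrightarrow> v \<in> J \<Longrightarrow> norm (R (u, v)) \<le> m"
      using p1(2) by (auto simp: m_def)
    have R_half: "norm (R (u, v)) \<le> m / 2" if u: "u \<in> I" and v: "v \<in> J" for u v
    proof -
      have "R (u, v0) = 0"
        using X_eq'[OF u mid(2)] X_eq'[OF mid] by (simp add: R_def P_def)
      have "norm (R (u, v) - R (u, v0)) \<le> (2 * K * m) * norm (v - v0)"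
      proof (rule differentiable_bound[of J "\<lambda>v. R (u, v)"])
        fix t assume t: "t \<in> J"
        let ?d = "B (u, t) (R (u, t)) - oint u0 u (\<lambda>s. d_u B (s, t) (R (s, t)))"
        show "((\<lambda>v. R (u, v)) has_derivative (\<lambda>h. h *\<^sub>R ?d)) (at t within J)"
          using R_v[OF u t] by (simp add: has_vector_derivative_def)
        have op: "norm (L p (R p)) \<le> K * m" if "norm (L p) \<le> K" "p \<in> I \<times> J" for L :: "real \<times> real \<Rightarrow> 'v \<Rightarrow>\<^sub>L 'v" and p
          using norm_blinfun[of "L p" "R p"] mult_mono[OF that(1) p1(2)[OF that(2)]] Kge(1) by (simp add: m_def)
        have "norm (oint u0 u (\<lambda>s. d_u B (s, t) (R (s, t)))) \<le> K * m * \<bar>u - u0\<bar>"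
        proof (rule norm_oint_le[where c = "u0 - \<delta>" and d = "u0 + \<delta>"], fold I_def)
          show "norm (d_u B (s, t) (R (s, t))) \<le> K * m" if "s \<in> I" for s
            using op[of "d_u B" "(s, t)"] K(3)[of "(s, t)"] that t IJ by blast
        qed (use cont_I[OF smooth_on_d_u[OF smooth(2)] R_cont t] u mid in auto)
        also have "\<dots> \<le> K * m * 1"
          using u \<delta>(3) m(1) Kge(1) by (intro mult_left_mono mult_nonneg_nonneg) (auto simp: I_def abs_le_iff)
        finally have 1: "norm (oint u0 u (\<lambda>s. d_u B (s, t) (R (s, t)))) \<le> K * m" by simp
        have 2: "norm (B (u, t) (R (u, t))) \<le> K * m"
          using op[of B "(u, t)"] K(2) u t IJ by blast
        have "norm ?d \<le> 2 * K * m"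
          using norm_triangle_ineq4[of "B (u, t) (R (u, t))" "oint u0 u (\<lambda>s. d_u B (s, t) (R (s, t)))"] 1 2 by linarith
        then show "onorm (\<lambda>h. h *\<^sub>R ?d) \<le> 2 * K * m"
          by (intro onorm_le) (simp add: mult.commute[of "2 * K * m"] mult_left_mono del: mult.assoc)
      qed (use v mid in \<open>auto simp: J_def\<close>)
      also have "\<dots> \<le> (2 * K * m) * \<delta>"
        using v m(1) Kge(1) by (intro mult_left_mono mult_nonneg_nonneg) (auto simp: J_def abs_le_iff)
      also have "\<dots> = 2 * m * (\<delta> * K)" by simp
      also have "\<dots> \<le> 2 * m * (1 / 4)" using \<delta>K m(1) by (intro mult_left_mono) auto
      finally show ?thesis using \<open>R (u, v0) = 0\<close> by simp
    qed
    have "m \<le> m / 2" using R_half p1(1) by (cases p1) (auto simp: m_def)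
    then have "m = 0" using m(1) by simp
    then show ?thesis using m(2)[OF uv] by simp
  qed

  have X_u: "((\<lambda>u. X (u, v)) has_vector_derivative A (u, v) (X (u, v))) (at u within I)"
    if "u \<in> I" "v \<in> J" for u v
    by (rule has_vector_derivative_transform[OF that(1) _ P_u[OF that]])
      (use R0 that(2) in \<open>auto simp: R_def\<close>)

  define D0 where "D0 = {u0 - \<delta><..<u0 + \<delta>} \<times> {v0 - \<delta><..<v0 + \<delta>}"
  have D0: "open D0" "D0 \<subseteq> I \<times> J" by (auto simp: D0_def I_def J_def open_Times)
  have X_deriv: "(X has_derivative (\<lambda>w. fst w *\<^sub>R A p (X p) + snd w *\<^sub>R B p (X p))) (at p)"
    if "p \<in> D0" for p
  proof -
    obtain u v where p: "p = (u, v)" and uv: "u \<in> I" "v \<in> J" using \<open>p \<in> D0\<close> D0(2) by auto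
    have c: "continuous_on (I \<times> J) (\<lambda>p. blinfun_scaleR_left (B p (X p)))"
      using smooth_on_continuous[OF smooth(2)] X_IJ IJ Q(2)
      by (intro bounded_linear.continuous_on[OF bounded_linear_blinfun_scaleR_left] blinfun.continuous_on)
        (auto intro: continuous_on_subset)
    have "((\<lambda>(u, v). X (u, v)) has_derivative (\<lambda>(tu, tv). tu *\<^sub>R A (u, v) (X (u, v))
        + blinfun_scaleR_left (B (u, v) (X (u, v))) tv)) (at (u, v) within I \<times> J)"
    proof (rule has_derivative_partialsI)
      show "((\<lambda>u. X (u, v)) has_derivative (\<lambda>tu. tu *\<^sub>R A (u, v) (X (u, v)))) (at u within I)"
        using X_u[OF uv] by (simp add: has_vector_derivative_def)
      show "((\<lambda>v. X (u, v)) has_derivative blinfun_scaleR_left (B (u, v) (X (u, v)))) (at v within J)"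
        if "u \<in> I" "v \<in> J" for u v
        using X_v[OF that] by (simp add: has_vector_derivative_def)
      show "continuous (at (u, v) within I \<times> J) (\<lambda>(u, v). blinfun_scaleR_left (B (u, v) (X (u, v))))"
        using c uv unfolding split_beta prod.collapse continuous_on_eq_continuous_within by blast
    qed (use uv in \<open>auto simp: J_def\<close>)
    then have "(X has_derivative (\<lambda>w. fst w *\<^sub>R A p (X p) + snd w *\<^sub>R B p (X p))) (at p within I \<times> J)"
      by (simp add: p case_prod_beta')
    then show ?thesis
      by (simp add: at_within_open_subset[OF \<open>p \<in> D0\<close> D0])
  qed
  have X_partials: "d_u X p = A p (X p)" "d_v X p = B p (X p)" if "p \<in> D0" for p
    using d_u_eqI[OF X_deriv[OF that]] d_v_eqI[OF X_deriv[OF that]] by simp_all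
  have D0_D: "D0 \<subseteq> D" using D0(2) IJ Q(2) by blast
  have "smooth_on D0 X"
  proof (rule smooth_on_bootstrap)
    show "X differentiable (at p)" if "p \<in> D0" for p using X_deriv[OF that] by (rule differentiableI)
    note prod = C_on_bilinear[OF bounded_bilinear_blinfun_apply D0(1)]
    have sm: "smooth_on D0 A" "smooth_on D0 B" using smooth smooth_on_subset D0_D by blast+
    fix n assume n: "C_on n D0 X"
    show "C_on n D0 (d_u X)"
      using prod[of n A X] sm(1) n C_on_cong[OF D0(1), of "d_u X" "\<lambda>p. A p (X p)"] X_partials(1)
      by (simp add: smooth_on_def)
    show "C_on n D0 (d_v X)"
      using prod[of n B X] sm(2) n C_on_cong[OF D0(1), of "d_v X" "\<lambda>p. B p (X p)"] X_partials(2)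
      by (simp add: smooth_on_def)
  qed
  moreover have "plane_domain D0"
    unfolding plane_domain_def using D0(1) \<delta>(1)
    by (auto simp: D0_def intro!: connected_Times)
  moreover have "q0 \<in> D0" using \<delta>(1) by (simp add: q0 D0_def)
  moreover have "X q0 = X0" using X_eq'[OF mid] by (simp add: q0)
  ultimately show thesis using that[of D0 X] D0_D X_partials by blast
qed


section \<open>Pseudo-orthonormal frames\<close>

lemma ip_commute: "ip X Y = ip Y X"
  by (simp add: ip_def mult.commute)

lemma bounded_bilinear_ip: "bounded_bilinear ip"
proof
  show "\<exists>K. \<forall>a b. norm (ip a b) \<le> norm a * norm b * K"
  proof (intro exI allI)
    fix a b :: "real ^ 4"
    have c: "\<bar>a $ i * b $ i\<bar> \<le> norm a * norm b" for i
      unfolding abs_mult by (intro mult_mono component_le_norm_cart) auto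
    have "\<bar>ip a b\<bar> \<le> \<bar>a $ 1 * b $ 1\<bar> + \<bar>a $ 2 * b $ 2\<bar> + \<bar>a $ 3 * b $ 3\<bar> + \<bar>a $ 4 * b $ 4\<bar>"
      unfolding ip_def by linarith
    then show "norm (ip a b) \<le> norm a * norm b * 4"
      using c[of 1] c[of 2] c[of 3] c[of 4] by simp
  qed
qed (auto simp: ip_def algebra_simps)

interpretation ip: bounded_bilinear ip by (rule bounded_bilinear_ip)

lemmas ip_simps = ip.add_left ip.add_right ip.diff_left ip.diff_right ip.minus_left ip.minus_right
  ip.scaleR_left ip.scaleR_right ip.zero_left ip.zero_right

definition orthonormal_frame :: "real \<Rightarrow> real ^ 4 \<Rightarrow> real ^ 4 \<Rightarrow> real ^ 4 \<Rightarrow> real ^ 4 \<Rightarrow> bool"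
  where "orthonormal_frame eps x y b l \<longleftrightarrow>
    ip x x = 1 \<and> ip y y = -1 \<and> ip b b = eps \<and> ip l l = - eps \<and>
    ip x y = 0 \<and> ip x b = 0 \<and> ip x l = 0 \<and> ip y b = 0 \<and> ip y l = 0 \<and> ip b l = 0"

lemma orthonormal_frameD:
  assumes "orthonormal_frame eps x y b l"
  shows "ip x x = 1" "ip y y = -1" "ip b b = eps" "ip l l = - eps"
    "ip x y = 0" "ip x b = 0" "ip x l = 0" "ip y b = 0" "ip y l = 0" "ip b l = 0"
    "ip y x = 0" "ip b x = 0" "ip l x = 0" "ip b y = 0" "ip l y = 0" "ip l b = 0"
  using assms by (simp_all add: orthonormal_frame_def ip_commute)

text \<open>The tensor \<open>x \<otimes> x' - y \<otimes> y' + eps b \<otimes> b' - eps l \<otimes> l'\<close>, evaluated on two covectors by means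
  of the metric. Two frames are allowed, because uniqueness pairs the frames of two surfaces.\<close>
definition frame_pairing :: "real \<Rightarrow> (real ^ 4) \<times> (real ^ 4) \<times> (real ^ 4) \<times> (real ^ 4) \<Rightarrow>
    (real ^ 4) \<times> (real ^ 4) \<times> (real ^ 4) \<times> (real ^ 4) \<Rightarrow> real ^ 4 \<Rightarrow> real ^ 4 \<Rightarrow> real"
  where "frame_pairing eps = (\<lambda>(x, y, b, l) (x', y', b', l') w w'.
    ip x w * ip x' w' - ip y w * ip y' w' + eps * (ip b w * ip b' w') - eps * (ip l w * ip l' w'))"

lemma vector_4:
  "(vector [x, y, b, l] :: 'a::zero ^ 4) $ 1 = x" "(vector [x, y, b, l] :: 'a ^ 4) $ 2 = y"
  "(vector [x, y, b, l] :: 'a ^ 4) $ 3 = b" "(vector [x, y, b, l] :: 'a ^ 4) $ 4 = l"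
  unfolding vector_def by simp_all

lemma axis_4_simps:
  "(axis 1 c :: real ^ 4) $ 1 = c" "(axis 2 c :: real ^ 4) $ 2 = c"
  "(axis 3 c :: real ^ 4) $ 3 = c" "(axis 4 c :: real ^ 4) $ 4 = c"
  "(axis 1 c :: real ^ 4) $ 2 = 0" "(axis 1 c :: real ^ 4) $ 3 = 0" "(axis 1 c :: real ^ 4) $ 4 = 0"
  "(axis 2 c :: real ^ 4) $ 1 = 0" "(axis 2 c :: real ^ 4) $ 3 = 0" "(axis 2 c :: real ^ 4) $ 4 = 0"
  "(axis 3 c :: real ^ 4) $ 1 = 0" "(axis 3 c :: real ^ 4) $ 2 = 0" "(axis 3 c :: real ^ 4) $ 4 = 0"
  "(axis 4 c :: real ^ 4) $ 1 = 0" "(axis 4 c :: real ^ 4) $ 2 = 0" "(axis 4 c :: real ^ 4) $ 3 = 0"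
  by (simp_all add: axis_def)

lemma ip_eqI:
  assumes "\<And>w. ip X w = ip Y w"
  shows "X = Y"
proof -
  have "X $ 1 = Y $ 1" "X $ 2 = Y $ 2" "X $ 3 = Y $ 3" "X $ 4 = Y $ 4"
    using assms[of "axis 1 1"] assms[of "axis 2 1"] assms[of "axis 3 1"] assms[of "axis 4 1"]
    by (simp_all add: ip_def axis_4_simps)
  then show ?thesis by (simp add: vec_eq_iff forall_4)
qed

text \<open>If the tensor is the metric, then raising an index makes it the identity.\<close>
lemma frame_pairing_expansion:
  assumes "\<And>w w'. frame_pairing eps (x, y, b, l) (x', y', b', l') w w' = ip w w'"
  shows "w = ip x w *\<^sub>R x' - ip y w *\<^sub>R y' + (eps * ip b w) *\<^sub>R b' - (eps * ip l w) *\<^sub>R l'"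
proof (rule ip_eqI)
  fix w'
  show "ip w w' = ip (ip x w *\<^sub>R x' - ip y w *\<^sub>R y' + (eps * ip b w) *\<^sub>R b' - (eps * ip l w) *\<^sub>R l') w'"
    using assms[of w w'] by (simp add: frame_pairing_def ip_simps)
qed

text \<open>Let \<open>M\<close> have the rows \<open>x, y, b, l\<close>, and let \<open>N\<close> be its adjoint with respect to the
  metrics with diagonals \<open>s\<close> and \<open>t\<close>. Orthonormality is \<open>M N = 1\<close>, the identity for the tensor is
  \<open>N M = 1\<close>, and a one-sided inverse of a square matrix is two-sided.\<close>
lemma orthonormal_frame_iff_pairing:
  assumes eps: "eps * eps = 1"
  shows "orthonormal_frame eps x y b l \<longleftrightarrow>
    (\<forall>w w'. frame_pairing eps (x, y, b, l) (x, y, b, l) w w' = ip w w')"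
proof
  define M :: "real ^ 4 ^ 4" where "M = vector [x, y, b, l]"
  define s t :: "real ^ 4" where "s = vector [1, 1, -1, -1]" and "t = vector [1, -1, eps, -eps]"
  define N :: "real ^ 4 ^ 4" where "N = (\<chi> j i. s $ j * t $ i * M $ i $ j)"
  have MN: "(M ** N) $ i $ j = t $ j * ip (M $ i) (M $ j)" for i j
    by (simp add: matrix_matrix_mult_def N_def s_def ip_def sum_4 vector_4 algebra_simps)
  have rows: "M $ 1 = x" "M $ 2 = y" "M $ 3 = b" "M $ 4 = l" by (simp_all add: M_def vector_4)
  { assume on: "orthonormal_frame eps x y b l"
    have "M ** N = mat 1"
      using orthonormal_frameD[OF on] eps
      by (simp add: vec_eq_iff forall_4 MN mat_def rows t_def vector_4)
    then have "N ** M = mat 1" by (simp add: matrix_left_right_inverse)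
    then have NM: "(N ** M) $ i $ j = (if i = j then 1 else 0)" for i j by (simp add: mat_def)
    have sum: "frame_pairing eps (x, y, b, l) (x, y, b, l) w w'
        = (\<Sum>i\<in>UNIV. \<Sum>j\<in>UNIV. (N ** M) $ i $ j * (w $ i * (s $ j * w' $ j)))" for w w'
      by (simp add: frame_pairing_def ip_def matrix_matrix_mult_def sum_4 M_def N_def s_def t_def
          vector_4 algebra_simps)
    show "\<forall>w w'. frame_pairing eps (x, y, b, l) (x, y, b, l) w w' = ip w w'"
      unfolding sum NM by (simp add: sum_4 s_def vector_4 ip_def) }
  { assume "\<forall>w w'. frame_pairing eps (x, y, b, l) (x, y, b, l) w w' = ip w w'"
    then have fp: "frame_pairing eps (x, y, b, l) (x, y, b, l) (axis i 1) (axis j 1) = ip (axis i 1) (axis j 1)"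
      for i j by blast
    have "N ** M = mat 1"
      unfolding vec_eq_iff forall_4 matrix_matrix_mult_def mat_def
      using fp[of 1 1] fp[of 1 2] fp[of 1 3] fp[of 1 4] fp[of 2 1] fp[of 2 2] fp[of 2 3] fp[of 2 4]
        fp[of 3 1] fp[of 3 2] fp[of 3 3] fp[of 3 4] fp[of 4 1] fp[of 4 2] fp[of 4 3] fp[of 4 4]
      by (simp add: sum_4 M_def N_def s_def t_def vector_4 frame_pairing_def ip_def axis_4_simps algebra_simps)
    then have "M ** N = mat 1" by (simp add: matrix_left_right_inverse)
    then have gram: "t $ j * ip (M $ i) (M $ j) = (if i = j then 1 else 0)" for i j
      by (simp add: MN[symmetric] mat_def)
    have "t $ j * t $ j = 1" for j
    proof -
      have "\<forall>j. t $ j * t $ j = 1" using eps by (simp add: forall_4 t_def vector_4)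
      then show ?thesis by blast
    qed
    then have "ip (M $ i) (M $ j) = (if i = j then t $ j else 0)" for i j
      using arg_cong[OF gram[of j i], of "(*) (t $ j)"] by (simp add: mult.assoc[symmetric])
    from this[of 1 1] this[of 2 2] this[of 3 3] this[of 4 4] this[of 1 2] this[of 1 3] this[of 1 4]
      this[of 2 3] this[of 2 4] this[of 3 4]
    show "orthonormal_frame eps x y b l"
      by (simp add: orthonormal_frame_def M_def t_def vector_4) }
qed

lemma orthonormal_expansion:
  assumes "eps * eps = 1" "orthonormal_frame eps x y b l"
  shows "w = ip x w *\<^sub>R x - ip y w *\<^sub>R y + (eps * ip b w) *\<^sub>R b - (eps * ip l w) *\<^sub>R l"
  using frame_pairing_expansion orthonormal_frame_iff_pairing assms by blast

lemma prod_4: "prod f (UNIV :: 4 set) = f 1 * f 2 * f 3 * f 4"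
  unfolding UNIV_4 by (simp add: mult.assoc)

lemma det_diagonal_4:
  "det (\<chi> i j. if i = j then d $ i else 0 :: real ^ 4 ^ 4) = d $ 1 * d $ 2 * d $ 3 * d $ 4"
  by (subst det_diagonal) (auto simp: prod_4)

text \<open>The determinant of the Gram matrix, as the metric itself has determinant one. The nonnegative
  left-hand side fixes the causal character of the fourth vector of an orthonormal frame.\<close>
lemma det_orthogonal_frame:
  assumes "ip x y = 0" "ip x b = 0" "ip x l = 0" "ip y b = 0" "ip y l = 0" "ip b l = 0"
  shows "(det (vector [x, y, b, l] :: real ^ 4 ^ 4))\<^sup>2 = ip x x * ip y y * ip b b * ip l l"
proof -
  define M :: "real ^ 4 ^ 4" where "M = vector [x, y, b, l]"
  define \<eta> :: "real ^ 4 ^ 4" where "\<eta> = (\<chi> i j. if i = j then (vector [1, 1, -1, -1] :: real ^ 4) $ i else 0)"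
  define g :: "real ^ 4" where "g = vector [ip x x, ip y y, ip b b, ip l l]"
  have "M ** (\<eta> ** transpose M) = (\<chi> i j. if i = j then g $ i else 0)"
    using assms
    unfolding vec_eq_iff forall_4 matrix_matrix_mult_def transpose_def
    by (simp add: sum_4 M_def \<eta>_def g_def vector_4 ip_def algebra_simps)
  moreover have "det (M ** (\<eta> ** transpose M)) = (det M)\<^sup>2"
    by (simp add: det_mul det_transpose \<eta>_def det_diagonal_4 vector_4 power2_eq_square)
  ultimately show ?thesis
    using det_diagonal_4[of g] by (simp add: M_def g_def vector_4)
qed

lemma det_scale_rows:
  "det (vector [a *\<^sub>R x, b *\<^sub>R y, c *\<^sub>R z, d *\<^sub>R w] :: real ^ 4 ^ 4)
    = a * b * c * d * det (vector [x, y, z, w] :: real ^ 4 ^ 4)"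
proof -
  define g :: "real ^ 4" where "g = vector [a, b, c, d]"
  have "vector [a *\<^sub>R x, b *\<^sub>R y, c *\<^sub>R z, d *\<^sub>R w]
      = (\<chi> i j. if i = j then g $ i else 0) ** (vector [x, y, z, w] :: real ^ 4 ^ 4)"
    unfolding vec_eq_iff forall_4 matrix_matrix_mult_def by (simp add: sum_4 g_def vector_4)
  then show ?thesis using det_diagonal_4[of g] by (simp add: det_mul g_def vector_4)
qed

text \<open>The orientation of a frame as the sign of a number that depends continuously on it.\<close>
definition frame_det :: "real \<Rightarrow> real ^ 4 \<Rightarrow> real ^ 4 \<Rightarrow> real ^ 4 \<Rightarrow> real ^ 4 \<Rightarrow> real"
  where "frame_det eps x y b l = (if eps = 1 then det (vector [x, y, b, l] :: real ^ 4 ^ 4)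
      else det (vector [x, y, l, b] :: real ^ 4 ^ 4))"

lemma frame_oriented_iff_det: "frame_oriented eps x y b l \<longleftrightarrow> frame_det eps x y b l > 0"
  by (simp add: frame_oriented_def positively_oriented_def frame_det_def)

lemma frame_det_uminus: "frame_det eps x y b (- l) = - frame_det eps x y b l"
  using det_scale_rows[of 1 x 1 y 1 b "-1" l] det_scale_rows[of 1 x 1 y "-1" l 1 b]
  by (simp add: frame_det_def)

lemma frame_det_nonzero:
  assumes "eps * eps = 1" "orthonormal_frame eps x y b l"
  shows "frame_det eps x y b l \<noteq> 0"
  using det_orthogonal_frame[of x y b l] det_orthogonal_frame[of x y l b]
    orthonormal_frameD[OF assms(2)] assms(1)
  by (auto simp: frame_det_def)

lemma orthonormal_frame_uminus:
  "orthonormal_frame eps x y b l \<Longrightarrow> orthonormal_frame eps x y b (- l)"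
  by (simp add: orthonormal_frame_def ip_simps)

text \<open>The unit vectors orthogonal to \<open>x, y, b\<close> are \<open>l\<close> and \<open>-l\<close>, and the orientation selects one of
  them. This makes the definite description in \<^const>\<open>geo_l\<close> meaningful.\<close>
lemma unit_normal_unique:
  assumes eps: "eps * eps = 1" and on: "orthonormal_frame eps x y b l" "orthonormal_frame eps x y b l'"
    and or: "frame_oriented eps x y b l" "frame_oriented eps x y b l'"
  shows "l' = l"
proof -
  note o1 = orthonormal_frameD[OF on(1)] and o2 = orthonormal_frameD[OF on(2)]
  define c where "c = - eps * ip l l'"
  have l': "l' = c *\<^sub>R l"
    using orthonormal_expansion[OF eps on(1), of l'] o2 by (simp add: c_def)
  have "c * c * eps = eps" using o1(4) o2(4) unfolding l' by (simp add: ip_simps)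
  then have "c * c = 1" using eps by (metis mult_cancel_right1 mult_zero_left zero_neq_one)
  then have "c = 1 \<or> c = -1" by (simp add: square_eq_1_iff)
  moreover have "c \<noteq> -1"
    using or frame_det_uminus[of eps x y b l] by (auto simp: l' frame_oriented_iff_det)
  ultimately show ?thesis using l' by simp
qed

text \<open>Project a basis vector onto the orthogonal complement of \<open>x, y, b\<close>, choosing it so that the
  projection is not null, and normalize. The square of the result is \<open>-eps\<close> by
  \<open>det_orthogonal_frame\<close>, and its sign can be adapted to the orientation.\<close>
lemma unit_normal_exists:
  assumes eps: "eps * eps = 1"
    and o: "ip x x = 1" "ip y y = -1" "ip b b = eps" "ip x y = 0" "ip x b = 0" "ip y b = 0"
  obtains l where "orthonormal_frame eps x y b l" "frame_oriented eps x y b l"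
proof -
  have o': "ip y x = 0" "ip b x = 0" "ip b y = 0" using o by (simp_all add: ip_commute)
  define P where "P w = w - ip w x *\<^sub>R x + ip w y *\<^sub>R y - (eps * ip w b) *\<^sub>R b" for w
  have PP: "ip (P w) (P w) = ip w w - ip w x * ip w x + ip w y * ip w y - eps * (ip w b * ip w b)" for w
  proof -
    have "ip (P w) (P w) = ip w w - ip w x * ip w x + ip w y * ip w y - 2 * eps * (ip w b * ip w b)
       + (eps * eps) * eps * (ip w b * ip w b)"
      using o o' ip_commute[of x w] ip_commute[of y w] ip_commute[of b w]
      by (simp add: P_def ip_simps algebra_simps)
    then show ?thesis using eps by simp
  qed
  have orth: "ip (P w) x = 0" "ip (P w) y = 0" "ip (P w) b = 0" for w
  proof -
    show "ip (P w) x = 0" "ip (P w) y = 0" using o o' by (simp_all add: P_def ip_simps)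
    have "ip (P w) b = ip w b - (eps * eps) * ip w b" using o o' by (simp add: P_def ip_simps)
    then show "ip (P w) b = 0" using eps by simp
  qed
  \<comment> \<open>The trace of the projection is \<open>4 - 3\<close>, so it does not vanish on all basis vectors.\<close>
  let ?Q = "\<lambda>i. ip (P (axis i 1)) (P (axis i 1))"
  have "?Q 1 + ?Q 2 - ?Q 3 - ?Q 4 = 4 - ip x x + ip y y - eps * ip b b"
    unfolding PP by (simp add: ip_def axis_4_simps algebra_simps)
  then have "?Q 1 + ?Q 2 - ?Q 3 - ?Q 4 = 1" using o eps by simp
  then obtain i where i: "?Q i \<noteq> 0" by force
  define n where "n = (1 / sqrt \<bar>?Q i\<bar>) *\<^sub>R P (axis i 1)"
  define s where "s = ?Q i / \<bar>?Q i\<bar>"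
  have nn: "ip n n = s"
    using i by (simp add: n_def ip_simps s_def divide_simps)
  have n_orth: "ip n x = 0" "ip n y = 0" "ip n b = 0" by (simp_all add: n_def ip_simps orth)
  have "(det (vector [x, y, b, n] :: real ^ 4 ^ 4))\<^sup>2 = - (eps * s)"
    using det_orthogonal_frame[of x y b n] o n_orth nn by (simp add: ip_commute)
  then have "eps * s \<le> 0" by (metis neg_0_le_iff_le neg_le_0_iff_le zero_le_power2)
  moreover have "s = 1 \<or> s = -1" using i by (auto simp: s_def abs_if)
  moreover have "eps = 1 \<or> eps = -1" using eps by (simp add: square_eq_1_iff)
  ultimately have "s = - eps" by auto
  then have on: "orthonormal_frame eps x y b n"
    using o n_orth nn by (simp add: orthonormal_frame_def ip_commute)
  show thesis
  proof (cases "frame_det eps x y b n > 0")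
    case True
    then show ?thesis using that on by (simp add: frame_oriented_iff_det)
  next
    case False
    then have "frame_det eps x y b (- n) > 0"
      using frame_det_nonzero[OF eps on] by (simp add: frame_det_uminus)
    then show ?thesis
      using that orthonormal_frame_uminus[OF on] by (simp add: frame_oriented_iff_det)
  qed
qed

lemma continuous_on_frame_det:
  assumes "continuous_on S x" "continuous_on S y" "continuous_on S b" "continuous_on S l"
  shows "continuous_on S (\<lambda>p. frame_det eps (x p) (y p) (b p) (l p))"
proof -
  have det: "continuous_on S (\<lambda>p. det (vector [x p, y p, b p, l p] :: real ^ 4 ^ 4))"
    if "continuous_on S x" "continuous_on S y" "continuous_on S b" "continuous_on S l" for x y b l
  proof -
    have "\<forall>i. continuous_on S (\<lambda>p. (vector [x p, y p, b p, l p] :: real ^ 4 ^ 4) $ i $ j)" for j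
      unfolding forall_4 vector_4 using that by (auto intro!: continuous_intros)
    then show ?thesis
      unfolding det_def by (intro continuous_on_sum continuous_on_mult continuous_on_const continuous_on_prod) auto
  qed
  show ?thesis
    unfolding frame_det_def using det[OF assms] det[OF assms(1,2,4,3)] by (cases "eps = 1") auto
qed


section \<open>Surfaces with an adapted moving frame\<close>

text \<open>A surface with \<open>F = 0\<close>, described by its unit tangent fields and by \<open>e = sqrt E\<close>, \<open>g = sqrt (-G)\<close>.
  Existence starts from \<open>x, y\<close> and a solution \<open>z\<close>, uniqueness from \<open>z\<close>; both need the following
  translation of the notions of surface theory into derivatives of \<open>x\<close> and \<open>y\<close>.\<close>
locale parametrized_frame =
  fixes S :: "(real \<times> real) set" and z x y :: vfield and e g :: "real \<times> real \<Rightarrow> real"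
  assumes open_S: "open S" and smooth_z: "smooth_on S z"
    and smooth_eg: "smooth_on S e" "smooth_on S g"
    and eg_pos: "\<And>p. p \<in> S \<Longrightarrow> e p > 0" "\<And>p. p \<in> S \<Longrightarrow> g p > 0"
    and z_partials: "\<And>p. p \<in> S \<Longrightarrow> d_u z p = e p *\<^sub>R x p" "\<And>p. p \<in> S \<Longrightarrow> d_v z p = g p *\<^sub>R y p"
    and xy: "\<And>p. p \<in> S \<Longrightarrow> ip (x p) (x p) = 1" "\<And>p. p \<in> S \<Longrightarrow> ip (y p) (y p) = -1"
      "\<And>p. p \<in> S \<Longrightarrow> ip (x p) (y p) = 0"
begin

lemma yx: "p \<in> S \<Longrightarrow> ip (y p) (x p) = 0"
  using xy(3) by (simp add: ip_commute)

lemma smooth_xy: "smooth_on S x" "smooth_on S y"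
proof -
  have "smooth_on S (\<lambda>p. inverse (e p) *\<^sub>R d_u z p)" "smooth_on S (\<lambda>p. inverse (g p) *\<^sub>R d_v z p)"
    using open_S smooth_eg eg_pos smooth_z
    by (intro smooth_on_scaleR smooth_on_inverse smooth_on_d_u smooth_on_d_v; fastforce)+
  moreover have "inverse (e p) *\<^sub>R d_u z p = x p" "inverse (g p) *\<^sub>R d_v z p = y p" if "p \<in> S" for p
    using z_partials eg_pos[OF that] that by simp_all
  ultimately show "smooth_on S x" "smooth_on S y"
    using smooth_on_cong[OF open_S, of "\<lambda>p. inverse (e p) *\<^sub>R d_u z p" x]
      smooth_on_cong[OF open_S, of "\<lambda>p. inverse (g p) *\<^sub>R d_v z p" y] by simp_all
qed

lemma diff_xy: "p \<in> S \<Longrightarrow> x differentiable (at p)" "p \<in> S \<Longrightarrow> y differentiable (at p)"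
  using smooth_xy smooth_on_differentiable by blast+

lemma frechet_z: "p \<in> S \<Longrightarrow>
    frechet_derivative z (at p) w = (fst w * e p) *\<^sub>R x p + (snd w * g p) *\<^sub>R y p"
  using frechet_derivative_eq_partials[OF smooth_on_differentiable[OF smooth_z]] z_partials by simp

lemma EFG:
  assumes "p \<in> S"
  shows "E_coef z p = (e p)\<^sup>2" "F_coef z p = 0" "G_coef z p = - (g p)\<^sup>2" "W_coef z p = e p * g p"
proof -
  show EFG: "E_coef z p = (e p)\<^sup>2" "F_coef z p = 0" "G_coef z p = - (g p)\<^sup>2"
    using xy[OF assms] z_partials[OF assms]
    by (simp_all add: E_coef_def F_coef_def G_coef_def ip_simps power2_eq_square)
  show "W_coef z p = e p * g p"
    using eg_pos[OF assms] by (simp add: W_coef_def EFG real_sqrt_mult)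
qed

lemma frechet_z_inj: "p \<in> S \<Longrightarrow> frechet_derivative z (at p) w = frechet_derivative z (at p) w' \<Longrightarrow> w = w'"
proof -
  assume p: "p \<in> S" and eq: "frechet_derivative z (at p) w = frechet_derivative z (at p) w'"
  have "ip (frechet_derivative z (at p) w) (x p) = fst w * e p"
    "ip (frechet_derivative z (at p) w) (y p) = - (snd w * g p)" for w
    using xy[OF p] yx[OF p] by (simp_all add: frechet_z[OF p] ip_simps)
  from this[of w] this[of w'] show "w = w'"
    using eq eg_pos[OF p] by (simp add: prod_eq_iff)
qed

lemma lorentz_surface: "plane_domain S \<Longrightarrow> lorentz_surface S z"
  unfolding lorentz_surface_def
proof (intro conjI ballI)
  fix p assume p: "p \<in> S"
  show "inj (frechet_derivative z (at p))" using frechet_z_inj[OF p] by (rule injI)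
  show "E_coef z p * G_coef z p - (F_coef z p)\<^sup>2 < 0" "0 < E_coef z p" "G_coef z p < 0"
    using eg_pos[OF p] by (simp_all add: EFG[OF p])
qed (use smooth_z in auto)

lemma normal_space_iff: "p \<in> S \<Longrightarrow> n \<in> normal_space z p \<longleftrightarrow> ip n (x p) = 0 \<and> ip n (y p) = 0"
proof
  assume p: "p \<in> S"
  { assume "n \<in> normal_space z p"
    then have n: "ip n ((a * e p) *\<^sub>R x p + (c * g p) *\<^sub>R y p) = 0" for a c
      using frechet_z[OF p, of "(a, c)", symmetric] by (auto simp: normal_space_def tangent_space_def)
    show "ip n (x p) = 0 \<and> ip n (y p) = 0"
      using n[of 1 0] n[of 0 1] eg_pos[OF p] by (simp add: ip_simps) }
  { assume "ip n (x p) = 0 \<and> ip n (y p) = 0"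
    then show "n \<in> normal_space z p"
      by (auto simp: normal_space_def tangent_space_def frechet_z[OF p] ip_simps) }
qed

lemma normal_part_eq:
  assumes p: "p \<in> S"
  shows "normal_part z p w = w - ip w (x p) *\<^sub>R x p + ip w (y p) *\<^sub>R y p"
  unfolding normal_part_def
proof (rule the_equality)
  let ?n = "w - ip w (x p) *\<^sub>R x p + ip w (y p) *\<^sub>R y p"
  have "w - ?n = frechet_derivative z (at p) (ip w (x p) / e p, - ip w (y p) / g p)"
    using eg_pos[OF p] by (simp add: frechet_z[OF p])
  then have "w - ?n \<in> tangent_space z p" unfolding tangent_space_def by (rule range_eqI)
  moreover have "?n \<in> normal_space z p"
    using xy[OF p] yx[OF p] by (simp add: normal_space_iff[OF p] ip_simps)
  ultimately show "?n \<in> normal_space z p \<and> w - ?n \<in> tangent_space z p" by simp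
next
  fix n assume n: "n \<in> normal_space z p \<and> w - n \<in> tangent_space z p"
  then obtain h where h: "w - n = (fst h * e p) *\<^sub>R x p + (snd h * g p) *\<^sub>R y p"
    unfolding tangent_space_def using frechet_z[OF p] by auto
  then have w: "w = n + (fst h * e p) *\<^sub>R x p + (snd h * g p) *\<^sub>R y p" by (simp add: algebra_simps)
  have "ip w (x p) = fst h * e p" "ip w (y p) = - (snd h * g p)"
    using n xy[OF p] yx[OF p] by (simp_all add: w normal_space_iff[OF p] ip_simps)
  then show "n = w - ip w (x p) *\<^sub>R x p + ip w (y p) *\<^sub>R y p" using w by simp
qed

lemma nabla_x:
  assumes "p \<in> S" "X p = x p" "Y differentiable (at p)"
  shows "nabla z X Y p = (1 / e p) *\<^sub>R d_u Y p"
proof -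
  have "(THE w. frechet_derivative z (at p) w = X p) = (1 / e p, 0)"
    using assms(2) eg_pos(1)[OF assms(1)] frechet_z_inj[OF assms(1)]
    by (intro the_equality) (auto simp: frechet_z[OF assms(1)])
  then show ?thesis by (simp add: nabla_def frechet_derivative_eq_partials[OF assms(3)])
qed

lemma nabla_y:
  assumes "p \<in> S" "X p = y p" "Y differentiable (at p)"
  shows "nabla z X Y p = (1 / g p) *\<^sub>R d_v Y p"
proof -
  have "(THE w. frechet_derivative z (at p) w = X p) = (0, 1 / g p)"
    using assms(2) eg_pos(2)[OF assms(1)] frechet_z_inj[OF assms(1)]
    by (intro the_equality) (auto simp: frechet_z[OF assms(1)])
  then show ?thesis by (simp add: nabla_def frechet_derivative_eq_partials[OF assms(3)])
qed

lemma tangent_frame: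
  assumes "p \<in> S"
  shows "geo_x z p = x p" "geo_y z p = y p" "tan_x z p = x p" "tan_y z p = y p"
  using eg_pos[OF assms] z_partials[OF assms]
  by (simp_all add: geo_x_def geo_y_def tan_x_def tan_y_def EFG[OF assms])

lemma nabla_tangent:
  assumes p: "p \<in> S" and X: "\<And>q. q \<in> S \<Longrightarrow> X q = x q" and Y: "\<And>q. q \<in> S \<Longrightarrow> Y q = y q"
  shows "nabla z X X p = (1 / e p) *\<^sub>R d_u x p" "nabla z X Y p = (1 / e p) *\<^sub>R d_u y p"
    "nabla z Y X p = (1 / g p) *\<^sub>R d_v x p" "nabla z Y Y p = (1 / g p) *\<^sub>R d_v y p"
proof -
  have "X differentiable (at p)" "Y differentiable (at p)"
    using differentiable_cong_open[OF open_S p X] differentiable_cong_open[OF open_S p Y] diff_xy[OF p]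
    by simp_all
  then show "nabla z X X p = (1 / e p) *\<^sub>R d_u x p" "nabla z X Y p = (1 / e p) *\<^sub>R d_u y p"
    "nabla z Y X p = (1 / g p) *\<^sub>R d_v x p" "nabla z Y Y p = (1 / g p) *\<^sub>R d_v y p"
    using nabla_x[where X = X, OF p X[OF p]] nabla_y[where X = Y, OF p Y[OF p]]
      d_u_cong_open[OF open_S p X] d_u_cong_open[OF open_S p Y]
      d_v_cong_open[OF open_S p X] d_v_cong_open[OF open_S p Y] by simp_all
qed

lemma mean_curv_eq:
  assumes "p \<in> S"
  shows "mean_curv z p = (1 / 2) *\<^sub>R
    (normal_part z p ((1 / e p) *\<^sub>R d_u x p) - normal_part z p ((1 / g p) *\<^sub>R d_v y p))"
  using nabla_tangent[OF assms, of "tan_x z" "tan_y z"] tangent_frame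
  by (simp add: mean_curv_def second_ff_def)

text \<open>The tangential terms \<open>e_u x\<close>, \<open>e_v x\<close>, \<open>g_v y\<close> of the second derivatives do not contribute.\<close>
lemma second_derivatives_normal:
  assumes p: "p \<in> S" and n: "n \<in> normal_space z p"
  shows "c11 z p n = e p * ip (d_u x p) n" "c12 z p n = e p * ip (d_v x p) n"
    "c22 z p n = g p * ip (d_v y p) n"
proof -
  have n': "ip (x p) n = 0" "ip (y p) n = 0"
    using n by (simp_all add: normal_space_iff[OF p] ip_commute)
  have e: "e differentiable (at p)" "g differentiable (at p)"
    using smooth_eg p smooth_on_differentiable by blast+
  have "d_u (d_u z) p = d_u e p *\<^sub>R x p + e p *\<^sub>R d_u x p"
    "d_v (d_u z) p = d_v e p *\<^sub>R x p + e p *\<^sub>R d_v x p"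
    "d_v (d_v z) p = d_v g p *\<^sub>R y p + g p *\<^sub>R d_v y p"
    using d_u_cong_open[OF open_S p z_partials(1)] d_v_cong_open[OF open_S p z_partials(1)]
      d_v_cong_open[OF open_S p z_partials(2)] d_u_scaleR[OF e(1) diff_xy(1)[OF p]]
      d_v_scaleR[OF e(1) diff_xy(1)[OF p]] d_v_scaleR[OF e(2) diff_xy(2)[OF p]]
    by simp_all
  then show "c11 z p n = e p * ip (d_u x p) n" "c12 z p n = e p * ip (d_v x p) n"
    "c22 z p n = g p * ip (d_v y p) n"
    by (simp_all add: c11_def c12_def c22_def ip_simps n')
qed

end

text \<open>Here \<open>e\<close> and \<open>g\<close> are independent data: in the uniqueness proof they are first the roots of the
  coefficients of an unknown surface.\<close>
locale frame_coefficients =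
  fixes eps :: real and \<gamma>1 \<gamma>2 \<nu>1 \<nu>2 lam \<mu> \<beta>1 \<beta>2 e g :: "real \<times> real \<Rightarrow> real"
  assumes eps: "eps \<in> {1, -1}"
begin

lemma eps_sq: "eps * eps = 1"
  using eps by auto

text \<open>The derivation formulas \<open>\<nabla>_x x = -\<gamma>1 y + eps \<nu>1 b\<close> and so on, multiplied by \<open>e\<close> and \<open>g\<close>. The
  signs \<open>eps\<close> and \<open>-eps\<close> before \<open>b\<close> and \<open>l\<close> come from expanding in a frame with \<open>\<langle>b,b\<rangle> = eps\<close> and
  \<open>\<langle>l,l\<rangle> = -eps\<close>.\<close>
definition frame_equations :: "(real \<times> real) set \<Rightarrow> vfield \<Rightarrow> vfield \<Rightarrow> vfield \<Rightarrow> vfield \<Rightarrow> bool"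
  where "frame_equations S x y b l \<longleftrightarrow> (\<forall>p\<in>S.
    x differentiable (at p) \<and> y differentiable (at p) \<and> b differentiable (at p) \<and> l differentiable (at p) \<and>
    d_u x p = e p *\<^sub>R (- (\<gamma>1 p) *\<^sub>R y p + (eps * \<nu>1 p) *\<^sub>R b p) \<and>
    d_v x p = g p *\<^sub>R (- (\<gamma>2 p) *\<^sub>R y p + (eps * lam p) *\<^sub>R b p - (eps * \<mu> p) *\<^sub>R l p) \<and>
    d_u y p = e p *\<^sub>R (- (\<gamma>1 p) *\<^sub>R x p + (eps * lam p) *\<^sub>R b p - (eps * \<mu> p) *\<^sub>R l p) \<and>
    d_v y p = g p *\<^sub>R (- (\<gamma>2 p) *\<^sub>R x p + (eps * \<nu>2 p) *\<^sub>R b p) \<and>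
    d_u b p = e p *\<^sub>R (- (\<nu>1 p) *\<^sub>R x p + lam p *\<^sub>R y p - (eps * \<beta>1 p) *\<^sub>R l p) \<and>
    d_v b p = g p *\<^sub>R (- (lam p) *\<^sub>R x p + \<nu>2 p *\<^sub>R y p - (eps * \<beta>2 p) *\<^sub>R l p) \<and>
    d_u l p = e p *\<^sub>R (\<mu> p *\<^sub>R y p - (eps * \<beta>1 p) *\<^sub>R b p) \<and>
    d_v l p = g p *\<^sub>R (- (\<mu> p) *\<^sub>R x p - (eps * \<beta>2 p) *\<^sub>R b p))"

lemma frame_equationsD:
  assumes "frame_equations S x y b l" "p \<in> S"
  shows "x differentiable (at p)" "y differentiable (at p)" "b differentiable (at p)" "l differentiable (at p)"
    "d_u x p = e p *\<^sub>R (- (\<gamma>1 p) *\<^sub>R y p + (eps * \<nu>1 p) *\<^sub>R b p)"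
    "d_v x p = g p *\<^sub>R (- (\<gamma>2 p) *\<^sub>R y p + (eps * lam p) *\<^sub>R b p - (eps * \<mu> p) *\<^sub>R l p)"
    "d_u y p = e p *\<^sub>R (- (\<gamma>1 p) *\<^sub>R x p + (eps * lam p) *\<^sub>R b p - (eps * \<mu> p) *\<^sub>R l p)"
    "d_v y p = g p *\<^sub>R (- (\<gamma>2 p) *\<^sub>R x p + (eps * \<nu>2 p) *\<^sub>R b p)"
    "d_u b p = e p *\<^sub>R (- (\<nu>1 p) *\<^sub>R x p + lam p *\<^sub>R y p - (eps * \<beta>1 p) *\<^sub>R l p)"
    "d_v b p = g p *\<^sub>R (- (lam p) *\<^sub>R x p + \<nu>2 p *\<^sub>R y p - (eps * \<beta>2 p) *\<^sub>R l p)"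
    "d_u l p = e p *\<^sub>R (\<mu> p *\<^sub>R y p - (eps * \<beta>1 p) *\<^sub>R b p)"
    "d_v l p = g p *\<^sub>R (- (\<mu> p) *\<^sub>R x p - (eps * \<beta>2 p) *\<^sub>R b p)"
  using assms unfolding frame_equations_def by blast+

text \<open>The coefficient matrix is skew with respect to \<open>(1, -1, eps, -eps)\<close>, so the terms of the
  derivative of the tensor cancel in pairs.\<close>
lemma frame_pairing_constant:
  assumes S: "open S" "connected S" "p \<in> S" "q \<in> S"
    and eqs: "frame_equations S x y b l" "frame_equations S x' y' b' l'"
  shows "frame_pairing eps (x p, y p, b p, l p) (x' p, y' p, b' p, l' p) w w'
    = frame_pairing eps (x q, y q, b q, l q) (x' q, y' q, b' q, l' q) w w'"
proof (rule has_derivative_zero_unique_connected[OF S(1,2) _ S(3,4)])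
  fix p assume p: "p \<in> S"
  note E = frame_equationsD[OF eqs(1) p] and E' = frame_equationsD[OF eqs(2) p]
  have d: "((\<lambda>p. ip (f p) w * ip (f' p) w') has_derivative (\<lambda>h.
      fst h * (ip (d_u f p) w * ip (f' p) w' + ip (f p) w * ip (d_u f' p) w')
      + snd h * (ip (d_v f p) w * ip (f' p) w' + ip (f p) w * ip (d_v f' p) w'))) (at p)"
    if "f differentiable (at p)" "f' differentiable (at p)" for f f' :: vfield
    by (rule has_derivative_eq_rhs[OF has_derivative_mult[OF
        bounded_linear.has_derivative[OF ip.bounded_linear_left has_derivative_partials[OF that(1)]]
        bounded_linear.has_derivative[OF ip.bounded_linear_left has_derivative_partials[OF that(2)]]]])
      (simp add: fun_eq_iff ip_simps algebra_simps)
  have "((\<lambda>p. ip (x p) w * ip (x' p) w' - ip (y p) w * ip (y' p) w'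
      + eps * (ip (b p) w * ip (b' p) w') - eps * (ip (l p) w * ip (l' p) w')) has_derivative (\<lambda>h. 0)) (at p)"
    by (rule has_derivative_eq_rhs[OF has_derivative_diff[OF has_derivative_add[OF has_derivative_diff[OF
        d[OF E(1) E'(1)] d[OF E(2) E'(2)]] has_derivative_mult_right[OF d[OF E(3) E'(3)]]]
        has_derivative_mult_right[OF d[OF E(4) E'(4)]]]])
      (simp add: fun_eq_iff E(5-) E'(5-) ip_simps algebra_simps)
  then show "((\<lambda>p. frame_pairing eps (x p, y p, b p, l p) (x' p, y' p, b' p, l' p) w w')
      has_derivative (\<lambda>h. 0)) (at p)"
    by (simp add: frame_pairing_def)
qed

text \<open>The case of one frame paired with itself.\<close>
lemma orthonormal_frame_propagates:
  assumes S: "open S" "connected S" "p \<in> S" "q \<in> S"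
    and eqs: "frame_equations S x y b l"
    and on: "orthonormal_frame eps (x q) (y q) (b q) (l q)"
  shows "orthonormal_frame eps (x p) (y p) (b p) (l p)"
  using frame_pairing_constant[OF S eqs eqs] on
  by (simp add: orthonormal_frame_iff_pairing[OF eps_sq])

text \<open>The determinant of the frame is continuous and, by orthonormality, has no zero.\<close>
lemma frame_oriented_propagates:
  assumes S: "open S" "connected S" "p \<in> S" "q \<in> S"
    and eqs: "frame_equations S x y b l"
    and on: "orthonormal_frame eps (x q) (y q) (b q) (l q)"
    and or: "frame_oriented eps (x q) (y q) (b q) (l q)"
  shows "frame_oriented eps (x p) (y p) (b p) (l p)"
proof -
  let ?d = "\<lambda>p. frame_det eps (x p) (y p) (b p) (l p)"
  have c: "continuous_on S f" if "\<And>p. p \<in> S \<Longrightarrow> f differentiable (at p)" for f :: vfield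
    using that by (simp add: continuous_at_imp_continuous_on differentiable_imp_continuous_within)
  have "continuous_on S ?d"
    by (intro continuous_on_frame_det c) (use frame_equationsD(1-4)[OF eqs] in auto)
  then have "connected (?d ` S)" using S(2) by (rule connected_continuous_image)
  moreover have "?d r \<noteq> 0" if "r \<in> S" for r
    using frame_det_nonzero[OF eps_sq orthonormal_frame_propagates[OF S(1,2) that S(4) eqs on]] .
  moreover have "?d q > 0" using or by (simp add: frame_oriented_iff_det)
  ultimately show ?thesis
    using S(3,4) connectedD_interval[of "?d ` S" "?d p" "?d q" 0]
    unfolding frame_oriented_iff_det by (force simp: not_less)
qed

text \<open>Pairing the two frames gives the metric at \<open>q\<close>, hence everywhere. In the resulting expansions of
  \<open>x p\<close> and \<open>y p\<close> only one term is left.\<close>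
lemma frame_equations_unique:
  assumes S: "open S" "connected S" "p \<in> S" "q \<in> S"
    and eqs: "frame_equations S x y b l" "frame_equations S x' y' b' l'"
    and on: "orthonormal_frame eps (x q) (y q) (b q) (l q)"
    and init: "x' q = x q" "y' q = y q" "b' q = b q" "l' q = l q"
  shows "x' p = x p" "y' p = y p"
proof -
  have fp: "frame_pairing eps (x p, y p, b p, l p) (x' p, y' p, b' p, l' p) w w' = ip w w'" for w w'
    using frame_pairing_constant[OF S eqs] on init by (simp add: orthonormal_frame_iff_pairing[OF eps_sq])
  note o = orthonormal_frameD[OF orthonormal_frame_propagates[OF S eqs(1) on]]
  show "x' p = x p" using frame_pairing_expansion[OF fp, of "x p"] o by (simp add: ip_commute)
  show "y' p = y p" using frame_pairing_expansion[OF fp, of "y p"] o by (simp add: ip_commute)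
qed

end

text \<open>A surface together with a solution of the frame equations that is an oriented orthonormal frame.
  The aim is that this frame is the geometric frame of the surface.\<close>
locale moving_frame = parametrized_frame S z x y e g + frame_coefficients eps \<gamma>1 \<gamma>2 \<nu>1 \<nu>2 lam \<mu> \<beta>1 \<beta>2 e g
  for S z x y e g eps \<gamma>1 \<gamma>2 \<nu>1 \<nu>2 lam \<mu> \<beta>1 \<beta>2 +
  fixes b l :: vfield
  assumes eqs: "frame_equations S x y b l"
    and on: "\<And>p. p \<in> S \<Longrightarrow> orthonormal_frame eps (x p) (y p) (b p) (l p)"
    and oriented: "\<And>p. p \<in> S \<Longrightarrow> frame_oriented eps (x p) (y p) (b p) (l p)"
    and \<mu>_nonzero: "\<And>p. p \<in> S \<Longrightarrow> \<mu> p \<noteq> 0"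
    and \<nu>_less: "\<And>p. p \<in> S \<Longrightarrow> \<nu>1 p - \<nu>2 p > 0"
begin

lemma sigma:
  assumes p: "p \<in> S"
  shows "normal_part z p ((1 / e p) *\<^sub>R d_u x p) = (eps * \<nu>1 p) *\<^sub>R b p"
    "normal_part z p ((1 / g p) *\<^sub>R d_v y p) = (eps * \<nu>2 p) *\<^sub>R b p"
    "normal_part z p ((1 / e p) *\<^sub>R d_u y p) = (eps * lam p) *\<^sub>R b p - (eps * \<mu> p) *\<^sub>R l p"
  using orthonormal_frameD[OF on[OF p]] frame_equationsD[OF eqs p] eg_pos[OF p]
  by (simp_all add: normal_part_eq[OF p] ip_simps)

lemma mean_curv_b:
  assumes p: "p \<in> S"
  shows "mean_curv z p = (eps * (\<nu>1 p - \<nu>2 p) / 2) *\<^sub>R b p"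
  by (simp add: mean_curv_eq[OF p] sigma[OF p] algebra_simps diff_divide_distrib)

lemma mean_curv_square:
  assumes p: "p \<in> S"
  shows "ip (mean_curv z p) (mean_curv z p) = eps * ((\<nu>1 p - \<nu>2 p) / 2)\<^sup>2"
proof -
  have "ip (mean_curv z p) (mean_curv z p) = (eps * eps) * eps * ((\<nu>1 p - \<nu>2 p) / 2)\<^sup>2"
    using orthonormal_frameD(3)[OF on[OF p]]
    by (simp add: mean_curv_b[OF p] ip_simps power2_eq_square)
  then show ?thesis by (simp add: eps_sq)
qed

lemma eps_of_eq: "p \<in> S \<Longrightarrow> eps_of z p = eps"
  using eps \<nu>_less[of p] by (auto simp: eps_of_def mean_curv_square sgn_mult)

lemma geo_b_eq:
  assumes p: "p \<in> S"
  shows "geo_b z p = b p"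
proof -
  have "eps_of z p * ip (mean_curv z p) (mean_curv z p) = (eps * eps) * ((\<nu>1 p - \<nu>2 p) / 2)\<^sup>2"
    by (simp add: eps_of_eq[OF p] mean_curv_square[OF p])
  then have sq: "sqrt (eps_of z p * ip (mean_curv z p) (mean_curv z p)) = (\<nu>1 p - \<nu>2 p) / 2"
    using \<nu>_less[OF p] by (simp add: eps_sq)
  have "eps / ((\<nu>1 p - \<nu>2 p) / 2) * (eps * (\<nu>1 p - \<nu>2 p) / 2) = 1"
    using \<nu>_less[OF p] eps by auto
  then show ?thesis
    unfolding geo_b_def sq by (simp only: eps_of_eq[OF p] mean_curv_b[OF p] scaleR_scaleR scaleR_one)
qed

lemma geo_l_eq:
  assumes p: "p \<in> S"
  shows "geo_l z p = l p"
proof -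
  note o = orthonormal_frameD[OF on[OF p]]
  have "(THE l. l \<in> normal_space z p \<and> ip l l = - eps \<and> ip (b p) l = 0 \<and>
      frame_oriented eps (x p) (y p) (b p) l) = l p"
  proof (rule the_equality)
    fix l' assume l': "l' \<in> normal_space z p \<and> ip l' l' = - eps \<and> ip (b p) l' = 0 \<and>
      frame_oriented eps (x p) (y p) (b p) l'"
    then have "orthonormal_frame eps (x p) (y p) (b p) l'"
      using o by (simp add: orthonormal_frame_def normal_space_iff[OF p] ip_commute)
    with l' show "l' = l p"
      using unit_normal_unique[OF eps_sq on[OF p] _ oriented[OF p]] by blast
  qed (use o oriented[OF p] in \<open>auto simp: normal_space_iff[OF p]\<close>)
  then show ?thesis by (simp add: geo_l_def eps_of_eq[OF p] geo_b_eq[OF p] tangent_frame[OF p])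
qed

text \<open>The number \<open>d\<close> is the determinant of the change between the normal frames \<open>(n1, n2)\<close> and
  \<open>(b, l)\<close> up to sign; its square is one because both are orthonormal.\<close>
lemma second_order_coefficients:
  assumes p: "p \<in> S" and n: "normal_frame z p n1 n2"
  obtains d where "d\<^sup>2 = 1" "L_coef z p n1 n2 = 2 * (e p)\<^sup>2 * (\<nu>1 p * \<mu> p * d)"
    "M_coef z p n1 n2 = 0" "N_coef z p n1 n2 = - (2 * (g p)\<^sup>2 * (\<nu>2 p * \<mu> p * d))"
proof -
  note o = orthonormal_frameD[OF on[OF p]] and E = frame_equationsD[OF eqs p]
  have nn: "n1 \<in> normal_space z p" "n2 \<in> normal_space z p" "ip n1 n1 = 1" "ip n2 n2 = -1" "ip n1 n2 = 0"
    using n by (auto simp: normal_frame_def)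
  have n_xy: "ip (x p) n1 = 0" "ip (y p) n1 = 0" "ip (x p) n2 = 0" "ip (y p) n2 = 0"
    using nn(1,2) by (auto simp: normal_space_iff[OF p] ip_commute)
  define b1 b2 l1 l2 where "b1 = ip (b p) n1" and "b2 = ip (b p) n2"
    and "l1 = ip (l p) n1" and "l2 = ip (l p) n2"
  have gram: "ip w w' = ip (x p) w * ip (x p) w' - ip (y p) w * ip (y p) w' + eps * (ip (b p) w * ip (b p) w')
      - eps * (ip (l p) w * ip (l p) w')" for w w'
    using on[OF p] by (simp add: orthonormal_frame_iff_pairing[OF eps_sq] frame_pairing_def)
  have "eps * (b1 * b1) - eps * (l1 * l1) = 1" "eps * (b2 * b2) - eps * (l2 * l2) = -1"
    "eps * (b1 * b2) - eps * (l1 * l2) = 0"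
    using gram[of n1 n1] gram[of n2 n2] gram[of n1 n2] nn n_xy
    by (simp_all add: b1_def b2_def l1_def l2_def)
  then have "b1 * b1 - l1 * l1 = eps" "b2 * b2 - l2 * l2 = - eps" "b1 * b2 - l1 * l2 = 0"
    using eps by auto
  moreover have "(b1 * l2 - b2 * l1)\<^sup>2 = (b1 * b2 - l1 * l2)\<^sup>2 - (b1 * b1 - l1 * l1) * (b2 * b2 - l2 * l2)"
    by (simp add: power2_eq_square algebra_simps)
  ultimately have sq: "(b1 * l2 - b2 * l1)\<^sup>2 = 1" by (simp add: eps_sq)
  have c: "c11 z p n1 = (e p)\<^sup>2 * (eps * \<nu>1 p * b1)" "c11 z p n2 = (e p)\<^sup>2 * (eps * \<nu>1 p * b2)"
    "c12 z p n1 = e p * g p * (eps * lam p * b1 - eps * \<mu> p * l1)"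
    "c12 z p n2 = e p * g p * (eps * lam p * b2 - eps * \<mu> p * l2)"
    "c22 z p n1 = (g p)\<^sup>2 * (eps * \<nu>2 p * b1)" "c22 z p n2 = (g p)\<^sup>2 * (eps * \<nu>2 p * b2)"
    using second_derivatives_normal[OF p nn(1)] second_derivatives_normal[OF p nn(2)] n_xy
    by (simp_all add: E ip_simps b1_def b2_def l1_def l2_def power2_eq_square)
  define d where "d = b2 * l1 - b1 * l2"
  have d2: "d\<^sup>2 = 1" using sq by (simp add: d_def power2_eq_square algebra_simps)
  have eg: "e p \<noteq> 0" "g p \<noteq> 0" using eg_pos[OF p] by auto
  have "c11 z p n1 * c12 z p n2 - c12 z p n1 * c11 z p n2
      = (eps * eps) * (e p * g p * (e p)\<^sup>2 * (\<nu>1 p * \<mu> p * d))"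
    by (simp add: c d_def algebra_simps power2_eq_square)
  then have L: "L_coef z p n1 n2 = 2 * (e p)\<^sup>2 * (\<nu>1 p * \<mu> p * d)"
    using eg by (simp add: L_coef_def EFG[OF p] eps_sq)
  have "c12 z p n1 * c22 z p n2 - c22 z p n1 * c12 z p n2
      = (eps * eps) * (- (e p * g p * (g p)\<^sup>2 * (\<nu>2 p * \<mu> p * d)))"
    by (simp add: c d_def algebra_simps power2_eq_square)
  then have N: "N_coef z p n1 n2 = - (2 * (g p)\<^sup>2 * (\<nu>2 p * \<mu> p * d))"
    using eg by (simp add: N_coef_def EFG[OF p] eps_sq)
  have M: "M_coef z p n1 n2 = 0" by (simp add: M_coef_def c)
  show thesis using that d2 L M N by blast
qed

lemma principal: "principal S z"
  unfolding principal_def using EFG(2) by (metis second_order_coefficients)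

text \<open>With \<open>\<kappa> = (\<nu>1 + \<nu>2) \<mu> d\<close> and \<open>k = 4 \<nu>1 \<nu>2 \<mu>\<^sup>2\<close> the discriminant is \<open>((\<nu>1 - \<nu>2) \<mu>)\<^sup>2\<close>.\<close>
lemma admissible: "admissible S z"
  unfolding admissible_def
proof (intro ballI allI impI)
  fix p n1 n2 assume p: "p \<in> S" and n: "normal_frame z p n1 n2"
  obtain d where d: "d\<^sup>2 = 1" "L_coef z p n1 n2 = 2 * (e p)\<^sup>2 * (\<nu>1 p * \<mu> p * d)"
    "M_coef z p n1 n2 = 0" "N_coef z p n1 n2 = - (2 * (g p)\<^sup>2 * (\<nu>2 p * \<mu> p * d))"
    using second_order_coefficients[OF p n] by metis
  have nz: "e p \<noteq> 0" "g p \<noteq> 0" "\<mu> p \<noteq> 0" "d \<noteq> 0" "\<nu>1 p \<noteq> 0 \<or> \<nu>2 p \<noteq> 0"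
    using eg_pos[OF p] \<mu>_nonzero[OF p] d(1) \<nu>_less[OF p] by auto
  have "kappa_inv z p n1 n2 = (\<nu>1 p + \<nu>2 p) * \<mu> p * d"
    using nz by (simp add: kappa_inv_def EFG[OF p] d field_simps)
  moreover have "k_inv z p n1 n2 = 4 * \<nu>1 p * \<nu>2 p * (\<mu> p)\<^sup>2 * d\<^sup>2"
    using nz by (simp add: k_inv_def EFG[OF p] d(2-) field_simps power2_eq_square)
  ultimately have "(kappa_inv z p n1 n2)\<^sup>2 - k_inv z p n1 n2 = ((\<nu>1 p - \<nu>2 p) * \<mu> p * d)\<^sup>2"
    by (simp add: power2_eq_square algebra_simps)
  moreover have "\<dots> > 0" using nz \<nu>_less[OF p] by simp
  ultimately show "(L_coef z p n1 n2, M_coef z p n1 n2, N_coef z p n1 n2) \<noteq> (0, 0, 0) \<and>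
      (kappa_inv z p n1 n2)\<^sup>2 - k_inv z p n1 n2 > 0"
    using nz by (auto simp: d(2-))
qed

lemma geometric_functions: "geometric_functions S z \<gamma>1 \<gamma>2 \<nu>1 \<nu>2 lam \<mu> \<beta>1 \<beta>2"
  unfolding geometric_functions_def
proof (intro conjI ballI principal)
  fix p assume p: "p \<in> S"
  note o = orthonormal_frameD[OF on[OF p]] and E = frame_equationsD[OF eqs p]
  note nt = nabla_tangent[OF p tangent_frame(1,2)]
  note tf = tangent_frame[OF p] geo_b_eq[OF p] geo_l_eq[OF p]
  have eg: "e p \<noteq> 0" "g p \<noteq> 0" using eg_pos[OF p] by auto
  have e1: "eps * (eps * c) = c" for c using eps by auto
  have "geo_b z differentiable (at p)"
    using differentiable_cong_open[OF open_S p geo_b_eq] E(3) by simp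
  then have nb: "nabla z (geo_x z) (geo_b z) p = (1 / e p) *\<^sub>R d_u b p"
    "nabla z (geo_y z) (geo_b z) p = (1 / g p) *\<^sub>R d_v b p"
    using nabla_x[where X = "geo_x z", OF p tf(1)] nabla_y[where X = "geo_y z", OF p tf(2)] d_u_cong_open[OF open_S p geo_b_eq]
      d_v_cong_open[OF open_S p geo_b_eq] by simp_all
  show "\<gamma>1 p = ip (nabla z (geo_x z) (geo_x z) p) (geo_y z p)"
    using eg o by (simp add: nt tf E ip_simps)
  show "\<gamma>2 p = ip (nabla z (geo_y z) (geo_x z) p) (geo_y z p)"
    using eg o by (simp add: nt tf E ip_simps)
  show "\<nu>1 p = ip (second_ff z (geo_x z) (geo_x z) p) (geo_b z p)"
    "\<nu>2 p = ip (second_ff z (geo_y z) (geo_y z) p) (geo_b z p)"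
    "lam p = ip (second_ff z (geo_x z) (geo_y z) p) (geo_b z p)"
    "\<mu> p = ip (second_ff z (geo_x z) (geo_y z) p) (geo_l z p)"
    using o eps by (auto simp: second_ff_def nt tf sigma[OF p] ip_simps)
  show "\<beta>1 p = ip (nabla z (geo_x z) (geo_b z) p) (geo_l z p)"
    "\<beta>2 p = ip (nabla z (geo_y z) (geo_b z) p) (geo_l z p)"
    using eg o eps by (auto simp: nb tf E ip_simps)
qed

end


section \<open>Existence\<close>

type_synonym frame_state = "(real ^ 4) \<times> (real ^ 4) \<times> (real ^ 4) \<times> (real ^ 4) \<times> (real ^ 4)"

abbreviation st_x :: "frame_state \<Rightarrow> real ^ 4" where "st_x X \<equiv> fst (snd X)"
abbreviation st_y :: "frame_state \<Rightarrow> real ^ 4" where "st_y X \<equiv> fst (snd (snd X))"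
abbreviation st_b :: "frame_state \<Rightarrow> real ^ 4" where "st_b X \<equiv> fst (snd (snd (snd X)))"
abbreviation st_l :: "frame_state \<Rightarrow> real ^ 4" where "st_l X \<equiv> snd (snd (snd (snd X)))"

lemma has_derivative_scaleR_const:
  fixes c :: "real \<times> real \<Rightarrow> real"
  assumes "c differentiable (at p)"
  shows "((\<lambda>p. c p *\<^sub>R T) has_derivative (\<lambda>h. fst h *\<^sub>R (d_u c p *\<^sub>R T) + snd h *\<^sub>R (d_v c p *\<^sub>R T))) (at p)"
  by (rule has_derivative_eq_rhs[OF bounded_linear.has_derivative[OF bounded_linear_scaleR_left
        has_derivative_partials[OF assms]]]) (simp add: fun_eq_iff scaleR_add_left)

text \<open>The operators of the Pfaffian system are combinations of six constant ones. In list form their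
  smoothness and their derivatives follow by induction on the number of terms.\<close>
definition combine :: "(real \<times> real \<Rightarrow> real) list \<Rightarrow> 'a::real_normed_vector list \<Rightarrow> real \<times> real \<Rightarrow> 'a"
  where "combine cs Ts p = (\<Sum>(c, T)\<leftarrow>zip cs Ts. c p *\<^sub>R T)"

lemma combine_simps:
  "combine [] Ts p = 0" "combine cs [] p = 0"
  "combine (c # cs) (T # Ts) p = c p *\<^sub>R T + combine cs Ts p"
  by (simp_all add: combine_def)

lemma smooth_on_combine:
  assumes "open S" "\<And>c. c \<in> set cs \<Longrightarrow> smooth_on S c"
  shows "smooth_on S (combine cs Ts)"
  using assms(2)
proof (induction cs arbitrary: Ts)
  case Nil
  have "combine [] Ts = (\<lambda>p. 0)" by (simp add: fun_eq_iff combine_simps)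
  then show ?case by (simp add: smooth_on_const)
next
  case (Cons c cs)
  show ?case
  proof (cases Ts)
    case Nil
    have "combine (c # cs) Ts = (\<lambda>p. 0)" by (simp add: fun_eq_iff combine_simps Nil)
    then show ?thesis by (simp add: smooth_on_const)
  next
    case (Cons T Ts')
    have "combine (c # cs) (T # Ts') = (\<lambda>p. c p *\<^sub>R T + combine cs Ts' p)"
      by (simp add: fun_eq_iff combine_simps)
    then show ?thesis using Cons.IH Cons.prems Cons assms(1)
      by (auto intro!: smooth_on_add smooth_on_scaleR smooth_on_const)
  qed
qed

lemma has_derivative_combine:
  assumes "\<And>c. c \<in> set cs \<Longrightarrow> c differentiable (at p)"
  shows "(combine cs Ts has_derivative (\<lambda>h. fst h *\<^sub>R combine (map d_u cs) Ts p
    + snd h *\<^sub>R combine (map d_v cs) Ts p)) (at p)"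
  using assms
proof (induction cs arbitrary: Ts)
  case Nil
  have "combine [] Ts = (\<lambda>p. 0)" by (simp add: fun_eq_iff combine_simps)
  then show ?case by (simp add: combine_simps)
next
  case (Cons c cs)
  show ?case
  proof (cases Ts)
    case Nil
    have "combine (c # cs) Ts = (\<lambda>p. 0)" by (simp add: fun_eq_iff combine_simps Nil)
    then show ?thesis by (simp add: combine_simps Nil)
  next
    case (Cons T Ts')
    have "combine (c # cs) (T # Ts') = (\<lambda>p. c p *\<^sub>R T + combine cs Ts' p)"
      by (simp add: fun_eq_iff combine_simps)
    moreover have "((\<lambda>p. c p *\<^sub>R T + combine cs Ts' p) has_derivative
        (\<lambda>h. (fst h *\<^sub>R (d_u c p *\<^sub>R T) + snd h *\<^sub>R (d_v c p *\<^sub>R T))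
          + (fst h *\<^sub>R combine (map d_u cs) Ts' p + snd h *\<^sub>R combine (map d_v cs) Ts' p))) (at p)"
      using Cons.IH Cons.prems by (intro has_derivative_add has_derivative_scaleR_const) auto
    ultimately show ?thesis
      using Cons by (simp add: combine_simps algebra_simps)
  qed
qed

text \<open>The hypotheses of the theorem on the given functions.\<close>
locale surface_data = frame_coefficients eps \<gamma>1 \<gamma>2 \<nu>1 \<nu>2 lam \<mu> \<beta>1 \<beta>2 e g
  for eps and \<gamma>1 \<gamma>2 \<nu>1 \<nu>2 lam \<mu> \<beta>1 \<beta>2 e g +
  fixes D :: "(real \<times> real) set"
  assumes D: "plane_domain D"
    and smooth: "smooth_on D \<gamma>1" "smooth_on D \<gamma>2" "smooth_on D \<nu>1" "smooth_on D \<nu>2"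
      "smooth_on D lam" "smooth_on D \<mu>" "smooth_on D \<beta>1" "smooth_on D \<beta>2"
    and \<mu>_nonzero: "\<And>p. p \<in> D \<Longrightarrow> \<mu> p \<noteq> 0"
    and \<nu>_less: "\<And>p. p \<in> D \<Longrightarrow> \<nu>1 p - \<nu>2 p > 0"
    and e_def: "e = (\<lambda>p. d_u \<mu> p / (2 * \<mu> p * \<gamma>2 p - eps * lam p * \<beta>1 p + eps * \<nu>1 p * \<beta>2 p))"
    and g_def: "g = (\<lambda>p. d_v \<mu> p / (2 * \<mu> p * \<gamma>1 p + eps * \<nu>2 p * \<beta>1 p - eps * lam p * \<beta>2 p))"
    and e_pos: "\<And>p. p \<in> D \<Longrightarrow> e p > 0"
    and g_pos: "\<And>p. p \<in> D \<Longrightarrow> g p > 0"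
    and e_v: "\<And>p. p \<in> D \<Longrightarrow> - \<gamma>1 p * e p * g p = d_v e p"
    and g_u: "\<And>p. p \<in> D \<Longrightarrow> - \<gamma>2 p * e p * g p = d_u g p"
    and codazzi1: "\<And>p. p \<in> D \<Longrightarrow>
      2 * lam p * \<gamma>2 p - eps * \<mu> p * \<beta>1 p - (\<nu>1 p + \<nu>2 p) * \<gamma>1 p
        = 1 / e p * d_u lam p - 1 / g p * d_v \<nu>1 p"
    and codazzi2: "\<And>p. p \<in> D \<Longrightarrow>
      2 * lam p * \<gamma>1 p - eps * \<mu> p * \<beta>2 p - (\<nu>1 p + \<nu>2 p) * \<gamma>2 p
        = - (1 / e p) * d_u \<nu>2 p + 1 / g p * d_v lam p"
    and ricci: "\<And>p. p \<in> D \<Longrightarrow>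
      \<gamma>1 p * \<beta>1 p - \<gamma>2 p * \<beta>2 p + (\<nu>1 p + \<nu>2 p) * \<mu> p
        = - (1 / e p) * d_u \<beta>2 p + 1 / g p * d_v \<beta>1 p"
    and gauss: "\<And>p. p \<in> D \<Longrightarrow>
      eps * ((lam p)\<^sup>2 - (\<mu> p)\<^sup>2 - \<nu>1 p * \<nu>2 p)
        = 1 / e p * d_u \<gamma>2 p - 1 / g p * d_v \<gamma>1 p + (\<gamma>1 p)\<^sup>2 - (\<gamma>2 p)\<^sup>2"
begin

lemma open_D: "open D"
  using D by (simp add: plane_domain_def)

lemma denominators:
  assumes "p \<in> D"
  shows "2 * \<mu> p * \<gamma>2 p - eps * lam p * \<beta>1 p + eps * \<nu>1 p * \<beta>2 p \<noteq> 0"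
    "2 * \<mu> p * \<gamma>1 p + eps * \<nu>2 p * \<beta>1 p - eps * lam p * \<beta>2 p \<noteq> 0"
proof -
  \<comment> \<open>Division by zero gives zero, so positive quotients have nonzero denominators.\<close>
  show "2 * \<mu> p * \<gamma>2 p - eps * lam p * \<beta>1 p + eps * \<nu>1 p * \<beta>2 p \<noteq> 0"
    using e_pos[OF assms] unfolding e_def by (metis div_by_0 less_irrefl)
  show "2 * \<mu> p * \<gamma>1 p + eps * \<nu>2 p * \<beta>1 p - eps * lam p * \<beta>2 p \<noteq> 0"
    using g_pos[OF assms] unfolding g_def by (metis div_by_0 less_irrefl)
qed

lemma smooth_eg: "smooth_on D e" "smooth_on D g"
  unfolding e_def g_def using denominators
  by (auto intro!: smooth_on_divide smooth_on_add smooth_on_diff smooth_on_mult smooth_on_const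
      smooth_on_d_u smooth_on_d_v smooth open_D)

lemma codazzi_\<mu>:
  assumes "p \<in> D"
  shows "d_u \<mu> p = e p * (2 * \<mu> p * \<gamma>2 p - eps * lam p * \<beta>1 p + eps * \<nu>1 p * \<beta>2 p)"
    "d_v \<mu> p = g p * (2 * \<mu> p * \<gamma>1 p + eps * \<nu>2 p * \<beta>1 p - eps * lam p * \<beta>2 p)"
  using denominators[OF assms] by (simp_all add: e_def g_def)

text \<open>The hypotheses in the form in which they occur as integrability conditions: they relate the
  derivatives of the products by \<open>e\<close> and \<open>g\<close> that are the coefficients of the system.\<close>
lemma coefficient_derivatives:
  assumes p: "p \<in> D"
  shows "d_v e p = - (e p * \<gamma>1 p * g p)" "d_u g p = - (g p * \<gamma>2 p * e p)"
    "d_u (\<lambda>p. g p * \<gamma>2 p) p = d_v (\<lambda>p. e p * \<gamma>1 p) p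
      + e p * g p * (eps * (lam p * lam p - \<mu> p * \<mu> p - \<nu>1 p * \<nu>2 p))"
    "d_u (\<lambda>p. g p * lam p) p = d_v (\<lambda>p. e p * \<nu>1 p) p
      + e p * g p * (lam p * \<gamma>2 p - eps * \<mu> p * \<beta>1 p - \<nu>2 p * \<gamma>1 p)"
    "d_v (\<lambda>p. e p * lam p) p = d_u (\<lambda>p. g p * \<nu>2 p) p
      + e p * g p * (lam p * \<gamma>1 p - eps * \<mu> p * \<beta>2 p - \<nu>1 p * \<gamma>2 p)"
    "d_u (\<lambda>p. g p * \<mu> p) p = e p * g p * (\<mu> p * \<gamma>2 p - eps * lam p * \<beta>1 p + eps * \<nu>1 p * \<beta>2 p)"
    "d_v (\<lambda>p. e p * \<mu> p) p = e p * g p * (\<mu> p * \<gamma>1 p + eps * \<nu>2 p * \<beta>1 p - eps * lam p * \<beta>2 p)"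
    "d_v (\<lambda>p. e p * \<beta>1 p) p = d_u (\<lambda>p. g p * \<beta>2 p) p + e p * g p * ((\<nu>1 p + \<nu>2 p) * \<mu> p)"
proof -
  have diff: "c differentiable (at p)" if "smooth_on D c" for c :: "real \<times> real \<Rightarrow> real"
    using that p by (rule smooth_on_differentiable)
  note du = d_u_mult[OF diff[OF smooth_eg(2)] diff] and dv = d_v_mult[OF diff[OF smooth_eg(1)] diff]
  show ev: "d_v e p = - (e p * \<gamma>1 p * g p)" and gu: "d_u g p = - (g p * \<gamma>2 p * e p)"
    using e_v[OF p] g_u[OF p] by (simp_all add: algebra_simps)
  have eg: "e p \<noteq> 0" "g p \<noteq> 0" using e_pos[OF p] g_pos[OF p] by auto
  show "d_u (\<lambda>p. g p * \<gamma>2 p) p = d_v (\<lambda>p. e p * \<gamma>1 p) p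
      + e p * g p * (eps * (lam p * lam p - \<mu> p * \<mu> p - \<nu>1 p * \<nu>2 p))"
    unfolding du[OF smooth(2)] dv[OF smooth(1)] ev gu
    using gauss[OF p] eg by (simp add: field_simps power2_eq_square)
  show "d_u (\<lambda>p. g p * lam p) p = d_v (\<lambda>p. e p * \<nu>1 p) p
      + e p * g p * (lam p * \<gamma>2 p - eps * \<mu> p * \<beta>1 p - \<nu>2 p * \<gamma>1 p)"
    unfolding du[OF smooth(5)] dv[OF smooth(3)] ev gu
    using codazzi1[OF p] eg by (simp add: field_simps)
  show "d_v (\<lambda>p. e p * lam p) p = d_u (\<lambda>p. g p * \<nu>2 p) p
      + e p * g p * (lam p * \<gamma>1 p - eps * \<mu> p * \<beta>2 p - \<nu>1 p * \<gamma>2 p)"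
    unfolding du[OF smooth(4)] dv[OF smooth(5)] ev gu
    using codazzi2[OF p] eg by (simp add: field_simps)
  show "d_u (\<lambda>p. g p * \<mu> p) p = e p * g p * (\<mu> p * \<gamma>2 p - eps * lam p * \<beta>1 p + eps * \<nu>1 p * \<beta>2 p)"
    "d_v (\<lambda>p. e p * \<mu> p) p = e p * g p * (\<mu> p * \<gamma>1 p + eps * \<nu>2 p * \<beta>1 p - eps * lam p * \<beta>2 p)"
    unfolding du[OF smooth(6)] dv[OF smooth(6)] ev gu codazzi_\<mu>[OF p]
    by (simp_all add: algebra_simps)
  show "d_v (\<lambda>p. e p * \<beta>1 p) p = d_u (\<lambda>p. g p * \<beta>2 p) p + e p * g p * ((\<nu>1 p + \<nu>2 p) * \<mu> p)"
    unfolding du[OF smooth(8)] dv[OF smooth(7)] ev gu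
    using ricci[OF p] eg by (simp add: field_simps)
qed

text \<open>Infinitesimal motions of the moving frame: the displacements of the point along \<open>x\<close> and \<open>y\<close>,
  and the infinitesimal pseudo-rotations in the planes \<open>xy\<close>, \<open>xb\<close>, \<open>yb\<close>, \<open>yl\<close>, \<open>xl\<close>, \<open>bl\<close>.\<close>
definition "move_x = Blinfun (\<lambda>X :: frame_state. (st_x X, 0, 0, 0, 0) :: frame_state)"
definition "move_y = Blinfun (\<lambda>X :: frame_state. (st_y X, 0, 0, 0, 0) :: frame_state)"
definition "rot_xy = Blinfun (\<lambda>X :: frame_state. (0, - st_y X, - st_x X, 0, 0) :: frame_state)"
definition "rot_xb = Blinfun (\<lambda>X :: frame_state. (0, eps *\<^sub>R st_b X, 0, - st_x X, 0) :: frame_state)"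
definition "rot_yb = Blinfun (\<lambda>X :: frame_state. (0, 0, eps *\<^sub>R st_b X, st_y X, 0) :: frame_state)"
definition "rot_yl = Blinfun (\<lambda>X :: frame_state. (0, 0, - eps *\<^sub>R st_l X, 0, st_y X) :: frame_state)"
definition "rot_xl = Blinfun (\<lambda>X :: frame_state. (0, - eps *\<^sub>R st_l X, 0, 0, - st_x X) :: frame_state)"
definition "rot_bl = Blinfun (\<lambda>X :: frame_state. (0, 0, 0, - eps *\<^sub>R st_l X, - eps *\<^sub>R st_b X) :: frame_state)"

lemma motion_apply:
  "move_x X = (st_x X, 0, 0, 0, 0)"
  "move_y X = (st_y X, 0, 0, 0, 0)"
  "rot_xy X = (0, - st_y X, - st_x X, 0, 0)"
  "rot_xb X = (0, eps *\<^sub>R st_b X, 0, - st_x X, 0)"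
  "rot_yb X = (0, 0, eps *\<^sub>R st_b X, st_y X, 0)"
  "rot_yl X = (0, 0, - eps *\<^sub>R st_l X, 0, st_y X)"
  "rot_xl X = (0, - eps *\<^sub>R st_l X, 0, 0, - st_x X)"
  "rot_bl X = (0, 0, 0, - eps *\<^sub>R st_l X, - eps *\<^sub>R st_b X)"
  unfolding move_x_def move_y_def rot_xy_def rot_xb_def rot_yb_def rot_yl_def rot_xl_def rot_bl_def
  by (subst bounded_linear_Blinfun_apply;
      (intro bounded_linear_Pair bounded_linear_zero bounded_linear_minus bounded_linear_const_scaleR
        bounded_linear_fst_comp bounded_linear_snd_comp bounded_linear_ident | simp))+

definition "motion_u = combine [e, \<lambda>p. e p * \<gamma>1 p, \<lambda>p. e p * \<nu>1 p, \<lambda>p. e p * lam p, \<lambda>p. e p * \<mu> p, \<lambda>p. e p * \<beta>1 p]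
  [move_x, rot_xy, rot_xb, rot_yb, rot_yl, rot_bl]"
definition "motion_v = combine [g, \<lambda>p. g p * \<gamma>2 p, \<lambda>p. g p * lam p, \<lambda>p. g p * \<nu>2 p, \<lambda>p. g p * \<mu> p, \<lambda>p. g p * \<beta>2 p]
  [move_y, rot_xy, rot_xb, rot_yb, rot_xl, rot_bl]"

lemma smooth_motion: "smooth_on D motion_u" "smooth_on D motion_v"
  unfolding motion_u_def motion_v_def
  by (rule smooth_on_combine[OF open_D],
      auto intro!: smooth_on_mult smooth smooth_eg open_D)+

text \<open>The products \<open>A B\<close> and \<open>B A\<close> are quadratic in the coefficients, and \<open>coefficient_derivatives\<close>
  replaces the derivatives by the same quadratic expressions, except for some that occur on
  both sides.\<close>
lemma motion_compatible:
  assumes p: "p \<in> D"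
  shows "d_v motion_u p X + motion_u p (motion_v p X) = d_u motion_v p X + motion_v p (motion_u p X)"
proof -
  have diff: "c differentiable (at p)" if "smooth_on D c" for c :: "real \<times> real \<Rightarrow> real"
    using that p by (rule smooth_on_differentiable)
  have m: "smooth_on D (\<lambda>p. f p * h p)" if "smooth_on D f" "smooth_on D h" for f h :: "real \<times> real \<Rightarrow> real"
    using smooth_on_mult[OF open_D that] .
  have dv: "d_v motion_u p = combine (map d_v [e, \<lambda>p. e p * \<gamma>1 p, \<lambda>p. e p * \<nu>1 p, \<lambda>p. e p * lam p,
      \<lambda>p. e p * \<mu> p, \<lambda>p. e p * \<beta>1 p]) [move_x, rot_xy, rot_xb, rot_yb, rot_yl, rot_bl] p"
    unfolding motion_u_def
    by (subst d_v_eqI[OF has_derivative_combine]) (auto intro!: diff m smooth smooth_eg)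
  have du: "d_u motion_v p = combine (map d_u [g, \<lambda>p. g p * \<gamma>2 p, \<lambda>p. g p * lam p, \<lambda>p. g p * \<nu>2 p,
      \<lambda>p. g p * \<mu> p, \<lambda>p. g p * \<beta>2 p]) [move_y, rot_xy, rot_xb, rot_yb, rot_xl, rot_bl] p"
    unfolding motion_v_def
    by (subst d_u_eqI[OF has_derivative_combine]) (auto intro!: diff m smooth smooth_eg)
  note cd = coefficient_derivatives[OF p]
  obtain z x y b l where X: "X = (z, x, y, b, l)" by (cases X) auto
  have comb: "(a + a') W = a W + a' W" "(c *\<^sub>R a) W = c *\<^sub>R a W" "(0 :: frame_state \<Rightarrow>\<^sub>L frame_state) W = 0"
    for a a' :: "frame_state \<Rightarrow>\<^sub>L frame_state" and c W
    by (simp_all add: blinfun.bilinear_simps)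
  have "eps = 1 \<or> eps = -1" using eps by auto
  then show ?thesis
    unfolding dv du unfolding list.map cd motion_u_def motion_v_def combine_simps comb X motion_apply
    by (elim disjE) (simp_all add: motion_apply algebra_simps)
qed

text \<open>Restriction to \<open>D0\<close> makes \<open>z\<close> extensional; the derivatives on the open set \<open>D0\<close> are unaffected.\<close>
lemma local_surface_exists:
  assumes q: "q \<in> D" and on: "orthonormal_frame eps x0 y0 b0 l0"
    and or: "frame_oriented eps x0 y0 b0 l0"
  obtains D0 z x y b l where "plane_domain D0" "q \<in> D0" "D0 \<subseteq> D" "z \<in> extensional D0"
    "moving_frame D0 z x y e g eps \<gamma>1 \<gamma>2 \<nu>1 \<nu>2 lam \<mu> \<beta>1 \<beta>2 b l"
    "z q = p0" "x q = x0" "y q = y0" "b q = b0" "l q = l0"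
proof -
  obtain D0 X where D0: "plane_domain D0" "q \<in> D0" "D0 \<subseteq> D"
    and X: "smooth_on D0 X" "X q = (p0, x0, y0, b0, l0)"
      "\<And>p. p \<in> D0 \<Longrightarrow> d_u X p = motion_u p (X p)" "\<And>p. p \<in> D0 \<Longrightarrow> d_v X p = motion_v p (X p)"
    by (rule linear_pfaffian_system[OF open_D q smooth_motion motion_compatible,
          where ?X0.0 = "(p0, x0, y0, b0, l0)"]) auto
  have D0': "open D0" "connected D0" using D0(1) by (simp_all add: plane_domain_def)
  define x where "x p = st_x (X p)" for p
  define y where "y p = st_y (X p)" for p
  define b where "b p = st_b (X p)" for p
  define l where "l p = st_l (X p)" for p
  define z where "z = restrict (\<lambda>p. fst (X p)) D0"
  have z: "z p = fst (X p)" if "p \<in> D0" for p using that by (simp add: z_def)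
  have lin: "bounded_linear (fst :: frame_state \<Rightarrow> _)" "bounded_linear st_x" "bounded_linear st_y"
    "bounded_linear st_b" "bounded_linear st_l"
    by (intro bounded_linear_fst bounded_linear_fst_comp bounded_linear_snd_comp bounded_linear_ident)+
  have dX: "X differentiable (at p)" if "p \<in> D0" for p using smooth_on_differentiable[OF X(1) that] .
  have diff: "(\<lambda>p. h (X p)) differentiable (at p)" if "bounded_linear h" "p \<in> D0" for h :: "frame_state \<Rightarrow> real ^ 4" and p
    using smooth_on_differentiable[OF smooth_on_linear[OF that(1) D0'(1) X(1)] that(2)] .
  have du: "d_u (\<lambda>p. h (X p)) p = h (motion_u p (X p))" "d_v (\<lambda>p. h (X p)) p = h (motion_v p (X p))"
    if "bounded_linear h" "p \<in> D0" for h :: "frame_state \<Rightarrow> real ^ 4" and p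
    using d_u_linear[OF that(1) dX[OF that(2)]] d_v_linear[OF that(1) dX[OF that(2)]] X(3,4) that(2) by simp_all
  have mot: "motion_u p (X p) = (e p *\<^sub>R x p, e p *\<^sub>R (- (\<gamma>1 p) *\<^sub>R y p + (eps * \<nu>1 p) *\<^sub>R b p),
      e p *\<^sub>R (- (\<gamma>1 p) *\<^sub>R x p + (eps * lam p) *\<^sub>R b p - (eps * \<mu> p) *\<^sub>R l p),
      e p *\<^sub>R (- (\<nu>1 p) *\<^sub>R x p + lam p *\<^sub>R y p - (eps * \<beta>1 p) *\<^sub>R l p),
      e p *\<^sub>R (\<mu> p *\<^sub>R y p - (eps * \<beta>1 p) *\<^sub>R b p))"
    "motion_v p (X p) = (g p *\<^sub>R y p, g p *\<^sub>R (- (\<gamma>2 p) *\<^sub>R y p + (eps * lam p) *\<^sub>R b p - (eps * \<mu> p) *\<^sub>R l p),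
      g p *\<^sub>R (- (\<gamma>2 p) *\<^sub>R x p + (eps * \<nu>2 p) *\<^sub>R b p),
      g p *\<^sub>R (- (lam p) *\<^sub>R x p + \<nu>2 p *\<^sub>R y p - (eps * \<beta>2 p) *\<^sub>R l p),
      g p *\<^sub>R (- (\<mu> p) *\<^sub>R x p - (eps * \<beta>2 p) *\<^sub>R b p))" for p
    by (simp_all add: motion_u_def motion_v_def combine_simps blinfun.bilinear_simps motion_apply
        x_def y_def b_def l_def algebra_simps)
  have eqs: "frame_equations D0 x y b l"
    unfolding frame_equations_def x_def[abs_def] y_def[abs_def] b_def[abs_def] l_def[abs_def]
    using du[OF lin(2)] du[OF lin(3)] du[OF lin(4)] du[OF lin(5)]
      diff[OF lin(2)] diff[OF lin(3)] diff[OF lin(4)] diff[OF lin(5)] mot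
    by (simp add: x_def y_def b_def l_def)
  have init: "x q = x0" "y q = y0" "b q = b0" "l q = l0"
    by (simp_all add: x_def y_def b_def l_def X(2))
  have on': "orthonormal_frame eps (x p) (y p) (b p) (l p)" if "p \<in> D0" for p
    using orthonormal_frame_propagates[OF D0' that D0(2) eqs] on init by simp
  have or': "frame_oriented eps (x p) (y p) (b p) (l p)" if "p \<in> D0" for p
    using frame_oriented_propagates[OF D0' that D0(2) eqs] on or init by simp
  have "moving_frame D0 z x y e g eps \<gamma>1 \<gamma>2 \<nu>1 \<nu>2 lam \<mu> \<beta>1 \<beta>2 b l"
  proof unfold_locales
    have "smooth_on D0 (\<lambda>p. fst (X p))" by (rule smooth_on_linear[OF lin(1) D0'(1) X(1)])
    then show "smooth_on D0 z" using smooth_on_cong[OF D0'(1) z] by simp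
    show "smooth_on D0 e" "smooth_on D0 g" using smooth_eg D0(3) smooth_on_subset by blast+
    show "d_u z p = e p *\<^sub>R x p" "d_v z p = g p *\<^sub>R y p" if "p \<in> D0" for p
      using d_u_cong_open[OF D0'(1) that z] d_v_cong_open[OF D0'(1) that z] du[OF lin(1) that] mot[of p]
      by simp_all
    show "ip (x p) (x p) = 1" "ip (y p) (y p) = -1" "ip (x p) (y p) = 0" if "p \<in> D0" for p
      using orthonormal_frameD[OF on'[OF that]] by simp_all
  qed (use D0' D0(3) e_pos g_pos \<mu>_nonzero \<nu>_less eqs on' or' in auto)
  moreover have "z q = p0" using z[OF D0(2)] X(2) by simp
  moreover have "z \<in> extensional D0" by (simp add: z_def)
  ultimately show thesis using that D0 init by blast
qed

end


section \<open>Uniqueness\<close>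

lemma ip_constant_partials:
  assumes "open S" "p \<in> S" "\<And>q. q \<in> S \<Longrightarrow> ip (f q) (h q) = c"
    and "f differentiable (at p)" "h differentiable (at p)"
  shows "ip (d_u f p) (h p) = - ip (f p) (d_u h p)" "ip (d_v f p) (h p) = - ip (f p) (d_v h p)"
  using d_u_bilinear[OF bounded_bilinear_ip assms(4,5)] d_v_bilinear[OF bounded_bilinear_ip assms(4,5)]
    d_u_cong_open[OF assms(1-3)] d_v_cong_open[OF assms(1-3)] by simp_all

text \<open>Differentiating the orthonormality relations determines one half of the components of the
  derivatives of a frame by the other half.\<close>
lemma (in frame_coefficients) frame_equationsI:
  assumes S: "open S"
    and on: "\<And>p. p \<in> S \<Longrightarrow> orthonormal_frame eps (x p) (y p) (b p) (l p)"
    and diff: "\<And>p. p \<in> S \<Longrightarrow> x differentiable (at p)" "\<And>p. p \<in> S \<Longrightarrow> y differentiable (at p)"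
      "\<And>p. p \<in> S \<Longrightarrow> b differentiable (at p)" "\<And>p. p \<in> S \<Longrightarrow> l differentiable (at p)"
    and u: "\<And>p. p \<in> S \<Longrightarrow> ip (d_u x p) (y p) = e p * \<gamma>1 p" "\<And>p. p \<in> S \<Longrightarrow> ip (d_u x p) (b p) = e p * \<nu>1 p"
      "\<And>p. p \<in> S \<Longrightarrow> ip (d_u x p) (l p) = 0" "\<And>p. p \<in> S \<Longrightarrow> ip (d_u y p) (b p) = e p * lam p"
      "\<And>p. p \<in> S \<Longrightarrow> ip (d_u y p) (l p) = e p * \<mu> p" "\<And>p. p \<in> S \<Longrightarrow> ip (d_u b p) (l p) = e p * \<beta>1 p"
    and v: "\<And>p. p \<in> S \<Longrightarrow> ip (d_v x p) (y p) = g p * \<gamma>2 p" "\<And>p. p \<in> S \<Longrightarrow> ip (d_v x p) (b p) = g p * lam p"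
      "\<And>p. p \<in> S \<Longrightarrow> ip (d_v x p) (l p) = g p * \<mu> p" "\<And>p. p \<in> S \<Longrightarrow> ip (d_v y p) (b p) = g p * \<nu>2 p"
      "\<And>p. p \<in> S \<Longrightarrow> ip (d_v y p) (l p) = 0" "\<And>p. p \<in> S \<Longrightarrow> ip (d_v b p) (l p) = g p * \<beta>2 p"
  shows "frame_equations S x y b l"
  unfolding frame_equations_def
proof (intro ballI conjI diff)
  fix p assume p: "p \<in> S"
  note o = orthonormal_frameD[OF on]
  note skew = ip_constant_partials[OF S p]
  have self: "ip (f p) (d_u f p) = 0" "ip (f p) (d_v f p) = 0"
    if "\<And>q. q \<in> S \<Longrightarrow> ip (f q) (f q) = c" "f differentiable (at p)" for f :: vfield and c
    using skew[OF that(1) that(2) that(2)] ip_commute[of "f p"] by auto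
  note selfs = self[OF o(1) diff(1)[OF p]] self[OF o(2) diff(2)[OF p]] self[OF o(3) diff(3)[OF p]]
    self[OF o(4) diff(4)[OF p]]
  note skews = skew[OF o(11) diff(2)[OF p] diff(1)[OF p]] skew[OF o(12) diff(3)[OF p] diff(1)[OF p]]
    skew[OF o(13) diff(4)[OF p] diff(1)[OF p]] skew[OF o(14) diff(3)[OF p] diff(2)[OF p]]
    skew[OF o(15) diff(4)[OF p] diff(2)[OF p]] skew[OF o(16) diff(4)[OF p] diff(3)[OF p]]
  note exp = orthonormal_expansion[OF eps_sq on[OF p]]
  note uv = u[OF p] v[OF p] u[OF p, unfolded ip_commute[of "d_u _ _"]] v[OF p, unfolded ip_commute[of "d_v _ _"]]
  note all = selfs skews[unfolded ip_commute[of "d_u _ _"] ip_commute[of "d_v _ _"]] skews uv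
  show "d_u x p = e p *\<^sub>R (- \<gamma>1 p *\<^sub>R y p + (eps * \<nu>1 p) *\<^sub>R b p)"
    by (subst exp) (simp add: all algebra_simps)
  show "d_v x p = g p *\<^sub>R (- \<gamma>2 p *\<^sub>R y p + (eps * lam p) *\<^sub>R b p - (eps * \<mu> p) *\<^sub>R l p)"
    by (subst exp) (simp add: all algebra_simps)
  show "d_u y p = e p *\<^sub>R (- \<gamma>1 p *\<^sub>R x p + (eps * lam p) *\<^sub>R b p - (eps * \<mu> p) *\<^sub>R l p)"
    by (subst exp) (simp add: all algebra_simps)
  show "d_v y p = g p *\<^sub>R (- \<gamma>2 p *\<^sub>R x p + (eps * \<nu>2 p) *\<^sub>R b p)"
    by (subst exp) (simp add: all algebra_simps)
  show "d_u b p = e p *\<^sub>R (- \<nu>1 p *\<^sub>R x p + lam p *\<^sub>R y p - (eps * \<beta>1 p) *\<^sub>R l p)"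
    by (subst exp) (simp add: all algebra_simps)
  show "d_v b p = g p *\<^sub>R (- lam p *\<^sub>R x p + \<nu>2 p *\<^sub>R y p - (eps * \<beta>2 p) *\<^sub>R l p)"
    by (subst exp) (simp add: all algebra_simps)
  show "d_u l p = e p *\<^sub>R (\<mu> p *\<^sub>R y p - (eps * \<beta>1 p) *\<^sub>R b p)"
    by (subst exp) (simp add: all algebra_simps)
  show "d_v l p = g p *\<^sub>R (- \<mu> p *\<^sub>R x p - (eps * \<beta>2 p) *\<^sub>R b p)"
    by (subst exp) (simp add: all algebra_simps)
qed

lemma smooth_on_ip: "open S \<Longrightarrow> smooth_on S f \<Longrightarrow> smooth_on S h \<Longrightarrow> smooth_on S (\<lambda>p. ip (f p) (h p))"
  by (rule smooth_on_bilinear[OF bounded_bilinear_ip])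

text \<open>An arbitrary surface with prescribed geometric functions. The sign condition on \<open>H\<close> is stated as
  one inequality for both values of \<open>eps\<close>.\<close>
locale surface_with_functions =
  fixes S z eps \<gamma>1 \<gamma>2 \<nu>1 \<nu>2 lam \<mu> \<beta>1 \<beta>2
  assumes eps_cases: "eps \<in> {1, -1}"
    and lorentz: "lorentz_surface S z"
    and causal: "\<And>p. p \<in> S \<Longrightarrow> eps * ip (mean_curv z p) (mean_curv z p) > 0"
    and geo_funs: "geometric_functions S z \<gamma>1 \<gamma>2 \<nu>1 \<nu>2 lam \<mu> \<beta>1 \<beta>2"
    and smooth_lam: "smooth_on S lam" and smooth_\<mu>: "smooth_on S \<mu>"
    and \<mu>_nonzero: "\<And>p. p \<in> S \<Longrightarrow> \<mu> p \<noteq> 0"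
    and \<nu>_less: "\<And>p. p \<in> S \<Longrightarrow> \<nu>1 p - \<nu>2 p > 0"
begin

definition root_E where "root_E p = sqrt (E_coef z p)"
definition root_G where "root_G p = sqrt (- G_coef z p)"

lemma open_S: "open S" and conn_S: "connected S" and smooth_z: "smooth_on S z"
  using lorentz by (auto simp: lorentz_surface_def plane_domain_def)

lemma EG_pos: "p \<in> S \<Longrightarrow> E_coef z p > 0" "p \<in> S \<Longrightarrow> G_coef z p < 0"
  using lorentz by (auto simp: lorentz_surface_def)

lemma F_zero: "p \<in> S \<Longrightarrow> F_coef z p = 0"
  using geo_funs by (auto simp: geometric_functions_def principal_def)

lemma smooth_roots: "smooth_on S root_E" "smooth_on S root_G"
proof -
  have E: "E_coef z = (\<lambda>p. ip (d_u z p) (d_u z p))" and G: "G_coef z = (\<lambda>p. ip (d_v z p) (d_v z p))"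
    by (simp_all add: fun_eq_iff E_coef_def G_coef_def)
  have "smooth_on S (E_coef z)" "smooth_on S (G_coef z)"
    unfolding E G using smooth_z by (intro smooth_on_ip open_S smooth_on_d_u smooth_on_d_v; simp)+
  then show "smooth_on S root_E" "smooth_on S root_G"
    unfolding root_E_def[abs_def] root_G_def[abs_def] using EG_pos
    by (auto intro!: smooth_on_sqrt smooth_on_minus open_S)
qed

sublocale parametrized_frame S z "geo_x z" "geo_y z" root_E root_G
proof
  fix p assume p: "p \<in> S"
  note EG = EG_pos[OF p]
  show "root_E p > 0" "root_G p > 0" using EG by (simp_all add: root_E_def root_G_def)
  show "d_u z p = root_E p *\<^sub>R geo_x z p" "d_v z p = root_G p *\<^sub>R geo_y z p"
    using EG by (simp_all add: root_E_def root_G_def geo_x_def geo_y_def)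
  show "ip (geo_x z p) (geo_x z p) = 1"
    using EG by (simp add: geo_x_def ip_simps E_coef_def[symmetric])
  show "ip (geo_y z p) (geo_y z p) = -1"
    using EG by (simp add: geo_y_def ip_simps G_coef_def[symmetric] divide_simps)
  show "ip (geo_x z p) (geo_y z p) = 0"
    using F_zero[OF p] by (simp add: geo_x_def geo_y_def ip_simps F_coef_def)
qed (use open_S smooth_z smooth_roots in auto)

sublocale frame_coefficients eps \<gamma>1 \<gamma>2 \<nu>1 \<nu>2 lam \<mu> \<beta>1 \<beta>2 root_E root_G
  by unfold_locales (rule eps_cases)

lemma ip_normal_part:
  assumes p: "p \<in> S" and n: "n \<in> normal_space z p"
  shows "ip (normal_part z p w) n = ip w n"
proof -
  have "ip (geo_x z p) n = 0" "ip (geo_y z p) n = 0"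
    using n by (simp_all add: normal_space_iff[OF p] ip_commute)
  then show ?thesis by (simp add: normal_part_eq[OF p] ip_simps)
qed

lemma normal_part_normal: "p \<in> S \<Longrightarrow> normal_part z p w \<in> normal_space z p"
  using xy yx by (simp add: normal_space_iff normal_part_eq ip_simps)

lemma eps_of_eq: "p \<in> S \<Longrightarrow> eps_of z p = eps"
  using causal[of p] eps_cases by (auto simp: eps_of_def)

lemma geo_b_eq:
  assumes "p \<in> S"
  shows "geo_b z p = (eps / sqrt (eps * ip (mean_curv z p) (mean_curv z p))) *\<^sub>R mean_curv z p"
  using eps_of_eq[OF assms] by (simp add: geo_b_def)

lemma mean_curv_normal: "p \<in> S \<Longrightarrow> mean_curv z p \<in> normal_space z p"
  using normal_part_normal by (simp add: mean_curv_eq normal_space_iff ip_simps)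

lemma geo_b:
  assumes p: "p \<in> S"
  shows "geo_b z p \<in> normal_space z p" "ip (geo_b z p) (geo_b z p) = eps"
proof -
  show "geo_b z p \<in> normal_space z p"
    using mean_curv_normal[OF p] by (simp add: geo_b_eq[OF p] normal_space_iff[OF p] ip_simps)
  define h where "h = ip (mean_curv z p) (mean_curv z p)"
  have h: "eps * h > 0" using causal[OF p] by (simp add: h_def)
  have "ip (geo_b z p) (geo_b z p) = (eps / sqrt (eps * h)) * (eps / sqrt (eps * h)) * h"
    by (simp add: geo_b_eq[OF p] ip_simps h_def)
  also have "\<dots> = (eps * eps) * h / (sqrt (eps * h) * sqrt (eps * h))" by simp
  also have "\<dots> = h / (eps * h)" using h by (simp add: eps_sq)
  also have "\<dots> = eps" using h eps_cases by auto
  finally show "ip (geo_b z p) (geo_b z p) = eps" .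
qed

lemma geometric_frame:
  assumes p: "p \<in> S"
  shows "orthonormal_frame eps (geo_x z p) (geo_y z p) (geo_b z p) (geo_l z p)"
proof -
  have b: "ip (geo_x z p) (geo_b z p) = 0" "ip (geo_y z p) (geo_b z p) = 0"
    using geo_b(1)[OF p] by (simp_all add: normal_space_iff[OF p] ip_commute)
  obtain l where l: "orthonormal_frame eps (geo_x z p) (geo_y z p) (geo_b z p) l"
    "frame_oriented eps (geo_x z p) (geo_y z p) (geo_b z p) l"
    using unit_normal_exists[OF eps_sq xy(1)[OF p] xy(2)[OF p] geo_b(2)[OF p] xy(3)[OF p] b] by metis
  have "geo_l z p = l"
    unfolding geo_l_def eps_of_eq[OF p]
  proof (rule the_equality)
    show "l \<in> normal_space z p \<and> ip l l = - eps \<and> ip (geo_b z p) l = 0 \<and>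
        frame_oriented eps (geo_x z p) (geo_y z p) (geo_b z p) l"
      using l orthonormal_frameD[OF l(1)] by (simp add: normal_space_iff[OF p])
  next
    fix l' assume l': "l' \<in> normal_space z p \<and> ip l' l' = - eps \<and> ip (geo_b z p) l' = 0 \<and>
        frame_oriented eps (geo_x z p) (geo_y z p) (geo_b z p) l'"
    then have "orthonormal_frame eps (geo_x z p) (geo_y z p) (geo_b z p) l'"
      using orthonormal_frameD[OF l(1)] by (simp add: orthonormal_frame_def normal_space_iff[OF p] ip_commute)
    with l' show "l' = l" using unit_normal_unique[OF eps_sq l(1) _ l(2)] by blast
  qed
  then show ?thesis using l by simp
qed

lemma geo_l_normal: "p \<in> S \<Longrightarrow> geo_l z p \<in> normal_space z p"
  using orthonormal_frameD[OF geometric_frame] by (simp add: normal_space_iff)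

text \<open>The definitions of the geometric functions without normal parts, which may be dropped in an inner
  product with \<open>b\<close> or \<open>l\<close>.\<close>
lemma tangent_derivatives:
  assumes p: "p \<in> S"
  shows "ip (d_u (geo_x z) p) (geo_y z p) = root_E p * \<gamma>1 p" "ip (d_v (geo_x z) p) (geo_y z p) = root_G p * \<gamma>2 p"
    "ip (d_u (geo_x z) p) (geo_b z p) = root_E p * \<nu>1 p" "ip (d_v (geo_y z) p) (geo_b z p) = root_G p * \<nu>2 p"
    "ip (d_u (geo_y z) p) (geo_b z p) = root_E p * lam p" "ip (d_u (geo_y z) p) (geo_l z p) = root_E p * \<mu> p"
proof -
  note nt = nabla_tangent[OF p, of "geo_x z" "geo_y z"]
  have eg: "root_E p \<noteq> 0" "root_G p \<noteq> 0" using eg_pos[OF p] by auto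
  have f: "\<gamma>1 p = ip (nabla z (geo_x z) (geo_x z) p) (geo_y z p)"
    "\<gamma>2 p = ip (nabla z (geo_y z) (geo_x z) p) (geo_y z p)"
    "\<nu>1 p = ip (second_ff z (geo_x z) (geo_x z) p) (geo_b z p)"
    "\<nu>2 p = ip (second_ff z (geo_y z) (geo_y z) p) (geo_b z p)"
    "lam p = ip (second_ff z (geo_x z) (geo_y z) p) (geo_b z p)"
    "\<mu> p = ip (second_ff z (geo_x z) (geo_y z) p) (geo_l z p)"
    using geo_funs p unfolding geometric_functions_def by blast+
  show "ip (d_u (geo_x z) p) (geo_y z p) = root_E p * \<gamma>1 p" "ip (d_v (geo_x z) p) (geo_y z p) = root_G p * \<gamma>2 p"
    "ip (d_u (geo_x z) p) (geo_b z p) = root_E p * \<nu>1 p" "ip (d_v (geo_y z) p) (geo_b z p) = root_G p * \<nu>2 p"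
    "ip (d_u (geo_y z) p) (geo_b z p) = root_E p * lam p" "ip (d_u (geo_y z) p) (geo_l z p) = root_E p * \<mu> p"
    using eg by (simp_all add: f second_ff_def nt ip_simps ip_normal_part[OF p geo_b(1)[OF p]]
        ip_normal_part[OF p geo_l_normal[OF p]])
qed

text \<open>Since \<open>H\<close> is a multiple of \<open>b\<close>, the fields \<open>\<sigma>(x,x)\<close> and \<open>\<sigma>(y,y)\<close> have the same \<open>l\<close>-component;
  since \<open>M = 0\<close>, they are linearly dependent. With \<open>\<nu>\<^sub>1 \<noteq> \<nu>\<^sub>2\<close> the common component is zero.\<close>
lemma diagonal_l_components:
  assumes p: "p \<in> S"
  shows "ip (d_u (geo_x z) p) (geo_l z p) = 0" "ip (d_v (geo_y z) p) (geo_l z p) = 0"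
proof -
  let ?b = "geo_b z p" and ?l = "geo_l z p"
  note o = orthonormal_frameD[OF geometric_frame[OF p]]
  have eg: "root_E p > 0" "root_G p > 0" using eg_pos[OF p] by auto
  define t1 t2 where "t1 = ip (d_u (geo_x z) p) ?l / root_E p" and "t2 = ip (d_v (geo_y z) p) ?l / root_G p"
  have "mean_curv z p = (eps * sqrt (eps * ip (mean_curv z p) (mean_curv z p))) *\<^sub>R ?b"
    using causal[OF p] eps_cases by (auto simp: geo_b_eq[OF p])
  then obtain c where "mean_curv z p = c *\<^sub>R ?b" by blast
  then have "ip (mean_curv z p) ?l = 0" using o(10) by (simp add: ip_simps)
  then have t12: "t1 = t2"
    using eg by (simp add: mean_curv_eq[OF p] ip_simps ip_normal_part[OF p geo_l_normal[OF p]] t1_def t2_def)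
  have M: "M_coef z p n1 n2 = 0" if "normal_frame z p n1 n2" for n1 n2
    using geo_funs p that by (auto simp: geometric_functions_def principal_def)
  have "normal_frame z p ?b ?l \<or> normal_frame z p ?l ?b"
    using o eps_cases geo_b(1)[OF p] geo_l_normal[OF p] by (auto simp: normal_frame_def)
  then have "M_coef z p ?b ?l = 0 \<or> M_coef z p ?l ?b = 0" using M by blast
  then have "c11 z p ?b * c22 z p ?l - c22 z p ?b * c11 z p ?l = 0"
    using eg by (auto simp: M_coef_def EFG[OF p] mult.commute)
  moreover have "c11 z p ?b * c22 z p ?l - c22 z p ?b * c11 z p ?l
      = (root_E p)\<^sup>2 * (root_G p)\<^sup>2 * (\<nu>1 p * t2 - \<nu>2 p * t1)"
    using eg by (simp add: second_derivatives_normal[OF p geo_b(1)[OF p]]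
        second_derivatives_normal[OF p geo_l_normal[OF p]] tangent_derivatives[OF p] t1_def t2_def
        field_simps power2_eq_square)
  ultimately have "(\<nu>1 p - \<nu>2 p) * t1 = 0" using eg by (auto simp: t12 algebra_simps)
  then have "t1 = 0" using \<nu>_less[OF p] by simp
  then show "ip (d_u (geo_x z) p) ?l = 0" "ip (d_v (geo_y z) p) ?l = 0"
    using eg t12 by (simp_all add: t1_def t2_def)
qed

text \<open>The components of \<open>z_uv = z_vu\<close> along \<open>x\<close>, \<open>y\<close> and the normal space; the last one is the symmetry
  of the second fundamental form.\<close>
lemma mixed_derivatives:
  assumes p: "p \<in> S"
  shows "d_v root_E p = - (root_E p * \<gamma>1 p * root_G p)" "d_u root_G p = - (root_G p * \<gamma>2 p * root_E p)"
    "n \<in> normal_space z p \<Longrightarrow> root_E p * ip (d_v (geo_x z) p) n = root_G p * ip (d_u (geo_y z) p) n"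
proof -
  let ?x = "geo_x z p" and ?y = "geo_y z p"
  have de: "root_E differentiable (at p)" "root_G differentiable (at p)"
    using smooth_roots smooth_on_differentiable p by blast+
  have "d_u (d_v z) p = d_v (d_u z) p"
    by (rule mixed_partials_symmetric[OF open_S smooth_z p])
  then have mix: "d_v root_E p *\<^sub>R ?x + root_E p *\<^sub>R d_v (geo_x z) p
      = d_u root_G p *\<^sub>R ?y + root_G p *\<^sub>R d_u (geo_y z) p"
    using d_v_cong_open[OF open_S p z_partials(1)] d_u_cong_open[OF open_S p z_partials(2)]
      d_v_scaleR[OF de(1) diff_xy(1)[OF p]] d_u_scaleR[OF de(2) diff_xy(2)[OF p]] by simp
  have skew: "ip (d_v (geo_x z) p) ?x = 0" "ip (d_u (geo_y z) p) ?y = 0"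
    "ip (d_u (geo_y z) p) ?x = - ip (d_u (geo_x z) p) ?y"
    using ip_constant_partials[OF open_S p xy(1) diff_xy(1)[OF p] diff_xy(1)[OF p]]
      ip_constant_partials[OF open_S p xy(2) diff_xy(2)[OF p] diff_xy(2)[OF p]]
      ip_constant_partials[OF open_S p yx diff_xy(2)[OF p] diff_xy(1)[OF p]]
      ip_commute[of ?x] ip_commute[of ?y] by simp_all
  have "ip (d_v root_E p *\<^sub>R ?x + root_E p *\<^sub>R d_v (geo_x z) p) w
      = ip (d_u root_G p *\<^sub>R ?y + root_G p *\<^sub>R d_u (geo_y z) p) w" for w
    using mix by simp
  note w = this[unfolded ip_simps]
  show "d_v root_E p = - (root_E p * \<gamma>1 p * root_G p)"
    using w[of ?x] skew xy[OF p] yx[OF p] tangent_derivatives[OF p] by simp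
  show "d_u root_G p = - (root_G p * \<gamma>2 p * root_E p)"
    using w[of ?y] skew xy[OF p] yx[OF p] tangent_derivatives[OF p] by (simp add: algebra_simps)
  show "n \<in> normal_space z p \<Longrightarrow> root_E p * ip (d_v (geo_x z) p) n = root_G p * ip (d_u (geo_y z) p) n"
    using w[of n] by (simp add: normal_space_iff[OF p] ip_commute[of ?x] ip_commute[of ?y])
qed

text \<open>The field \<open>b\<close> is a smooth expression in \<open>H\<close>, which is not null. The field \<open>l\<close> is only given by a
  description at each point; since \<open>\<mu> \<noteq> 0\<close>, it can be recovered from
  \<open>\<sigma>(x,y) = eps \<lambda> b - eps \<mu> l\<close>.\<close>
lemma smooth_normal_frame: "smooth_on S (geo_b z)" "smooth_on S (geo_l z)"
proof -
  have eg: "root_E p \<noteq> 0" "root_G p \<noteq> 0" if "p \<in> S" for p using eg_pos[OF that] by auto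
  note s = open_S smooth_xy smooth_roots smooth_z smooth_on_d_u smooth_on_d_v
  have np: "smooth_on S (\<lambda>p. normal_part z p (w p))" if "smooth_on S w" for w
  proof -
    have "smooth_on S (\<lambda>p. w p - ip (w p) (geo_x z p) *\<^sub>R geo_x z p + ip (w p) (geo_y z p) *\<^sub>R geo_y z p)"
      by (intro smooth_on_add smooth_on_diff smooth_on_scaleR smooth_on_ip that s)
    then show ?thesis
      by (simp add: smooth_on_cong[OF open_S normal_part_eq])
  qed
  have "smooth_on S (\<lambda>p. (1 / 2) *\<^sub>R (normal_part z p ((1 / root_E p) *\<^sub>R d_u (geo_x z) p)
      - normal_part z p ((1 / root_G p) *\<^sub>R d_v (geo_y z) p)))"
    by (intro smooth_on_diff smooth_on_scaleR smooth_on_const np smooth_on_divide s eg)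
  then have H: "smooth_on S (mean_curv z)"
    using smooth_on_cong[OF open_S mean_curv_eq] by simp
  have "smooth_on S (\<lambda>p. (eps / sqrt (eps * ip (mean_curv z p) (mean_curv z p))) *\<^sub>R mean_curv z p)"
  proof (intro smooth_on_scaleR smooth_on_divide smooth_on_sqrt smooth_on_mult smooth_on_ip
        smooth_on_const H s causal)
    fix p assume "p \<in> S"
    from causal[OF this] show "sqrt (eps * ip (mean_curv z p) (mean_curv z p)) \<noteq> 0"
      by (metis less_irrefl real_sqrt_eq_0_iff)
  qed
  then show b: "smooth_on S (geo_b z)"
    using smooth_on_cong[OF open_S geo_b_eq] by simp
  have l: "geo_l z p = (1 / \<mu> p) *\<^sub>R (lam p *\<^sub>R geo_b z p
      - eps *\<^sub>R normal_part z p ((1 / root_E p) *\<^sub>R d_u (geo_y z) p))" if p: "p \<in> S" for p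
  proof -
    let ?w = "normal_part z p ((1 / root_E p) *\<^sub>R d_u (geo_y z) p)"
    have "ip (geo_x z p) ?w = 0" "ip (geo_y z p) ?w = 0"
      using normal_part_normal[OF p] by (simp_all add: normal_space_iff[OF p] ip_commute)
    moreover have "ip (geo_b z p) ?w = lam p" "ip (geo_l z p) ?w = \<mu> p"
      using tangent_derivatives[OF p] eg[OF p]
      by (simp_all add: ip_commute[of _ ?w] ip_normal_part[OF p geo_b(1)[OF p]]
          ip_normal_part[OF p geo_l_normal[OF p]] ip_simps)
    ultimately have w: "?w = (eps * lam p) *\<^sub>R geo_b z p - (eps * \<mu> p) *\<^sub>R geo_l z p"
      using orthonormal_expansion[OF eps_sq geometric_frame[OF p], of ?w] by simp
    have "eps *\<^sub>R ?w = (eps * eps) *\<^sub>R (lam p *\<^sub>R geo_b z p - \<mu> p *\<^sub>R geo_l z p)"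
      by (subst w) (simp add: algebra_simps)
    then have "lam p *\<^sub>R geo_b z p - eps *\<^sub>R ?w = \<mu> p *\<^sub>R geo_l z p" by (simp add: eps_sq)
    then show ?thesis using \<mu>_nonzero[OF p] by simp
  qed
  have "smooth_on S (\<lambda>p. (1 / \<mu> p) *\<^sub>R (lam p *\<^sub>R geo_b z p
      - eps *\<^sub>R normal_part z p ((1 / root_E p) *\<^sub>R d_u (geo_y z) p)))"
    by (intro smooth_on_diff smooth_on_scaleR smooth_on_const np smooth_on_divide s eg b smooth_lam smooth_\<mu> \<mu>_nonzero)
  then show "smooth_on S (geo_l z)" using smooth_on_cong[OF open_S l] by simp
qed

lemma frame_eqs: "frame_equations S (geo_x z) (geo_y z) (geo_b z) (geo_l z)"
proof (rule frame_equationsI[OF open_S geometric_frame])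
  fix p assume p: "p \<in> S"
  have eg: "root_E p \<noteq> 0" "root_G p \<noteq> 0" using eg_pos[OF p] by auto
  show db: "geo_b z differentiable (at p)" and "geo_l z differentiable (at p)"
    using smooth_normal_frame smooth_on_differentiable p by blast+
  have "\<beta>1 p = ip (nabla z (geo_x z) (geo_b z) p) (geo_l z p)"
    "\<beta>2 p = ip (nabla z (geo_y z) (geo_b z) p) (geo_l z p)"
    using geo_funs p unfolding geometric_functions_def by blast+
  then show "ip (d_u (geo_b z) p) (geo_l z p) = root_E p * \<beta>1 p"
    "ip (d_v (geo_b z) p) (geo_l z p) = root_G p * \<beta>2 p"
    using nabla_x[where X = "geo_x z", OF p refl db] nabla_y[where X = "geo_y z", OF p refl db] eg
    by (simp_all add: ip_simps)
  show "ip (d_v (geo_x z) p) (geo_b z p) = root_G p * lam p"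
    using mixed_derivatives(3)[OF p geo_b(1)[OF p]] tangent_derivatives[OF p] eg by simp
  show "ip (d_v (geo_x z) p) (geo_l z p) = root_G p * \<mu> p"
    using mixed_derivatives(3)[OF p geo_l_normal[OF p]] tangent_derivatives[OF p] eg by simp
qed (use diff_xy tangent_derivatives diagonal_l_components in auto)

text \<open>The component of \<open>x_uv = x_vu\<close> along \<open>l\<close>: differentiate \<open>\<langle>x_u, l\<rangle> = 0\<close> in \<open>v\<close> and
  \<open>\<langle>x_v, l\<rangle> = g \<mu>\<close> in \<open>u\<close>, subtract, and insert \<open>g_u = -e g \<gamma>2\<close>. In the same way \<open>y\<close> gives the second
  equation.\<close>
lemma codazzi_\<mu>:
  assumes p: "p \<in> S"
  shows "d_u \<mu> p = root_E p * (2 * \<mu> p * \<gamma>2 p - eps * lam p * \<beta>1 p + eps * \<nu>1 p * \<beta>2 p)"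
    "d_v \<mu> p = root_G p * (2 * \<mu> p * \<gamma>1 p + eps * \<nu>2 p * \<beta>1 p - eps * lam p * \<beta>2 p)"
proof -
  let ?x = "geo_x z" and ?y = "geo_y z" and ?b = "geo_b z" and ?l = "geo_l z"
  note E = frame_equationsD[OF frame_eqs p] and E' = frame_equationsD[OF frame_eqs]
  note o = orthonormal_frameD[OF geometric_frame[OF p]] and o' = orthonormal_frameD[OF geometric_frame]
  have eg: "root_E p \<noteq> 0" "root_G p \<noteq> 0" using eg_pos[OF p] by auto
  have d: "d_u ?x differentiable (at p)" "d_v ?x differentiable (at p)"
    "d_u ?y differentiable (at p)" "d_v ?y differentiable (at p)"
    "root_E differentiable (at p)" "root_G differentiable (at p)" "\<mu> differentiable (at p)"
    using smooth_on_differentiable[OF _ p] smooth_on_d_u smooth_on_d_v smooth_xy smooth_roots smooth_\<mu> by blast+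
  have mix: "d_u (d_v f) p = d_v (d_u f) p" if "smooth_on S f" for f :: vfield
    by (rule mixed_partials_symmetric[OF open_S that p])
  have l_comp: "ip (d_u ?x q) (?l q) = 0" "ip (d_v ?x q) (?l q) = root_G q * \<mu> q"
    "ip (d_u ?y q) (?l q) = root_E q * \<mu> q" "ip (d_v ?y q) (?l q) = 0" if q: "q \<in> S" for q
    using E'(5-8)[OF q] o'[OF q] eps_sq by (simp_all add: ip_simps mult.assoc[symmetric])
  have "ip (d_u (d_v ?x) p) (?l p) + ip (d_v ?x p) (d_u ?l p) = d_u (\<lambda>q. root_G q * \<mu> q) p"
    "ip (d_v (d_u ?y) p) (?l p) + ip (d_u ?y p) (d_v ?l p) = d_v (\<lambda>q. root_E q * \<mu> q) p"
    using d_u_cong_open[OF open_S p l_comp(2)] d_v_cong_open[OF open_S p l_comp(3)]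
      d_u_bilinear[OF bounded_bilinear_ip d(2) E(4)] d_v_bilinear[OF bounded_bilinear_ip d(3) E(4)] by simp_all
  moreover have "ip (d_v (d_u ?x) p) (?l p) = - ip (d_u ?x p) (d_v ?l p)"
    "ip (d_u (d_v ?y) p) (?l p) = - ip (d_v ?y p) (d_u ?l p)"
    using ip_constant_partials[OF open_S p l_comp(1) d(1) E(4)]
      ip_constant_partials[OF open_S p l_comp(4) d(4) E(4)] by simp_all
  ultimately have
    "d_u root_G p * \<mu> p + root_G p * d_u \<mu> p = ip (d_v ?x p) (d_u ?l p) - ip (d_u ?x p) (d_v ?l p)"
    "d_v root_E p * \<mu> p + root_E p * d_v \<mu> p = ip (d_u ?y p) (d_v ?l p) - ip (d_v ?y p) (d_u ?l p)"
    using mix[OF smooth_xy(1)] mix[OF smooth_xy(2)] d_u_mult[OF d(6,7)] d_v_mult[OF d(5,7)] by simp_all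
  moreover have "ip (d_v ?x p) (d_u ?l p) = root_E p * root_G p * (\<gamma>2 p * \<mu> p - (eps * eps) * eps * lam p * \<beta>1 p)"
    "ip (d_u ?x p) (d_v ?l p) = - (root_E p * root_G p * ((eps * eps) * eps * \<nu>1 p * \<beta>2 p))"
    "ip (d_u ?y p) (d_v ?l p) = root_E p * root_G p * (\<gamma>1 p * \<mu> p - (eps * eps) * eps * lam p * \<beta>2 p)"
    "ip (d_v ?y p) (d_u ?l p) = - (root_E p * root_G p * ((eps * eps) * eps * \<nu>2 p * \<beta>1 p))"
    by (simp_all add: E(5-) ip_simps o algebra_simps)
  ultimately have
    "root_G p * d_u \<mu> p = root_G p * (root_E p * (2 * \<mu> p * \<gamma>2 p - eps * lam p * \<beta>1 p + eps * \<nu>1 p * \<beta>2 p))"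
    "root_E p * d_v \<mu> p = root_E p * (root_G p * (2 * \<mu> p * \<gamma>1 p + eps * \<nu>2 p * \<beta>1 p - eps * lam p * \<beta>2 p))"
    unfolding eps_sq mixed_derivatives[OF p] by (simp_all add: algebra_simps)
  then show "d_u \<mu> p = root_E p * (2 * \<mu> p * \<gamma>2 p - eps * lam p * \<beta>1 p + eps * \<nu>1 p * \<beta>2 p)"
    "d_v \<mu> p = root_G p * (2 * \<mu> p * \<gamma>1 p + eps * \<nu>2 p * \<beta>1 p - eps * lam p * \<beta>2 p)"
    using eg by simp_all
qed

end

text \<open>Both surfaces satisfy \<open>codazzi_\<mu>\<close>. The denominators do not vanish, so both have the
  prescribed coefficients \<open>e\<close> and \<open>g\<close>, and their frames solve the same equations.\<close>
lemma (in surface_data) surface_unique: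
  assumes sub: "S \<subseteq> D" and q: "q \<in> S"
    and s1: "surface_with_functions S z eps \<gamma>1 \<gamma>2 \<nu>1 \<nu>2 lam \<mu> \<beta>1 \<beta>2"
    and s2: "surface_with_functions S z' eps \<gamma>1 \<gamma>2 \<nu>1 \<nu>2 lam \<mu> \<beta>1 \<beta>2"
    and init: "z' q = z q" "geo_x z' q = geo_x z q" "geo_y z' q = geo_y z q"
      "geo_b z' q = geo_b z q" "geo_l z' q = geo_l z q"
    and p: "p \<in> S"
  shows "z' p = z p"
proof -
  interpret s1: surface_with_functions S z eps \<gamma>1 \<gamma>2 \<nu>1 \<nu>2 lam \<mu> \<beta>1 \<beta>2 by (rule s1)
  interpret s2: surface_with_functions S z' eps \<gamma>1 \<gamma>2 \<nu>1 \<nu>2 lam \<mu> \<beta>1 \<beta>2 by (rule s2)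
  have roots: "s1.root_E p = e p" "s1.root_G p = g p" "s2.root_E p = e p" "s2.root_G p = g p"
    if "p \<in> S" for p
    using s1.codazzi_\<mu>[OF that] s2.codazzi_\<mu>[OF that] denominators[of p] sub that
    by (auto simp: e_def g_def)
  have "frame_equations S (geo_x z) (geo_y z) (geo_b z) (geo_l z)"
    "frame_equations S (geo_x z') (geo_y z') (geo_b z') (geo_l z')"
    using s1.frame_eqs s2.frame_eqs roots
    unfolding frame_equations_def s1.frame_equations_def s2.frame_equations_def by simp_all
  note xy = frame_equations_unique[OF s1.open_S s1.conn_S _ q this s1.geometric_frame[OF q] init(2-)]
  have "(\<lambda>p. z' p - z p) p = (\<lambda>p. z' p - z p) q"
  proof (rule has_derivative_zero_unique_connected[OF s1.open_S s1.conn_S _ p q])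
    fix r assume r: "r \<in> S"
    have "d_u z' r = d_u z r" "d_v z' r = d_v z r"
      using s1.z_partials[OF r] s2.z_partials[OF r] roots[OF r] xy[OF r] by simp_all
    moreover have "z differentiable (at r)" "z' differentiable (at r)"
      using smooth_on_differentiable s1.smooth_z s2.smooth_z r by blast+
    ultimately show "((\<lambda>p. z' p - z p) has_derivative (\<lambda>h. 0)) (at r)"
      using has_derivative_diff[OF has_derivative_partials has_derivative_partials, of z' r z] by simp
  qed
  then show ?thesis using init(1) by simp
qed

theorem theorem4p3:
  fixes eps :: real
    and D :: "(real \<times> real) set"
    and \<gamma>1 \<gamma>2 \<nu>1 \<nu>2 lam \<mu> \<beta>1 \<beta>2 rootE rootG :: "real \<times> real \<Rightarrow> real"
    and q0 :: "real \<times> real"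
    and p0 x0 y0 b0 l0 :: "real ^ 4"
  assumes "eps \<in> {1, -1}"
    and "plane_domain D"
    and "smooth_on D \<gamma>1" and "smooth_on D \<gamma>2" and "smooth_on D \<nu>1" and "smooth_on D \<nu>2"
    and "smooth_on D lam" and "smooth_on D \<mu>" and "smooth_on D \<beta>1" and "smooth_on D \<beta>2"
    and "\<And>p. p \<in> D \<Longrightarrow> \<mu> p \<noteq> 0"
    and "\<And>p. p \<in> D \<Longrightarrow> \<nu>1 p - \<nu>2 p > 0"
    and "rootE = (\<lambda>p. d_u \<mu> p / (2 * \<mu> p * \<gamma>2 p - eps * lam p * \<beta>1 p + eps * \<nu>1 p * \<beta>2 p))"
    and "rootG = (\<lambda>p. d_v \<mu> p / (2 * \<mu> p * \<gamma>1 p + eps * \<nu>2 p * \<beta>1 p - eps * lam p * \<beta>2 p))"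
    and "\<And>p. p \<in> D \<Longrightarrow> rootE p > 0"
    and "\<And>p. p \<in> D \<Longrightarrow> rootG p > 0"
    and "\<And>p. p \<in> D \<Longrightarrow> - \<gamma>1 p * rootE p * rootG p = d_v rootE p"
    and "\<And>p. p \<in> D \<Longrightarrow> - \<gamma>2 p * rootE p * rootG p = d_u rootG p"
    and "\<And>p. p \<in> D \<Longrightarrow>
      2 * lam p * \<gamma>2 p - eps * \<mu> p * \<beta>1 p - (\<nu>1 p + \<nu>2 p) * \<gamma>1 p
        = 1 / rootE p * d_u lam p - 1 / rootG p * d_v \<nu>1 p"
    and "\<And>p. p \<in> D \<Longrightarrow>
      2 * lam p * \<gamma>1 p - eps * \<mu> p * \<beta>2 p - (\<nu>1 p + \<nu>2 p) * \<gamma>2 p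
        = - (1 / rootE p) * d_u \<nu>2 p + 1 / rootG p * d_v lam p"
    and "\<And>p. p \<in> D \<Longrightarrow>
      \<gamma>1 p * \<beta>1 p - \<gamma>2 p * \<beta>2 p + (\<nu>1 p + \<nu>2 p) * \<mu> p
        = - (1 / rootE p) * d_u \<beta>2 p + 1 / rootG p * d_v \<beta>1 p"
    and "\<And>p. p \<in> D \<Longrightarrow>
      eps * ((lam p)\<^sup>2 - (\<mu> p)\<^sup>2 - \<nu>1 p * \<nu>2 p)
        = 1 / rootE p * d_u \<gamma>2 p - 1 / rootG p * d_v \<gamma>1 p + (\<gamma>1 p)\<^sup>2 - (\<gamma>2 p)\<^sup>2"
    and "q0 \<in> D"
    and "ip x0 x0 = 1" and "ip y0 y0 = -1" and "ip b0 b0 = eps" and "ip l0 l0 = - eps"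
    and "ip x0 y0 = 0" and "ip x0 b0 = 0" and "ip x0 l0 = 0"
    and "ip y0 b0 = 0" and "ip y0 l0 = 0" and "ip b0 l0 = 0"
    and "frame_oriented eps x0 y0 b0 l0"
  shows "\<exists>D0. plane_domain D0 \<and> D0 \<subseteq> D \<and> q0 \<in> D0 \<and>
    (\<exists>!z. z \<in> extensional D0 \<and> lorentz_surface D0 z \<and> admissible D0 z \<and>
      (\<forall>p\<in>D0. (eps = 1 \<longrightarrow> ip (mean_curv z p) (mean_curv z p) > 0) \<and>
              (eps = -1 \<longrightarrow> ip (mean_curv z p) (mean_curv z p) < 0)) \<and>
      z q0 = p0 \<and>
      geometric_functions D0 z \<gamma>1 \<gamma>2 \<nu>1 \<nu>2 lam \<mu> \<beta>1 \<beta>2 \<and>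
      geometric_frame_at D0 z q0 x0 y0 b0 l0)"
proof -
  interpret surface_data eps \<gamma>1 \<gamma>2 \<nu>1 \<nu>2 lam \<mu> \<beta>1 \<beta>2 rootE rootG D
    by unfold_locales (fact assms)+
  have on0: "orthonormal_frame eps x0 y0 b0 l0"
    unfolding orthonormal_frame_def by (intro conjI) (fact assms)+
  obtain D0 z x y b l where D0: "plane_domain D0" "q0 \<in> D0" "D0 \<subseteq> D" and ext: "z \<in> extensional D0"
    and mf: "moving_frame D0 z x y rootE rootG eps \<gamma>1 \<gamma>2 \<nu>1 \<nu>2 lam \<mu> \<beta>1 \<beta>2 b l"
    and init: "z q0 = p0" "x q0 = x0" "y q0 = y0" "b q0 = b0" "l q0 = l0"
    using local_surface_exists[OF \<open>q0 \<in> D\<close> on0 \<open>frame_oriented eps x0 y0 b0 l0\<close>, where ?p0.0 = p0] by metis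
  interpret moving_frame D0 z x y rootE rootG eps \<gamma>1 \<gamma>2 \<nu>1 \<nu>2 lam \<mu> \<beta>1 \<beta>2 b l by (rule mf)
  let ?causal = "\<lambda>z. \<forall>p\<in>D0. (eps = 1 \<longrightarrow> ip (mean_curv z p) (mean_curv z p) > 0) \<and>
      (eps = -1 \<longrightarrow> ip (mean_curv z p) (mean_curv z p) < 0)"
  have causal_z: "?causal z"
  proof (intro ballI conjI impI)
    fix p assume "p \<in> D0"
    then have "((\<nu>1 p - \<nu>2 p) / 2)\<^sup>2 > 0" using \<nu>_less[of p] D0(3) by auto
    then show "eps = 1 \<Longrightarrow> ip (mean_curv z p) (mean_curv z p) > 0"
      "eps = -1 \<Longrightarrow> ip (mean_curv z p) (mean_curv z p) < 0"
      by (simp_all add: mean_curv_square[OF \<open>p \<in> D0\<close>])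
  qed
  have frame_z: "geometric_frame_at D0 z q0 x0 y0 b0 l0"
    unfolding geometric_frame_at_def
    using principal tangent_frame[OF D0(2)] geo_b_eq[OF D0(2)] geo_l_eq[OF D0(2)] init by simp
  have surface: "surface_with_functions D0 z' eps \<gamma>1 \<gamma>2 \<nu>1 \<nu>2 lam \<mu> \<beta>1 \<beta>2"
    if "lorentz_surface D0 z'" "?causal z'" "geometric_functions D0 z' \<gamma>1 \<gamma>2 \<nu>1 \<nu>2 lam \<mu> \<beta>1 \<beta>2" for z'
  proof
    show "smooth_on D0 lam" "smooth_on D0 \<mu>" using smooth(5,6) smooth_on_subset D0(3) by blast+
    show "0 < eps * ip (mean_curv z' p) (mean_curv z' p)" if "p \<in> D0" for p
      using \<open>?causal z'\<close> that eps by auto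
  qed (use that eps \<mu>_nonzero \<nu>_less D0(3) in auto)
  have "\<exists>!z. z \<in> extensional D0 \<and> lorentz_surface D0 z \<and> admissible D0 z \<and> ?causal z \<and> z q0 = p0 \<and>
      geometric_functions D0 z \<gamma>1 \<gamma>2 \<nu>1 \<nu>2 lam \<mu> \<beta>1 \<beta>2 \<and>
      geometric_frame_at D0 z q0 x0 y0 b0 l0"
  proof (rule ex1I[of _ z])
    show "z \<in> extensional D0 \<and> lorentz_surface D0 z \<and> admissible D0 z \<and> ?causal z \<and> z q0 = p0 \<and>
        geometric_functions D0 z \<gamma>1 \<gamma>2 \<nu>1 \<nu>2 lam \<mu> \<beta>1 \<beta>2 \<and> geometric_frame_at D0 z q0 x0 y0 b0 l0"
      using ext lorentz_surface[OF D0(1)] admissible causal_z init(1) geometric_functions frame_z by blast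
  next
    fix z' assume z': "z' \<in> extensional D0 \<and> lorentz_surface D0 z' \<and> admissible D0 z' \<and> ?causal z' \<and> z' q0 = p0 \<and>
        geometric_functions D0 z' \<gamma>1 \<gamma>2 \<nu>1 \<nu>2 lam \<mu> \<beta>1 \<beta>2 \<and> geometric_frame_at D0 z' q0 x0 y0 b0 l0"
    have "z' p = z p" if "p \<in> D0" for p
    proof (rule surface_unique[OF D0(3,2) surface surface _ _ _ _ _ that])
      show "z' q0 = z q0" "geo_x z' q0 = geo_x z q0" "geo_y z' q0 = geo_y z q0"
        "geo_b z' q0 = geo_b z q0" "geo_l z' q0 = geo_l z q0"
        using z' frame_z init(1) by (auto simp: geometric_frame_at_def)
    qed (use z' lorentz_surface[OF D0(1)] causal_z geometric_functions in blast)+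
    then show "z' = z" using z' ext by (intro extensionalityI[of _ D0]) auto
  qed
  then show ?thesis using D0 by blast
qed

end
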